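(* Suppose $D\subset\mathbb{R}^N$ is a bounded open set and $\Omega\subset D$ is an open set with boundary of class $C^2$. Then there exists a constant $K>0$, depending on $\Omega,D,N$, for which we have $$\frac{|\lambda_k(\Omega)-\lambda_k(\mu_C)|}{\lambda_k(\Omega)}\le K\,C^{-1/(N+4)}.$$
   Context: Here $k\ge1$ is an integer index and $C>0$ is the penalization parameter. $\lambda_k(\Omega)$ is the $k$-th eigenvalue (counted with multiplicity) of the Dirichlet Laplacian on $\Omega$. $\mu_C$ denotes the measure $\mu_C=C\,\mathbf{1}_{\Omega^c}\,dx$, where $\mathbf{1}_{\Omega^c}$ is the characteristic function of the complement of $\Omega$, and $\lambda_k(\mu_C)$ is the $k$-th eigenvalue (counted with multiplicity) of the penalized problem $$-\Delta u+C\,\mathbf{1}_{\Omega^c}u=\lambda u\ \text{ in } D,\qquad u\in H^1_0(D),$$ equivalently $\lambda_k(\mu_C)=\min_{S_k}\max_{u\in S_k\setminus\{0\}}\frac{\int_D|\nabla u|^2+C\mathbf{1}_{D\setminus\Omega}u^2\,dx}{\int_D u^2\,dx}$, the minimum being over all $k$-dimensional subspaces $S_k$ of $H^1_0(D)$.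
   Formalization: The constant K may depend on the index k as well as on Ω, D, N; a K uniform in k is impossible (for D=(0,2π), Ω=(0,π) the quotient tends to at least 3/4 as k→∞ for every fixed C). Ω is taken nonempty. *)

theory Defs
  imports "HOL-Analysis.Analysis"
begin

primrec Ck_function :: "nat \<Rightarrow> (real ^ 'n \<Rightarrow> real) \<Rightarrow> bool" where
  "Ck_function 0 f \<longleftrightarrow> continuous_on UNIV f"
| "Ck_function (Suc m) f \<longleftrightarrow>
     (\<forall>x. f differentiable (at x)) \<and>
     (\<forall>v. Ck_function m (\<lambda>x. frechet_derivative f (at x) v))"

text \<open>
  Near each boundary point, after a rigid motion, the set is the strict epigraph of a \<open>C\<^sup>2\<close>
  function of \<open>N - 1\<close> variables; in particular it lies on one side of its boundary. The unit
  vector \<open>\<nu>\<close> is the direction of the graph axis, and \<open>\<gamma>\<close> is evaluated only on the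
  hyperplane orthogonal to \<open>\<nu>\<close>, so that defining it on the whole space loses no generality.
\<close>

definition C2_boundary :: "(real ^ 'n) set \<Rightarrow> bool" where
  "C2_boundary \<Omega> \<longleftrightarrow>
     (\<forall>p \<in> frontier \<Omega>. \<exists>r > 0. \<exists>\<nu> \<gamma>.
        norm \<nu> = 1 \<and> Ck_function 2 \<gamma> \<and>
        \<Omega> \<inter> ball p r = {y \<in> ball p r. y \<bullet> \<nu> > \<gamma> (y - (y \<bullet> \<nu>) *\<^sub>R \<nu>)})"

definition test_functions :: "(real ^ 'n) set \<Rightarrow> (real ^ 'n \<Rightarrow> real) set" where
  "test_functions U =
     {\<phi>. (\<forall>m. Ck_function m \<phi>) \<and>
         compact (closure {x. \<phi> x \<noteq> 0}) \<and> closure {x. \<phi> x \<noteq> 0} \<subseteq> U}"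

text \<open>
  Elements of Lebesgue and Sobolev spaces on \<open>U\<close> are represented by functions on the whole
  space; their values off \<open>U\<close> and on null subsets of \<open>U\<close> are irrelevant.
\<close>

definition L2_on :: "(real ^ 'n) set \<Rightarrow> (real ^ 'n \<Rightarrow> 'b::euclidean_space) set" where
  "L2_on U =
     {f \<in> borel_measurable (lebesgue_on U). integrable (lebesgue_on U) (\<lambda>x. (norm (f x))\<^sup>2)}"

definition is_weak_gradient ::
    "(real ^ 'n) set \<Rightarrow> (real ^ 'n \<Rightarrow> real) \<Rightarrow> (real ^ 'n \<Rightarrow> real ^ 'n) \<Rightarrow> bool" where
  "is_weak_gradient U u g \<longleftrightarrow>
     (\<forall>\<phi> \<in> test_functions U. \<forall>i.
        (\<integral>x. u x * frechet_derivative \<phi> (at x) (axis i 1) \<partial>lebesgue_on U) =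
        - (\<integral>x. (g x $ i) * \<phi> x \<partial>lebesgue_on U))"

definition H1 :: "(real ^ 'n) set \<Rightarrow> (real ^ 'n \<Rightarrow> real) set" where
  "H1 U = {u \<in> L2_on U. \<exists>g \<in> L2_on U. is_weak_gradient U u g}"

text \<open>For \<open>u \<in> H1 U\<close> the choice is unique up to null subsets of \<open>U\<close>.\<close>

definition weak_gradient ::
    "(real ^ 'n) set \<Rightarrow> (real ^ 'n \<Rightarrow> real) \<Rightarrow> real ^ 'n \<Rightarrow> real ^ 'n" where
  "weak_gradient U u = (SOME g. g \<in> L2_on U \<and> is_weak_gradient U u g)"

definition H1_dist :: "(real ^ 'n) set \<Rightarrow> (real ^ 'n \<Rightarrow> real) \<Rightarrow> (real ^ 'n \<Rightarrow> real) \<Rightarrow> real" where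
  "H1_dist U u v =
     sqrt (\<integral>x. (u x - v x)\<^sup>2 + (norm (weak_gradient U u x - weak_gradient U v x))\<^sup>2 \<partial>lebesgue_on U)"

definition H10 :: "(real ^ 'n) set \<Rightarrow> (real ^ 'n \<Rightarrow> real) set" where
  "H10 U =
     {u \<in> H1 U. \<exists>\<phi> :: nat \<Rightarrow> real ^ 'n \<Rightarrow> real.
        (\<forall>m. \<phi> m \<in> test_functions U) \<and> (\<lambda>m. H1_dist U (\<phi> m) u) \<longlonglongrightarrow> 0}"

text \<open>Weak solutions in \<open>H10 U\<close> of \<open>- \<Delta> u + V u = l u\<close> in \<open>U\<close>, the zero function included.\<close>

definition eigenspace ::
    "(real ^ 'n \<Rightarrow> real) \<Rightarrow> (real ^ 'n) set \<Rightarrow> real \<Rightarrow> (real ^ 'n \<Rightarrow> real) set" where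
  "eigenspace V U l =
     {u \<in> H10 U. \<forall>v \<in> H10 U.
        (\<integral>x. weak_gradient U u x \<bullet> weak_gradient U v x + V x * u x * v x \<partial>lebesgue_on U) =
        l * (\<integral>x. u x * v x \<partial>lebesgue_on U)}"

definition ae_independent :: "(real ^ 'n) set \<Rightarrow> nat \<Rightarrow> (nat \<Rightarrow> real ^ 'n \<Rightarrow> real) \<Rightarrow> bool" where
  "ae_independent U k u \<longleftrightarrow>
     (\<forall>c :: nat \<Rightarrow> real.
        (AE x in lebesgue_on U. (\<Sum>i<k. c i * u i x) = 0) \<longrightarrow> (\<forall>i<k. c i = 0))"

text \<open>
  The \<open>k\<close>-th term (\<open>k \<ge> 1\<close>) of the nondecreasing list of eigenvalues in which each
  eigenvalue is repeated as often as the dimension of its eigenspace: the least \<open>t\<close> such that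
  the eigenspaces for eigenvalues \<open>\<le> t\<close> together contain \<open>k\<close> linearly independent
  eigenfunctions. Independence is understood modulo equality almost everywhere, so it forces
  each \<open>u i\<close> to be nonzero.
\<close>

definition kth_eigenvalue :: "(real ^ 'n \<Rightarrow> real) \<Rightarrow> (real ^ 'n) set \<Rightarrow> nat \<Rightarrow> real" where
  "kth_eigenvalue V U k =
     Inf {t. \<exists>u l. ae_independent U k u \<and> (\<forall>i<k. l i \<le> t \<and> u i \<in> eigenspace V U (l i))}"

definition dirichlet_eigenvalue :: "(real ^ 'n) set \<Rightarrow> nat \<Rightarrow> real" where
  "dirichlet_eigenvalue \<Omega> k = kth_eigenvalue (\<lambda>x. 0) \<Omega> k"

definition penalized_eigenvalue :: "real \<Rightarrow> (real ^ 'n) set \<Rightarrow> (real ^ 'n) set \<Rightarrow> nat \<Rightarrow> real" where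
  "penalized_eigenvalue C \<Omega> D k = kth_eigenvalue (\<lambda>x. C * indicator (- \<Omega>) x) D k"

end

theory Submission
  imports Defs "HOL-Computational_Algebra.Polynomial" "HOL-Library.Diagonal_Subsequence"
begin

text \<open>Write \<open>\<Lambda>\<close> for the \<open>k\<close>-th Dirichlet eigenvalue of \<open>\<Omega>\<close>, \<open>\<sigma>\<close> for the \<open>k\<close>-th eigenvalue of the
  problem on \<open>D\<close> penalised with \<open>C\<close>, and \<open>N\<close> for the dimension. Since the penalisation vanishes on
  functions supported in \<open>\<Omega>\<close>, the variational principle gives \<open>\<sigma> \<le> \<Lambda>\<close>, so the quotient in the
  theorem never exceeds \<open>1\<close> and only large \<open>C\<close> matter. For these, the converse bound
  \<open>\<Lambda> \<le> (1 + K t) \<sigma>\<close> with \<open>t = C powr (- 1 / 4)\<close> is proved, and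
  \<open>C powr (- 1 / 4) \<le> C powr (- 1 / (N + 4))\<close> for \<open>C \<ge> 1\<close>.

  The converse bound comes from a linear map that moves functions into \<open>\<Omega>\<close>
  (\<open>transplantation\<close>). Cover the closure of \<open>\<Omega>\<close> by finitely many balls, take a partition of unity
  \<open>\<eta>\<^sub>i\<close> on \<open>\<Omega>\<close>, and let \<open>\<nu>\<^sub>i\<close> be the inward axis of the boundary chart in the \<open>i\<close>-th ball, or
  zero for an interior ball. The map is
  \<open>T u (x) = (\<Sum>i. \<eta>\<^sub>i(x) \<kappa>\<^sub>i(x) u(x - t \<nu>\<^sub>i))\<close>, where the cutoff \<open>\<kappa>\<^sub>i\<close> lives at distance of order
  \<open>t\<close> from the boundary: it vanishes near the boundary and outside \<open>\<Omega>\<close>, and it differs from \<open>1\<close> only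
  at points \<open>x\<close> for which \<open>x - t \<nu>\<^sub>i\<close> is outside \<open>\<Omega>\<close>. Hence the large gradient of \<open>\<kappa>\<^sub>i\<close>, of order
  \<open>1 / t\<close>, is only ever multiplied by values of \<open>u\<close> outside \<open>\<Omega>\<close>, and the integral of
  their squares is at most \<open>1 / C\<close> times the penalised energy. The main part \<open>\<Sum>i. \<eta>\<^sub>i \<kappa>\<^sub>i \<nabla>u(\<sqdot> - t \<nu>\<^sub>i)\<close> of the gradient
  costs only a factor \<open>1 + O(t)\<close> because \<open>\<eta>\<^sub>i\<close> are convex weights, and the derivatives of the
  partition act on \<open>u(\<sqdot> - t \<nu>\<^sub>i) - u\<close>, which is of order \<open>t\<close>. Separating the main part from
  the errors by Young's inequality with weight \<open>t\<close> leaves \<open>O(t)\<close> times the energy and \<open>O(1 / t ^ 3)\<close>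
  times the mass outside \<open>\<Omega>\<close>, which balance for \<open>C = 1 / t ^ 4\<close>.

  The eigenvalues are defined through eigenfunctions, so that comparing them through trial spaces
  needs the spectral theorem. It is proved for a pair of abstract quadratic forms by the direct
  method (\<open>next_eigenfunction\<close>): minimise the Rayleigh quotient on the orthogonal complement of the
  eigenfunctions found so far. Its concrete input is a description of \<open>H10\<close> as a closure of
  test functions (\<open>sobolev\<close>), completeness (\<open>L2_complete\<close>) and compactness (\<open>Rellich\<close>). The outcome
  is that the \<open>k\<close>-th eigenvalue is at most the largest Rayleigh quotient on any
  \<open>k\<close>-dimensional space of compactly supported \<open>C\<^sup>1\<close> functions (\<open>kth_eigenvalue_le\<close>), and is
  approximated by that quantity on spaces of test functions
  (\<open>kth_eigenvalue_test_space\<close>). In this form the map \<open>T\<close> is applied to test functions only.\<close>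

section \<open>Calculus of continuously differentiable functions\<close>

lemma Ck_SucI:
  assumes "\<And>x. (f has_derivative f' x) (at x)" "\<And>v. Ck_function m (\<lambda>x. f' x v)"
  shows "Ck_function (Suc m) f"
proof -
  have "f' x = frechet_derivative f (at x)" for x
    using frechet_derivative_at[OF assms(1)] .
  then show ?thesis using assms by (auto simp: differentiable_def)
qed

lemma Ck_has_derivative:
  assumes "Ck_function (Suc m) f"
  shows "(f has_derivative frechet_derivative f (at x)) (at x)"
  using assms frechet_derivative_works[of f "at x"] by auto

lemma Ck_SucD: "Ck_function (Suc m) f \<Longrightarrow> Ck_function m f"
proof (induction m arbitrary: f)
  case 0
  then show ?case
    by (auto intro: differentiable_imp_continuous_on simp: differentiable_on_def differentiable_at_withinI)
next
  case (Suc m)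
  then show ?case by auto
qed

lemma Ck_mono: "Ck_function n f \<Longrightarrow> m \<le> n \<Longrightarrow> Ck_function m f"
proof (induction n)
  case (Suc n)
  then show ?case using Ck_SucD le_Suc_eq by blast
qed auto

lemma Ck_continuous: "Ck_function m f \<Longrightarrow> continuous_on UNIV f"
  using Ck_mono[of m f 0] by simp

lemma Ck_const [intro, simp]: "Ck_function m (\<lambda>x. c)"
proof (induction m arbitrary: c)
  case (Suc m)
  show ?case by (rule Ck_SucI[of _ "\<lambda>x v. 0"]) (auto simp: Suc)
qed auto

lemma Ck_add [intro]:
  "Ck_function m f \<Longrightarrow> Ck_function m g \<Longrightarrow> Ck_function m (\<lambda>x. f x + g x)"
proof (induction m arbitrary: f g)
  case 0
  then show ?case by (auto intro: continuous_intros)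
next
  case (Suc m)
  show ?case
    by (rule Ck_SucI[OF has_derivative_add[OF Ck_has_derivative[OF Suc(2)] Ck_has_derivative[OF Suc(3)]]])
       (use Suc in auto)
qed

lemma Ck_mult [intro]:
  "Ck_function m f \<Longrightarrow> Ck_function m g \<Longrightarrow> Ck_function m (\<lambda>x. f x * g x)"
proof (induction m arbitrary: f g)
  case 0
  then show ?case by (auto intro: continuous_intros)
next
  case (Suc m)
  have "Ck_function m f" "Ck_function m g" using Suc.prems Ck_SucD by blast+
  then show ?case using Suc
    by (intro Ck_SucI[OF has_derivative_mult[OF Ck_has_derivative[OF Suc(2)] Ck_has_derivative[OF Suc(3)]]] Ck_add)
       auto
qed

lemma Ck_cmult [intro]: "Ck_function m f \<Longrightarrow> Ck_function m (\<lambda>x. c * f x)"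
  by (intro Ck_mult Ck_const)

lemma Ck_diff [intro]:
  "Ck_function m f \<Longrightarrow> Ck_function m g \<Longrightarrow> Ck_function m (\<lambda>x. f x - g x)"
  using Ck_add[of m f "\<lambda>x. (-1) * g x"] Ck_cmult[of m g "-1"] by simp

lemma Ck_sum [intro]:
  "(\<And>i. i \<in> I \<Longrightarrow> Ck_function m (f i)) \<Longrightarrow> Ck_function m (\<lambda>x. \<Sum>i\<in>I. f i x)"
  by (induction I rule: infinite_finite_induct) auto

lemma Ck_prod [intro]:
  "(\<And>i. i \<in> I \<Longrightarrow> Ck_function m (f i)) \<Longrightarrow> Ck_function m (\<lambda>x. \<Prod>i\<in>I. f i x)"
  by (induction I rule: infinite_finite_induct) auto

lemma Ck_power: "Ck_function m f \<Longrightarrow> Ck_function m (\<lambda>x. f x ^ j)"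
  by (induction j) auto

lemma Ck_inner_const [intro]: "Ck_function m (\<lambda>x. x \<bullet> a)"
proof (cases m)
  case 0
  then show ?thesis by (auto intro: continuous_intros)
next
  case (Suc n)
  show ?thesis unfolding Suc
    by (rule Ck_SucI[of _ "\<lambda>x v. v \<bullet> a"]) (auto intro!: derivative_eq_intros)
qed

lemma Ck_compose_affine:
  assumes A: "bounded_linear A"
  shows "Ck_function m f \<Longrightarrow> Ck_function m (\<lambda>x. f (A x + b))"
proof (induction m arbitrary: f)
  case 0
  then show ?case using bounded_linear.continuous_on[OF A continuous_on_id]
    by (auto intro!: continuous_intros continuous_on_compose2[of UNIV f])
next
  case (Suc m)
  have d: "((\<lambda>x. A x + b) has_derivative A) (at x)" for x
    using bounded_linear_imp_has_derivative[OF A] by (auto intro!: derivative_eq_intros)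
  have "((\<lambda>x. f (A x + b)) has_derivative (\<lambda>v. frechet_derivative f (at (A x + b)) (A v))) (at x)" for x
    using diff_chain_at[OF d Ck_has_derivative[OF Suc(2)]] by (simp add: o_def)
  then show ?case by (rule Ck_SucI) (use Suc in auto)
qed

lemma Ck_translate: "Ck_function m f \<Longrightarrow> Ck_function m (\<lambda>x. f (x - b))"
  using Ck_compose_affine[OF bounded_linear_ident, of m f "-b"] by simp

lemma Ck_reflect: "Ck_function m f \<Longrightarrow> Ck_function m (\<lambda>x. f (b - x))"
  using Ck_compose_affine[OF bounded_linear_minus[OF bounded_linear_ident], of m f b] by simp

text \<open>The successive derivatives of the outer function form a sequence \<open>h\<close>, because in the induction step
  the factor \<open>h 1 (f x)\<close> of the chain rule is the same situation for the shifted sequence.\<close>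

lemma Ck_compose_real:
  fixes h :: "nat \<Rightarrow> real \<Rightarrow> real"
  assumes "Ck_function m f"
    and "\<And>j s. j < m \<Longrightarrow> (h j has_real_derivative h (Suc j) s) (at s)"
    and "continuous_on UNIV (h m)"
  shows "Ck_function m (\<lambda>x. h 0 (f x))"
  using assms
proof (induction m arbitrary: f h)
  case 0
  then show ?case by (auto intro: continuous_on_compose2[of UNIV])
next
  case (Suc m)
  have "(h 0 has_derivative (*) (h 1 s)) (at s)" for s
    using Suc.prems(2)[of 0 s] by (simp add: has_field_derivative_def)
  from diff_chain_at[OF Ck_has_derivative[OF Suc.prems(1)] this]
  have "((\<lambda>x. h 0 (f x)) has_derivative (\<lambda>v. h 1 (f x) * frechet_derivative f (at x) v)) (at x)" for x
    by (simp add: o_def)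
  then show ?case
  proof (rule Ck_SucI)
    fix v
    have "Ck_function m (\<lambda>x. (\<lambda>j. h (Suc j)) 0 (f x))"
    proof (rule Suc.IH[of f "\<lambda>j. h (Suc j)"])
      show "Ck_function m f" using Suc.prems(1) by (rule Ck_SucD)
      show "(h (Suc j) has_real_derivative h (Suc (Suc j)) s) (at s)" if "j < m" for j s
        using Suc.prems(2)[of "Suc j" s] that by simp
      show "continuous_on UNIV (h (Suc m))" by (rule Suc.prems(3))
    qed
    then have "Ck_function m (\<lambda>x. h 1 (f x))" by simp
    then show "Ck_function m (\<lambda>x. h 1 (f x) * frechet_derivative f (at x) v)"
      using Suc.prems(1) by (intro Ck_mult) auto
  qed
qed

definition grad :: "(real ^ 'n \<Rightarrow> real) \<Rightarrow> real ^ 'n \<Rightarrow> real ^ 'n" where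
  "grad f x = (\<chi> i. frechet_derivative f (at x) (axis i 1))"

lemma frechet_eq_grad:
  assumes "f differentiable (at x)"
  shows "frechet_derivative f (at x) v = grad f x \<bullet> v"
proof -
  have l: "linear (frechet_derivative f (at x))"
    using assms by (simp add: linear_frechet_derivative)
  have "v = (\<Sum>i\<in>UNIV. v $ i *\<^sub>R axis i 1)"
    using basis_expansion[of v] by (simp add: scalar_mult_eq_scaleR)
  then have "frechet_derivative f (at x) v = frechet_derivative f (at x) (\<Sum>i\<in>UNIV. v $ i *\<^sub>R axis i 1)"
    by simp
  also have "\<dots> = (\<Sum>i\<in>UNIV. v $ i * frechet_derivative f (at x) (axis i 1))"
    by (simp add: linear_sum[OF l] linear_cmul[OF l])
  finally have "frechet_derivative f (at x) v = (\<Sum>i\<in>UNIV. v $ i * frechet_derivative f (at x) (axis i 1))" .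
  then show ?thesis
    by (simp add: grad_def inner_vec_def mult.commute)
qed

lemma has_derivative_grad:
  assumes "f differentiable (at x)"
  shows "(f has_derivative (\<lambda>v. grad f x \<bullet> v)) (at x)"
  using assms frechet_derivative_works[of f "at x"] frechet_eq_grad[OF assms]
  by (metis (no_types, lifting) ext)

lemma gradI:
  assumes "(f has_derivative (\<lambda>v. g \<bullet> v)) (at x)"
  shows "grad f x = g"
proof -
  have "frechet_derivative f (at x) = (\<lambda>v. g \<bullet> v)"
    using frechet_derivative_at[OF assms] by simp
  then show ?thesis by (simp add: grad_def inner_axis vec_eq_iff)
qed

abbreviation C1 :: "(real ^ 'n \<Rightarrow> real) \<Rightarrow> bool" where
  "C1 f \<equiv> Ck_function 1 f"

lemma C1_differentiable: "C1 f \<Longrightarrow> f differentiable (at x)"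
  by simp

lemma C1_has_derivative: "C1 f \<Longrightarrow> (f has_derivative (\<lambda>v. grad f x \<bullet> v)) (at x)"
  by (rule has_derivative_grad) simp

lemma C1_continuous_grad: "C1 f \<Longrightarrow> continuous_on UNIV (grad f)"
  unfolding grad_def by (intro continuous_on_vec_lambda) simp

lemma grad_add: "C1 f \<Longrightarrow> C1 g \<Longrightarrow> grad (\<lambda>x. f x + g x) x = grad f x + grad g x"
  by (rule gradI, drule C1_has_derivative[of f x], drule C1_has_derivative[of g x])
     (auto intro!: derivative_eq_intros simp: inner_add_left)

lemma grad_mult: "C1 f \<Longrightarrow> C1 g \<Longrightarrow> grad (\<lambda>x. f x * g x) x = f x *\<^sub>R grad g x + g x *\<^sub>R grad f x"
  by (rule gradI, drule C1_has_derivative[of f x], drule C1_has_derivative[of g x])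
     (auto intro!: derivative_eq_intros simp: inner_add_left mult.commute)

lemma grad_cmult: "C1 f \<Longrightarrow> grad (\<lambda>x. c * f x) x = c *\<^sub>R grad f x"
  by (rule gradI, drule C1_has_derivative[of f x]) (auto intro!: derivative_eq_intros)

lemma grad_sum:
  "(\<And>i. i \<in> I \<Longrightarrow> C1 (f i)) \<Longrightarrow> grad (\<lambda>x. \<Sum>i\<in>I. f i x) x = (\<Sum>i\<in>I. grad (f i) x)"
  by (rule gradI)
     (auto intro!: has_derivative_sum C1_has_derivative simp del: One_nat_def simp: inner_sum_left)

lemma grad_const [simp]: "grad (\<lambda>x. c) x = 0"
  by (rule gradI) auto

lemma grad_translate:
  assumes "C1 f"
  shows "grad (\<lambda>x. f (x - b)) x = grad f (x - b)"
proof (rule gradI)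
  have "((\<lambda>x. x - b) has_derivative (\<lambda>v. v)) (at x)" by (auto intro!: derivative_eq_intros)
  from diff_chain_at[OF this C1_has_derivative[OF assms]]
  show "((\<lambda>x. f (x - b)) has_derivative (\<bullet>) (grad f (x - b))) (at x)" by (simp add: o_def)
qed

lemma grad_local:
  assumes "open S" "x \<in> S" "\<And>y. y \<in> S \<Longrightarrow> f y = g y"
  shows "grad f x = grad g x"
proof -
  have "(f has_derivative D) (at x) \<longleftrightarrow> (g has_derivative D) (at x)" for D
    using has_derivative_transform_within_open[of f D x UNIV S g]
      has_derivative_transform_within_open[of g D x UNIV S f] assms by auto
  then show ?thesis unfolding grad_def frechet_derivative_def by simp
qed

text \<open>For \<open>p = 1\<close> this is the standard smooth function that is positive exactly on the positive
  half-line. With a polynomial factor the family is closed under differentiation.\<close>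

definition flat_exp :: "real poly \<Rightarrow> real \<Rightarrow> real" where
  "flat_exp p t = (if t > 0 then poly p (1 / t) * exp (- 1 / t) else 0)"

definition flat_exp_deriv :: "real poly \<Rightarrow> real poly" where
  "flat_exp_deriv p = [:0, 0, 1:] * (p - pderiv p)"

lemma poly_times_exp_minus: "((\<lambda>s. poly p s * exp (- s)) \<longlongrightarrow> 0) (at_top :: real filter)"
proof -
  have "((\<lambda>s. \<Sum>i\<le>degree p. coeff p i * (s ^ i / exp s)) \<longlongrightarrow> (\<Sum>i\<le>degree p. coeff p i * 0)) at_top"
    by (intro tendsto_intros tendsto_power_div_exp_0)
  then show ?thesis
    by (simp add: poly_altdef sum_distrib_right exp_minus divide_inverse mult.assoc)
qed

text \<open>At the origin the difference quotient from the right is \<open>s p(s) exp (-s)\<close> with \<open>s = 1 / h\<close>, which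
  tends to zero because the exponential beats every polynomial.\<close>

lemma flat_exp_has_derivative:
  "(flat_exp p has_real_derivative flat_exp (flat_exp_deriv p) t) (at t)"
proof -
  consider "t > 0" | "t < 0" | "t = 0" by linarith
  then show ?thesis
  proof cases
    case 1
    have "((\<lambda>t. poly p (1 / t) * exp (- 1 / t)) has_real_derivative flat_exp (flat_exp_deriv p) t) (at t)"
      using 1 by (auto intro!: derivative_eq_intros DERIV_chain2[OF poly_DERIV] simp: flat_exp_def flat_exp_deriv_def)
        (simp add: field_simps power2_eq_square)
    then show ?thesis
      by (rule has_field_derivative_transform_within_open[of _ _ _ "{0<..}"]) (use 1 in \<open>auto simp: flat_exp_def\<close>)
  next
    case 2
    have "((\<lambda>t. 0) has_real_derivative flat_exp (flat_exp_deriv p) t) (at t)"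
      using 2 by (auto simp: flat_exp_def)
    then show ?thesis
      by (rule has_field_derivative_transform_within_open[of _ _ _ "{..<0}"]) (use 2 in \<open>auto simp: flat_exp_def\<close>)
  next
    case 3
    have lim: "((\<lambda>h. flat_exp p h / h) \<longlongrightarrow> 0) (at_right 0)"
    proof -
      have "((\<lambda>h. poly (pCons 0 p) (inverse h) * exp (- inverse h)) \<longlongrightarrow> 0) (at_right (0::real))"
        using filterlim_compose[OF poly_times_exp_minus filterlim_inverse_at_top_right] .
      moreover have "\<forall>\<^sub>F h in at_right (0::real). poly (pCons 0 p) (inverse h) * exp (- inverse h) = flat_exp p h / h"
        unfolding eventually_at_right_field by (auto simp: flat_exp_def field_simps intro!: exI[of _ 1])
      ultimately show ?thesis by (rule Lim_transform_eventually)
    qed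
    moreover have "((\<lambda>h. flat_exp p h / h) \<longlongrightarrow> 0) (at_left 0)"
    proof -
      have "\<forall>\<^sub>F h in at_left (0::real). 0 = flat_exp p h / h"
        unfolding eventually_at_left_field by (auto simp: flat_exp_def intro!: exI[of _ "-1"])
      then show ?thesis by (rule Lim_transform_eventually[OF tendsto_const])
    qed
    ultimately have "((\<lambda>h. flat_exp p h / h) \<longlongrightarrow> 0) (at 0)"
      by (simp add: filterlim_split_at)
    then show ?thesis using 3 by (simp add: DERIV_def flat_exp_def)
  qed
qed

lemma Ck_flat_exp:
  assumes "\<And>m. Ck_function m f"
  shows "Ck_function m (\<lambda>x. flat_exp 1 (f x))"
proof -
  have d: "((flat_exp ((flat_exp_deriv ^^ j) 1)) has_real_derivative flat_exp ((flat_exp_deriv ^^ Suc j) 1) s) (at s)" for j s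
    using flat_exp_has_derivative[of "(flat_exp_deriv ^^ j) 1"] by simp
  have "continuous_on UNIV (flat_exp ((flat_exp_deriv ^^ m) 1))"
    by (intro continuous_at_imp_continuous_on ballI DERIV_isCont[OF d])
  then show ?thesis
    using Ck_compose_real[of m f "\<lambda>j. flat_exp ((flat_exp_deriv ^^ j) 1)", OF assms d] by simp
qed

lemma Ck_sqdist: "Ck_function m (\<lambda>x :: real ^ 'n. (x - p) \<bullet> (x - p))"
proof -
  have "(x - p) \<bullet> (x - p) = (\<Sum>i\<in>UNIV. (x \<bullet> axis i 1 - p $ i) * (x \<bullet> axis i 1 - p $ i))" for x :: "real ^ 'n"
    by (simp only: inner_axis inner_vec_def[of "x - p"]) simp
  then show ?thesis by (simp only:) (intro Ck_sum Ck_mult Ck_diff Ck_inner_const Ck_const)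
qed

lemma test_functionsI:
  assumes "\<And>m. Ck_function m f" "compact K" "K \<subseteq> U" "\<And>x. x \<notin> K \<Longrightarrow> f x = 0"
  shows "f \<in> test_functions U"
proof -
  have "{x. f x \<noteq> 0} \<subseteq> K" using assms(4) by auto
  then have c: "closure {x. f x \<noteq> 0} \<subseteq> K"
    by (rule closure_minimal) (simp add: assms(2) compact_imp_closed)
  then have "compact (closure {x. f x \<noteq> 0})"
    using assms(2) by (metis closed_closure compact_Int_closed inf.absorb2)
  then show ?thesis using c assms unfolding test_functions_def by auto
qed

lemma bump_exists:
  fixes U :: "(real ^ 'n) set"
  assumes "open U" "p \<in> U"
  shows "\<exists>b \<in> test_functions U. b p > 0 \<and> (\<forall>x. 0 \<le> b x)"
proof -
  obtain r where r: "r > 0" "cball p r \<subseteq> U"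
    using assms open_contains_cball by blast
  define b where "b = (\<lambda>x. flat_exp 1 (r\<^sup>2 - (x - p) \<bullet> (x - p)))"
  have "Ck_function m b" for m
    unfolding b_def by (intro Ck_flat_exp Ck_diff Ck_const Ck_sqdist)
  moreover have "b x = 0" if "x \<notin> cball p r" for x
  proof -
    have "r < norm (x - p)" using that by (simp add: dist_norm norm_minus_commute)
    then have "r\<^sup>2 \<le> (norm (x - p))\<^sup>2" using r by (intro power_mono) auto
    then show ?thesis by (simp add: b_def flat_exp_def power2_norm_eq_inner)
  qed
  ultimately have "b \<in> test_functions U"
    using r by (intro test_functionsI[of b "cball p r"]) auto
  moreover have "b p > 0" "\<forall>x. 0 \<le> b x" using r by (auto simp: b_def flat_exp_def)
  ultimately show ?thesis by blast
qed

text \<open>A step from \<open>0\<close> to \<open>1\<close>, constant below \<open>1/4\<close> and above \<open>3/4\<close>. It is the composition of two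
  affine images of \<open>(max 0 s)\<^sup>2\<close>, so that its derivative comes from that of one function.\<close>

definition smoothstep :: "real \<Rightarrow> real" where
  "smoothstep s = (max 0 (1 - (max 0 (3/2 - 2 * s))\<^sup>2))\<^sup>2"

definition smoothstep' :: "real \<Rightarrow> real" where
  "smoothstep' s = 8 * max 0 (1 - (max 0 (3/2 - 2 * s))\<^sup>2) * max 0 (3/2 - 2 * s)"

lemma pos_square_derivative: "((\<lambda>s. (max 0 s)\<^sup>2) has_real_derivative 2 * max 0 s) (at (s::real))"
proof -
  consider "s > 0" | "s < 0" | "s = 0" by linarith
  then show ?thesis
  proof cases
    case 1
    have "((\<lambda>s. s\<^sup>2) has_real_derivative 2 * max 0 s) (at s)"
      using 1 by (auto intro!: derivative_eq_intros)
    then show ?thesis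
      by (rule has_field_derivative_transform_within_open[of _ _ _ "{0<..}"]) (use 1 in auto)
  next
    case 2
    have "((\<lambda>s. 0) has_real_derivative 2 * max 0 s) (at s)"
      using 2 by auto
    then show ?thesis
      by (rule has_field_derivative_transform_within_open[of _ _ _ "{..<0}"]) (use 2 in auto)
  next
    case 3
    have "((\<lambda>h::real. \<bar>h\<bar>) \<longlongrightarrow> 0) (at 0)" by (intro tendsto_eq_intros) auto
    then have "((\<lambda>h::real. (max 0 h)\<^sup>2 / h) \<longlongrightarrow> 0) (at 0)"
      by (rule Lim_null_comparison[rotated]) (auto simp: eventually_at_filter max_def power2_eq_square)
    then show ?thesis using 3 by (simp add: DERIV_def)
  qed
qed

lemma smoothstep_derivative: "(smoothstep has_real_derivative smoothstep' s) (at s)"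
proof -
  have "((\<lambda>s. 3/2 - 2 * s) has_real_derivative -2) (at s)" by (auto intro!: derivative_eq_intros)
  from DERIV_diff[OF DERIV_const DERIV_chain2[OF pos_square_derivative this]]
  have "((\<lambda>s. 1 - (max 0 (3/2 - 2 * s))\<^sup>2) has_real_derivative 4 * max 0 (3/2 - 2 * s)) (at s)"
    by simp
  from DERIV_chain2[OF pos_square_derivative this]
  show ?thesis unfolding smoothstep_def[abs_def] smoothstep'_def by (simp add: mult_ac)
qed

lemma smoothstep_facts:
  "0 \<le> smoothstep s" "smoothstep s \<le> 1" "s \<le> 1/4 \<Longrightarrow> smoothstep s = 0" "s \<ge> 3/4 \<Longrightarrow> smoothstep s = 1"
  "\<bar>smoothstep' s\<bar> \<le> 8" "s \<ge> 3/4 \<Longrightarrow> smoothstep' s = 0" "s \<le> 1/4 \<Longrightarrow> smoothstep' s = 0"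
proof -
  let ?w = "max 0 (3/2 - 2 * s)"
  have q: "0 \<le> max 0 (1 - ?w\<^sup>2)" "max 0 (1 - ?w\<^sup>2) \<le> 1" by auto
  show "0 \<le> smoothstep s" by (simp add: smoothstep_def)
  show "smoothstep s \<le> 1" unfolding smoothstep_def using q by (intro power_le_one) auto
  have z: "max 0 (1 - ?w\<^sup>2) = 0" if "?w \<ge> 1"
    using one_le_power[OF that, of 2] by simp
  show "s \<le> 1/4 \<Longrightarrow> smoothstep s = 0" unfolding smoothstep_def using z by simp
  show "s \<ge> 3/4 \<Longrightarrow> smoothstep s = 1" unfolding smoothstep_def by simp
  show "s \<ge> 3/4 \<Longrightarrow> smoothstep' s = 0" unfolding smoothstep'_def by simp
  show "s \<le> 1/4 \<Longrightarrow> smoothstep' s = 0" unfolding smoothstep'_def using z by simp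
  show "\<bar>smoothstep' s\<bar> \<le> 8"
  proof (cases "?w \<ge> 1")
    case True
    then show ?thesis using z unfolding smoothstep'_def by simp
  next
    case False
    have "max 0 (1 - ?w\<^sup>2) * ?w \<le> 1 * 1" using q False by (intro mult_mono) auto
    then show ?thesis unfolding smoothstep'_def using q by (simp add: abs_mult mult.assoc)
  qed
qed

lemma smoothstep'_continuous: "continuous_on UNIV smoothstep'"
  unfolding smoothstep'_def by (intro continuous_intros)

lemma C1_smoothstep:
  assumes "C1 f"
  shows "C1 (\<lambda>x. smoothstep (f x))" "grad (\<lambda>x. smoothstep (f x)) x = smoothstep' (f x) *\<^sub>R grad f x"
proof -
  show "C1 (\<lambda>x. smoothstep (f x))"
    using Ck_compose_real[OF assms, of "\<lambda>j. if j = 0 then smoothstep else smoothstep'"]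
      smoothstep_derivative smoothstep'_continuous by auto
  have "(smoothstep has_derivative (*) (smoothstep' s)) (at s)" for s
    using smoothstep_derivative[of s] by (simp add: has_field_derivative_def)
  from diff_chain_at[OF C1_has_derivative[OF assms] this]
  show "grad (\<lambda>x. smoothstep (f x)) x = smoothstep' (f x) *\<^sub>R grad f x"
    by (intro gradI) (simp add: o_def mult.commute)
qed

declare Ck_function.simps(2) [simp del]

section \<open>Compactly supported functions and their energy\<close>

definition C1c :: "(real ^ 'n) set \<Rightarrow> (real ^ 'n \<Rightarrow> real) \<Rightarrow> bool" where
  "C1c U f \<longleftrightarrow> C1 f \<and> (\<exists>K. compact K \<and> K \<subseteq> U \<and> (\<forall>x. x \<notin> K \<longrightarrow> f x = 0))"

lemma grad_zero_outside:
  assumes "closed K" "\<And>x. x \<notin> K \<Longrightarrow> f x = 0" "x \<notin> K"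
  shows "grad f x = 0"
  using grad_local[of "- K" x f "\<lambda>x. 0"] assms by (auto simp: open_Compl)

lemma test_smooth: "f \<in> test_functions U \<Longrightarrow> Ck_function m f"
  unfolding test_functions_def by auto

lemma test_C1c: "f \<in> test_functions U \<Longrightarrow> C1c U f"
  unfolding C1c_def
proof (intro conjI exI[of _ "closure {x. f x \<noteq> 0}"] allI impI)
  fix x assume "x \<notin> closure {x. f x \<noteq> 0}"
  then show "f x = 0" using closure_subset[of "{x. f x \<noteq> 0}"] by auto
qed (auto simp: test_functions_def)

lemma C1c_mono: "C1c U f \<Longrightarrow> U \<subseteq> V \<Longrightarrow> C1c V f"
  unfolding C1c_def by blast

lemma C1c_sum:
  assumes "finite I" "\<And>i. i \<in> I \<Longrightarrow> C1c U (f i)"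
  shows "C1c U (\<lambda>x. \<Sum>i\<in>I. c i * f i x)"
proof -
  obtain K where K: "\<And>i. i \<in> I \<Longrightarrow> compact (K i) \<and> K i \<subseteq> U \<and> (\<forall>x. x \<notin> K i \<longrightarrow> f i x = 0)"
    using assms(2) unfolding C1c_def by metis
  show ?thesis unfolding C1c_def
  proof (intro conjI exI[of _ "\<Union>i\<in>I. K i"])
    show "C1 (\<lambda>x. \<Sum>i\<in>I. c i * f i x)"
      using assms(2) by (intro Ck_sum Ck_cmult) (auto simp: C1c_def)
  qed (use K assms(1) in \<open>auto intro!: compact_UN sum.neutral\<close>)
qed

lemma test_functions_sum:
  assumes "finite I" "\<And>i. i \<in> I \<Longrightarrow> f i \<in> test_functions U"
  shows "(\<lambda>x. \<Sum>i\<in>I. c i * f i x) \<in> test_functions U"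
proof -
  have "C1c U (\<lambda>x. \<Sum>i\<in>I. c i * f i x)"
    using assms by (intro C1c_sum test_C1c)
  then obtain K where "compact K" "K \<subseteq> U" "\<And>x. x \<notin> K \<Longrightarrow> (\<Sum>i\<in>I. c i * f i x) = 0"
    unfolding C1c_def by blast
  moreover have "Ck_function m (f i)" if "i \<in> I" for i m
    using test_smooth[OF assms(2)[OF that]] .
  ultimately show ?thesis
    by (intro test_functionsI[of _ K] Ck_sum Ck_cmult) auto
qed

lemma csupp_integrable:
  fixes f :: "'a::euclidean_space \<Rightarrow> 'b::{banach, second_countable_topology}"
  assumes "continuous_on UNIV f" "bounded K" "\<And>x. x \<notin> K \<Longrightarrow> f x = 0"
  shows "integrable lborel f"
proof -
  have "compact (closure K)" using assms by simp
  then have "integrable lborel (\<lambda>x. indicator (closure K) x *\<^sub>R f x)"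
    using assms by (intro borel_integrable_compact continuous_on_subset[OF assms(1)]) auto
  moreover have "indicator (closure K) x *\<^sub>R f x = f x" for x
    using assms(3)[of x] closure_subset[of K] by (cases "x \<in> closure K") auto
  ultimately show ?thesis by simp
qed

text \<open>The two constants that dominate all difference quotients: a bound of the gradient, hence a
  Lipschitz constant, and the radius of a ball outside of which everything vanishes.\<close>

lemma C1c_bounds:
  assumes "C1c UNIV f"
  obtains M R where "M \<ge> 0" "R > 0" "\<And>x. norm (grad f x) \<le> M" "\<And>x h. \<bar>f (x + h) - f x\<bar> \<le> M * norm h"
    "\<And>x. norm x > R \<Longrightarrow> f x = 0" "\<And>x. norm x > R \<Longrightarrow> grad f x = 0"
proof -
  from assms obtain K where K: "C1 f" "compact K" "\<And>x. x \<notin> K \<Longrightarrow> f x = 0"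
    unfolding C1c_def by auto
  obtain R where R: "R > 0" "\<And>x. x \<in> K \<Longrightarrow> norm x \<le> R"
    using bounded_pos[of K] K compact_imp_bounded by blast
  have g0: "grad f x = 0" if "x \<notin> K" for x
    using K that by (intro grad_zero_outside[of K]) (auto simp: compact_imp_closed)
  have "compact (grad f ` K)"
    by (rule compact_continuous_image[OF continuous_on_subset[OF C1_continuous_grad[OF K(1)] subset_UNIV] K(2)])
  then obtain M where M: "M > 0" "\<And>x. x \<in> K \<Longrightarrow> norm (grad f x) \<le> M"
    using bounded_pos[of "grad f ` K"] compact_imp_bounded by blast
  have M': "norm (grad f x) \<le> M" for x
    using M g0[of x] by (cases "x \<in> K") auto
  have "onorm (\<lambda>v. grad f x \<bullet> v) \<le> M" for x
  proof (rule onorm_le)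
    fix v show "norm (grad f x \<bullet> v) \<le> M * norm v"
      using Cauchy_Schwarz_ineq2[of "grad f x" v] mult_right_mono[OF M'[of x] norm_ge_zero[of v]]
      by simp
  qed
  then have "\<bar>f (x + h) - f x\<bar> \<le> M * norm h" for x h :: "real ^ 'a"
    using differentiable_bound[of UNIV f "\<lambda>x v. grad f x \<bullet> v" M "x + h" x] C1_has_derivative[OF K(1)]
    by auto
  note bnd = this
  show ?thesis
  proof (rule that[of M R])
    fix x :: "real ^ 'a" assume "norm x > R"
    then have "x \<notin> K" using R(2)[of x] by auto
    then show "f x = 0" "grad f x = 0" using K(3) g0 by auto
  qed (use M M' R bnd in auto)
qed

lemma borel_cont: "continuous_on UNIV f \<Longrightarrow> f \<in> borel_measurable borel"
  by (rule borel_measurable_continuous_onI)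

lemma C1c_cont:
  assumes "C1c U f"
  shows "continuous_on UNIV f" "continuous_on UNIV (grad f)" "C1 f"
  using assms C1_continuous_grad Ck_continuous unfolding C1c_def by blast+

lemma C1c_integrable_mult:
  assumes "C1c UNIV f" "continuous_on UNIV g"
  shows "integrable lborel (\<lambda>x. f x * g x)"
proof -
  obtain R where R: "\<And>x. norm x > R \<Longrightarrow> f x = 0" using C1c_bounds[OF assms(1)] by metis
  show ?thesis
    by (rule csupp_integrable[of _ "cball 0 R"])
      (use assms R C1c_cont[OF assms(1)] in \<open>auto intro!: continuous_intros\<close>)
qed

lemma C1c_integrable_grad:
  assumes "C1c UNIV f" "continuous_on UNIV g"
  shows "integrable lborel (\<lambda>x. grad f x \<bullet> g x)"
proof -
  obtain R where R: "\<And>x. norm x > R \<Longrightarrow> grad f x = 0" using C1c_bounds[OF assms(1)] by metis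
  show ?thesis
    by (rule csupp_integrable[of _ "cball 0 R"])
      (use assms R C1c_cont[OF assms(1)] in \<open>auto intro!: continuous_intros\<close>)
qed

lemma C1c_integrable_sq: "C1c UNIV f \<Longrightarrow> integrable lborel (\<lambda>x. (f x)\<^sup>2)"
  using C1c_integrable_mult[of f f] C1c_cont by (auto simp: power2_eq_square)

lemma C1c_integrable_grad_sq: "C1c UNIV f \<Longrightarrow> integrable lborel (\<lambda>x. (norm (grad f x))\<^sup>2)"
  using C1c_integrable_grad[of f "grad f"] C1c_cont by (auto simp: power2_norm_eq_inner)

lemma lborel_translate:
  fixes f :: "'a::euclidean_space \<Rightarrow> 'b::{banach, second_countable_topology}"
  assumes [measurable]: "f \<in> borel_measurable borel"
  shows "(\<integral>x. f (x + h) \<partial>lborel) = (\<integral>x. f x \<partial>lborel)"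
    "integrable lborel (\<lambda>x. f (x + h)) \<longleftrightarrow> integrable lborel f"
proof -
  show "(\<integral>x. f (x + h) \<partial>lborel) = (\<integral>x. f x \<partial>lborel)"
    using integral_distr[of "(+) h" lborel borel f] by (simp add: lborel_distr_plus add.commute)
  show "integrable lborel (\<lambda>x. f (x + h)) \<longleftrightarrow> integrable lborel f"
    using integrable_distr_eq[of "(+) h" lborel borel f] by (simp add: lborel_distr_plus add.commute)
qed

lemma lborel_reflect:
  fixes f :: "'a::euclidean_space \<Rightarrow> 'b::{banach, second_countable_topology}"
  assumes [measurable]: "f \<in> borel_measurable borel"
  shows "(\<integral>y. f (a - y) \<partial>lborel) = (\<integral>x. f x \<partial>lborel)"
proof -
  have "lborel = distr lborel borel (\<lambda>x::'a. a - x)"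
    using lborel_affine[of "-1" a] by (simp add: density_1)
  then show ?thesis
    using integral_distr[of "\<lambda>x. a - x" lborel borel f] by simp
qed

text \<open>The difference quotients of a compactly supported \<open>C\<^sup>1\<close> function are dominated by a fixed
  multiple of the indicator of a ball, so integrals of (squares of) quotients converge.\<close>

lemma difference_quotient:
  assumes f: "C1c UNIV f"
  shows "(\<lambda>n. \<integral>x. real (Suc n) * (f (x + h /\<^sub>R real (Suc n)) - f x) \<partial>lborel)
      \<longlonglongrightarrow> (\<integral>x. grad f x \<bullet> h \<partial>lborel)"
    "(\<lambda>n. \<integral>x. (real (Suc n) * (f (x + h /\<^sub>R real (Suc n)) - f x))\<^sup>2 \<partial>lborel)
      \<longlonglongrightarrow> (\<integral>x. (grad f x \<bullet> h)\<^sup>2 \<partial>lborel)"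
proof -
  obtain M R where M: "M \<ge> 0" "R > 0" "\<And>x h. \<bar>f (x + h) - f x\<bar> \<le> M * norm h"
    "\<And>x. norm x > R \<Longrightarrow> f x = 0" by (rule C1c_bounds[OF f]) blast
  note [measurable] = borel_cont[OF C1c_cont(1)[OF f]] borel_cont[OF C1c_cont(2)[OF f]]
  define q where "q = (\<lambda>n x. real (Suc n) * (f (x + h /\<^sub>R real (Suc n)) - f x))"
  define w where "w = (\<lambda>x::real^'a. indicator (cball 0 (R + norm h)) x * (M * norm h))"
  have [measurable]: "q n \<in> borel_measurable borel" for n
    unfolding q_def by measurable
  have bnd: "\<bar>q n x\<bar> \<le> w x" for n x
  proof (cases "norm x \<le> R + norm h")
    case True
    have "\<bar>q n x\<bar> = real (Suc n) * \<bar>f (x + h /\<^sub>R real (Suc n)) - f x\<bar>"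
      by (simp add: q_def abs_mult del: of_nat_Suc)
    also have "\<dots> \<le> real (Suc n) * (M * norm (h /\<^sub>R real (Suc n)))"
      by (intro mult_left_mono M) auto
    also have "\<dots> = M * norm h" by (simp add: field_simps del: of_nat_Suc)
    finally show ?thesis using True by (simp add: w_def)
  next
    case False
    have 1: "norm (h /\<^sub>R real (Suc n)) \<le> norm h"
      by (simp add: field_simps mult_left_le_one_le)
    have "norm x \<le> norm (x + h /\<^sub>R real (Suc n)) + norm (h /\<^sub>R real (Suc n))"
      by (metis norm_triangle_ineq4 add_diff_cancel)
    then have "norm (x + h /\<^sub>R real (Suc n)) > R" "norm x > R" using False 1 norm_ge_zero[of h] by linarith+
    then show ?thesis using M by (simp add: q_def w_def)
  qed
  have lim: "(\<lambda>n. q n x) \<longlonglongrightarrow> grad f x \<bullet> h" for x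
  proof -
    have "((\<lambda>t. f (x + t *\<^sub>R h)) has_derivative (\<lambda>t. grad f (x + 0 *\<^sub>R h) \<bullet> (t *\<^sub>R h))) (at 0)"
    proof -
      have "((\<lambda>t. x + t *\<^sub>R h) has_derivative (\<lambda>t. t *\<^sub>R h)) (at 0)"
        by (auto intro!: derivative_eq_intros)
      from diff_chain_at[OF this C1_has_derivative[OF C1c_cont(3)[OF f]]]
      show ?thesis by (simp add: o_def)
    qed
    moreover have "(\<lambda>t. grad f (x + 0 *\<^sub>R h) \<bullet> (t *\<^sub>R h)) = (*) (grad f x \<bullet> h)"
      by (auto simp: mult.commute)
    ultimately have "((\<lambda>t. f (x + t *\<^sub>R h)) has_real_derivative (grad f x \<bullet> h)) (at 0)"
      by (simp add: has_field_derivative_def)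
    then have "((\<lambda>t. (f (x + t *\<^sub>R h) - f x) / t) \<longlongrightarrow> grad f x \<bullet> h) (at 0)"
      by (simp add: DERIV_def)
    moreover have "filterlim (\<lambda>n. inverse (real (Suc n))) (at 0) sequentially"
      using LIMSEQ_inverse_real_of_nat by (auto simp: filterlim_at simp del: of_nat_Suc)
    ultimately have "(\<lambda>n. (f (x + inverse (real (Suc n)) *\<^sub>R h) - f x) / inverse (real (Suc n))) \<longlonglongrightarrow> grad f x \<bullet> h"
      by (rule filterlim_compose)
    then show ?thesis by (simp add: q_def divide_inverse mult.commute del: of_nat_Suc)
  qed
  have wi: "integrable lborel w" "integrable lborel (\<lambda>x. (w x)\<^sup>2)"
  proof -
    have "integrable lborel (indicator (cball 0 (R + norm h)) :: real ^ 'a \<Rightarrow> real)"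
      by (intro integrable_real_indicator emeasure_bounded_finite) auto
    moreover have "(indicator (cball 0 (R + norm h)) x :: real)\<^sup>2 = indicator (cball 0 (R + norm h)) x" for x :: "real ^ 'a"
      by (simp add: indicator_def)
    ultimately show "integrable lborel w" "integrable lborel (\<lambda>x. (w x)\<^sup>2)"
      unfolding w_def power_mult_distrib by (auto intro!: integrable_mult_left)
  qed
  show "(\<lambda>n. \<integral>x. real (Suc n) * (f (x + h /\<^sub>R real (Suc n)) - f x) \<partial>lborel)
      \<longlonglongrightarrow> (\<integral>x. grad f x \<bullet> h \<partial>lborel)"
  proof -
    have "(\<lambda>n. integral\<^sup>L lborel (q n)) \<longlonglongrightarrow> (\<integral>x. grad f x \<bullet> h \<partial>lborel)"
      using bnd lim wi by (intro integral_dominated_convergence[where w=w]) auto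
    then show ?thesis unfolding q_def .
  qed
  show "(\<lambda>n. \<integral>x. (real (Suc n) * (f (x + h /\<^sub>R real (Suc n)) - f x))\<^sup>2 \<partial>lborel)
      \<longlonglongrightarrow> (\<integral>x. (grad f x \<bullet> h)\<^sup>2 \<partial>lborel)"
  proof -
    have "(q i x)\<^sup>2 \<le> (w x)\<^sup>2" for i x
      using power_mono[OF bnd[of i x], of 2] by simp
    moreover have "(\<lambda>n. (q n x)\<^sup>2) \<longlonglongrightarrow> (grad f x \<bullet> h)\<^sup>2" for x
      by (intro tendsto_intros lim)
    ultimately have "(\<lambda>n. integral\<^sup>L lborel (\<lambda>x. (q n x)\<^sup>2)) \<longlonglongrightarrow> (\<integral>x. (grad f x \<bullet> h)\<^sup>2 \<partial>lborel)"
      using wi by (intro integral_dominated_convergence[where w="\<lambda>x. (w x)\<^sup>2"]) auto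
    then show ?thesis unfolding q_def .
  qed
qed

text \<open>By translation invariance every difference quotient has integral zero.\<close>

lemma integral_grad_zero:
  assumes f: "C1c UNIV f"
  shows "(\<integral>x. grad f x \<bullet> h \<partial>lborel) = 0"
proof -
  note [measurable] = borel_cont[OF C1c_cont(1)[OF f]]
  have i: "integrable lborel f" using C1c_integrable_mult[OF f, of "\<lambda>x. 1"] by simp
  have "(\<integral>x. real (Suc n) * (f (x + h /\<^sub>R real (Suc n)) - f x) \<partial>lborel) = 0" for n
    using i lborel_translate[of f "h /\<^sub>R real (Suc n)"] by simp
  then show ?thesis
    using difference_quotient(1)[OF f, of h] LIMSEQ_unique[OF _ tendsto_const[of 0]] by simp
qed

lemma C1c_mult:
  assumes "C1c U f" "C1 g"
  shows "C1c U (\<lambda>x. f x * g x)" "C1c U (\<lambda>x. g x * f x)"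
  using assms unfolding C1c_def by (auto simp del: One_nat_def)

lemma integral_by_parts:
  assumes f: "C1c UNIV f" and g: "C1 g"
  shows "(\<integral>x. f x * (grad g x \<bullet> h) \<partial>lborel) = - (\<integral>x. g x * (grad f x \<bullet> h) \<partial>lborel)"
proof -
  have c: "continuous_on UNIV g" "continuous_on UNIV (grad g)"
    using g Ck_continuous C1_continuous_grad by blast+
  have e: "grad (\<lambda>x. f x * g x) x \<bullet> h = f x * (grad g x \<bullet> h) + g x * (grad f x \<bullet> h)" for x
    using grad_mult[OF C1c_cont(3)[OF f] g] by (simp add: inner_add_left)
  have "integrable lborel (\<lambda>x. f x * (grad g x \<bullet> h))"
    by (intro C1c_integrable_mult[OF f] continuous_intros c)
  moreover have "integrable lborel (\<lambda>x. g x * (grad f x \<bullet> h))"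
    using C1c_integrable_grad[OF f, of "\<lambda>x. g x *\<^sub>R h", OF continuous_on_scaleR[OF c(1) continuous_on_const]]
    by simp
  ultimately show ?thesis
    using integral_grad_zero[OF C1c_mult(1)[OF f g], of h] by (simp add: e)
qed

definition energy :: "(real ^ 'n \<Rightarrow> real) \<Rightarrow> real" where
  "energy f = (\<integral>x. (norm (grad f x))\<^sup>2 \<partial>lborel)"

lemma energy_nonneg: "energy f \<ge> 0"
  by (simp add: energy_def)

text \<open>The increment over \<open>h\<close> is the sum of \<open>n\<close> increments over \<open>h / n\<close>. By the Cauchy--Schwarz
  inequality and translation invariance, the left-hand side is at most the integral of the squared
  difference quotient at scale \<open>1 / n\<close>, which converges to that of the squared derivative in
  direction \<open>h\<close>.\<close>

lemma translation_estimate: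
  fixes f :: "real ^ 'n \<Rightarrow> real"
  assumes f: "C1c UNIV f"
  shows "(\<integral>x. (f (x + h) - f x)\<^sup>2 \<partial>lborel) \<le> (norm h)\<^sup>2 * energy f"
proof -
  note cf = C1c_cont(1)[OF f]
  note [measurable] = borel_cont[OF cf]
  have sqi: "integrable lborel (\<lambda>x. (f (x + a) - f x)\<^sup>2)" for a :: "real ^ 'n"
  proof -
    obtain R where R: "\<And>x. norm x > R \<Longrightarrow> f x = 0" using C1c_bounds[OF f] by metis
    show ?thesis
    proof (rule csupp_integrable[of _ "cball 0 (R + norm a)"])
      fix x :: "real ^ 'n" assume "x \<notin> cball 0 (R + norm a)"
      then have "norm x > R + norm a" by simp
      moreover have "norm x \<le> norm (x + a) + norm a"
        by (metis norm_triangle_ineq4 add_diff_cancel)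
      ultimately have "norm (x + a) > R" "norm x > R" using norm_ge_zero[of a] by linarith+
      then show "(f (x + a) - f x)\<^sup>2 = 0" using R by simp
    qed (use cf in \<open>auto intro!: continuous_intros intro: continuous_on_compose2[of UNIV f]\<close>)
  qed
  have step: "(\<integral>x. (f (x + h) - f x)\<^sup>2 \<partial>lborel)
      \<le> (\<integral>x. (real (Suc n) * (f (x + h /\<^sub>R real (Suc n)) - f x))\<^sup>2 \<partial>lborel)" (is "?L \<le> ?R n") for n
  proof -
    define N where "N = Suc n"
    define d where "d = h /\<^sub>R real N"
    have N: "real N *\<^sub>R d = h" by (simp add: d_def N_def)
    have tel: "f (x + h) - f x = (\<Sum>j<N. f (x + real j *\<^sub>R d + d) - f (x + real j *\<^sub>R d))" for x
      using sum_lessThan_telescope[of "\<lambda>j. f (x + real j *\<^sub>R d)" N] N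
      by (simp add: algebra_simps)
    have "(f (x + h) - f x)\<^sup>2 \<le> real N * (\<Sum>j<N. (f (x + real j *\<^sub>R d + d) - f (x + real j *\<^sub>R d))\<^sup>2)" for x
      unfolding tel using Cauchy_Schwarz_ineq_sum[of "\<lambda>j. 1" "\<lambda>j. f (x + real j *\<^sub>R d + d) - f (x + real j *\<^sub>R d)" "{..<N}"]
      by simp
    moreover have ti: "integrable lborel (\<lambda>x. (f (x + b + d) - f (x + b))\<^sup>2)"
      "(\<integral>x. (f (x + b + d) - f (x + b))\<^sup>2 \<partial>lborel) = (\<integral>x. (f (x + d) - f x)\<^sup>2 \<partial>lborel)" for b
      using lborel_translate[of "\<lambda>x. (f (x + d) - f x)\<^sup>2" b] sqi[of d] by auto
    ultimately have "?L \<le> (\<integral>x. real N * (\<Sum>j<N. (f (x + real j *\<^sub>R d + d) - f (x + real j *\<^sub>R d))\<^sup>2) \<partial>lborel)"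
      using sqi by (intro integral_mono) auto
    also have "\<dots> = (real N)\<^sup>2 * (\<integral>x. (f (x + d) - f x)\<^sup>2 \<partial>lborel)"
      using ti by (simp add: power2_eq_square)
    also have "\<dots> = ?R n"
      by (simp add: d_def N_def power_mult_distrib del: of_nat_Suc)
    finally show ?thesis .
  qed
  have "(\<integral>x. (f (x + h) - f x)\<^sup>2 \<partial>lborel) \<le> (\<integral>x. (grad f x \<bullet> h)\<^sup>2 \<partial>lborel)"
    using LIMSEQ_le_const[OF difference_quotient(2)[OF f]] step by blast
  also have "\<dots> \<le> (\<integral>x. (norm h)\<^sup>2 * (norm (grad f x))\<^sup>2 \<partial>lborel)"
  proof (rule integral_mono)
    show "integrable lborel (\<lambda>x. (grad f x \<bullet> h)\<^sup>2)"
      using C1c_integrable_grad[OF f continuous_on_scaleR[OF continuous_on_inner[OF C1c_cont(2)[OF f]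
          continuous_on_const] continuous_on_const], of h h]
      by (simp add: power2_eq_square)
    show "integrable lborel (\<lambda>x. (norm h)\<^sup>2 * (norm (grad f x))\<^sup>2)"
      using C1c_integrable_grad_sq[OF f] by auto
    show "(grad f x \<bullet> h)\<^sup>2 \<le> (norm h)\<^sup>2 * (norm (grad f x))\<^sup>2" for x
      using Cauchy_Schwarz_ineq[of "grad f x" h] by (simp add: power2_norm_eq_inner mult.commute)
  qed
  finally show ?thesis by (simp add: energy_def)
qed

section \<open>Mollification\<close>

definition mollify :: "(real ^ 'n \<Rightarrow> real) \<Rightarrow> (real ^ 'n \<Rightarrow> real) \<Rightarrow> real ^ 'n \<Rightarrow> real" where
  "mollify \<rho> f x = (\<integral>y. f y * \<rho> (x - y) \<partial>lborel)"

text \<open>Differentiation under the integral sign over a box that contains the support of \<open>f\<close>.\<close>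

lemma mollify_has_derivative:
  fixes f :: "real ^ 'n \<Rightarrow> real"
  assumes f: "continuous_on UNIV f" "bounded K" "\<And>x. x \<notin> K \<Longrightarrow> f x = 0" and r: "C1 \<rho>"
  shows "(mollify \<rho> f has_derivative (\<lambda>v. mollify (\<lambda>x. frechet_derivative \<rho> (at x) v) f x)) (at x)"
proof -
  obtain a where a: "K \<subseteq> cbox (- a) a"
    using bounded_subset_cbox_symmetric[OF f(2)] by blast
  have eq: "(\<integral>y. f y * g y \<partial>lborel) = integral (cbox (-a) a) (\<lambda>y. f y * g y)"
    if "continuous_on UNIV g" for g
  proof -
    have "set_integrable lborel (cbox (-a) a) (\<lambda>y. f y * g y)"
      unfolding set_integrable_def
      by (intro borel_integrable_compact) (auto intro!: continuous_intros continuous_on_subset[OF f(1)] continuous_on_subset[OF that])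
    from set_borel_integral_eq_integral(2)[OF this]
    have "integral (cbox (-a) a) (\<lambda>y. f y * g y) = (\<integral>y. indicator (cbox (-a) a) y * (f y * g y) \<partial>lborel)"
      by (simp add: set_lebesgue_integral_def)
    also have "(\<lambda>y. indicator (cbox (-a) a) y * (f y * g y)) = (\<lambda>y. f y * g y)"
      using f(3) a by (fastforce simp: indicator_def)
    finally show ?thesis by simp
  qed
  define F where "F = (\<lambda>x t. blinfun_inner_right (f t *\<^sub>R grad \<rho> (x - t)))"
  have cr: "continuous_on UNIV \<rho>" "continuous_on UNIV (grad \<rho>)"
    using r Ck_continuous C1_continuous_grad by blast+
  have cF: "continuous_on (UNIV \<times> cbox (-a) a) (\<lambda>(x, t). F x t)"
    unfolding F_def split_beta
    by (intro bounded_linear.continuous_on[OF bounded_linear_blinfun_inner_right] continuous_intros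
        continuous_on_compose2[OF f(1)] continuous_on_compose2[OF cr(2)]) auto
  have "((\<lambda>x. integral (cbox (-a) a) (\<lambda>t. f t * \<rho> (x - t))) has_derivative
      blinfun_apply (integral (cbox (-a) a) (F x))) (at x within UNIV)"
  proof (rule leibniz_rule[OF _ _ cF])
    fix x t :: "real ^ 'n"
    have "((\<lambda>x. x - t) has_derivative (\<lambda>v. v)) (at x)" by (auto intro!: derivative_eq_intros)
    from diff_chain_at[OF this C1_has_derivative[OF r]]
    have "((\<lambda>x. \<rho> (x - t)) has_derivative (\<bullet>) (grad \<rho> (x - t))) (at x)" by (simp add: o_def)
    from has_derivative_mult_right[OF this, of "f t"]
    moreover have "(\<lambda>v. f t * (grad \<rho> (x - t) \<bullet> v)) = (\<bullet>) (f t *\<^sub>R grad \<rho> (x - t))" by auto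
    ultimately show "((\<lambda>x. f t * \<rho> (x - t)) has_derivative blinfun_apply (F x t)) (at x within UNIV)"
      unfolding F_def blinfun_inner_right.rep_eq by simp
    show "(\<lambda>t. f t * \<rho> (x - t)) integrable_on cbox (-a) a"
      by (intro integrable_continuous continuous_intros continuous_on_compose2[OF f(1)] continuous_on_compose2[OF cr(1)]) auto
  qed auto
  moreover have "blinfun_apply (integral (cbox (-a) a) (F x)) v = mollify (\<lambda>x. frechet_derivative \<rho> (at x) v) f x" for v
  proof -
    have fe: "frechet_derivative \<rho> (at x) v = grad \<rho> x \<bullet> v" for x
      by (rule frechet_eq_grad[OF C1_differentiable[OF r]])
    have "continuous_on (cbox (-a) a) (\<lambda>t. (x, t))" by (intro continuous_intros)
    from continuous_on_compose2[OF cF this] have cx: "continuous_on (cbox (-a) a) (F x)"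
      by auto
    have "blinfun_apply (integral (cbox (-a) a) (F x)) v = integral (cbox (-a) a) (\<lambda>t. blinfun_apply (F x t) v)"
      by (rule blinfun_apply_integral[OF integrable_continuous[OF cx]])
    also have "\<dots> = integral (cbox (-a) a) (\<lambda>t. f t * (grad \<rho> (x - t) \<bullet> v))"
      by (simp add: F_def blinfun_inner_right.rep_eq)
    also have "\<dots> = (\<integral>t. f t * (grad \<rho> (x - t) \<bullet> v) \<partial>lborel)"
      by (intro eq[symmetric] continuous_intros continuous_on_compose2[OF cr(2)]) auto
    finally show ?thesis unfolding mollify_def fe .
  qed
  moreover have "mollify \<rho> f = (\<lambda>x. integral (cbox (-a) a) (\<lambda>t. f t * \<rho> (x - t)))"
    unfolding mollify_def by (intro ext eq continuous_on_compose2[OF cr(1)] continuous_intros) auto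
  ultimately show ?thesis by (metis (no_types, lifting) ext)
qed

lemma mollify_smooth:
  assumes f: "continuous_on UNIV f" "bounded K" "\<And>x. x \<notin> K \<Longrightarrow> f x = 0"
  shows "(\<And>m. Ck_function m \<rho>) \<Longrightarrow> Ck_function m (mollify \<rho> f)"
proof (induction m arbitrary: \<rho>)
  case 0
  have "mollify \<rho> f differentiable (at x)" for x
    using mollify_has_derivative[OF f 0, of x] by (auto simp: differentiable_def)
  then show ?case
    by (simp add: differentiable_imp_continuous_on differentiable_on_def)
next
  case (Suc m)
  have "Ck_function j (\<lambda>x. frechet_derivative \<rho> (at x) v)" for j v
    using Suc.prems[of "Suc j"] by (simp add: Ck_function.simps(2))
  then show ?case
    by (intro Ck_SucI[OF mollify_has_derivative[OF f Suc.prems]] Suc.IH)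
qed

text \<open>The derivative falls on \<open>\<rho>\<close> first; integration by parts moves it to \<open>f\<close>, where uniform continuity of
  the gradient of \<open>f\<close> can be used.\<close>

lemma grad_mollify:
  assumes f: "C1c UNIV f" and r: "C1 \<rho>"
  shows "grad (mollify \<rho> f) x $ i = mollify \<rho> (\<lambda>y. grad f y $ i) x"
proof -
  obtain R where R: "\<And>x. norm x > R \<Longrightarrow> f x = 0" using C1c_bounds[OF f] by metis
  have "frechet_derivative (mollify \<rho> f) (at x) (axis i 1) = mollify (\<lambda>x. frechet_derivative \<rho> (at x) (axis i 1)) f x"
  proof -
    have "(\<lambda>v. mollify (\<lambda>x. frechet_derivative \<rho> (at x) v) f x) = frechet_derivative (mollify \<rho> f) (at x)"
      by (rule frechet_derivative_at, rule mollify_has_derivative[OF C1c_cont(1)[OF f], of "cball 0 R"])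
        (use R r in auto)
    then show ?thesis by (rule fun_cong[symmetric])
  qed
  also have "\<dots> = (\<integral>y. f y * (grad \<rho> (x - y) \<bullet> axis i 1) \<partial>lborel)"
    using frechet_eq_grad[OF C1_differentiable[OF r]] by (simp add: mollify_def)
  also have "\<dots> = (\<integral>y. f y * (grad (\<lambda>y. \<rho> (x - y)) y \<bullet> (- axis i 1)) \<partial>lborel)"
  proof -
    have "grad (\<lambda>y. \<rho> (x - y)) y = - grad \<rho> (x - y)" for y
    proof (rule gradI)
      have "((\<lambda>y. x - y) has_derivative (\<lambda>v. - v)) (at y)" by (auto intro!: derivative_eq_intros)
      from diff_chain_at[OF this C1_has_derivative[OF r]]
      moreover have "(\<lambda>v. - (grad \<rho> (x - y) \<bullet> v)) = (\<bullet>) (- grad \<rho> (x - y))" by auto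
      ultimately show "((\<lambda>y. \<rho> (x - y)) has_derivative (\<bullet>) (- grad \<rho> (x - y))) (at y)"
        by (simp add: o_def)
    qed
    then show ?thesis by simp
  qed
  also have "\<dots> = - (\<integral>y. \<rho> (x - y) * (grad f y \<bullet> (- axis i 1)) \<partial>lborel)"
    by (rule integral_by_parts[OF f Ck_reflect[OF r]])
  also have "\<dots> = mollify \<rho> (\<lambda>y. grad f y $ i) x"
    by (simp add: mollify_def inner_axis mult.commute)
  finally show ?thesis by (simp add: grad_def)
qed

lemma continuous_AE_zero:
  fixes f :: "'a::euclidean_space \<Rightarrow> real"
  assumes "open U" "continuous_on U f" "AE x in lebesgue_on U. f x = 0" "x \<in> U"
  shows "f x = 0"
proof (rule ccontr)
  assume x: "f x \<noteq> 0"
  define S where "S = {x \<in> U. f x \<in> - {0}}"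
  have "open S" unfolding S_def
    using continuous_open_preimage[OF assms(2,1), of "- {0}"] by (simp add: vimage_def Int_def open_Compl)
  moreover have "AE x in lebesgue. x \<in> U \<longrightarrow> f x = 0"
    using assms(1,3) by (subst (asm) AE_restrict_space_iff) auto
  then have "negligible S"
    unfolding negligible_iff_null_sets S_def completion.AE_iff_null_sets
    by (rule rev_iffD1) (auto intro!: arg_cong[of _ _ "\<lambda>S. S \<in> null_sets lebesgue"])
  ultimately show False
    using open_not_negligible[of S] x assms(4) by (auto simp: S_def)
qed

lemma mollifier_exists:
  assumes "\<delta> > 0"
  obtains \<rho> :: "real ^ 'n \<Rightarrow> real" where "\<And>m. Ck_function m \<rho>" "\<And>x. \<rho> x \<ge> 0"
    "\<And>x. norm x \<ge> \<delta> \<Longrightarrow> \<rho> x = 0" "(\<integral>x. \<rho> x \<partial>lborel) = 1"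
proof -
  obtain b :: "real ^ 'n \<Rightarrow> real" where b: "b \<in> test_functions (ball 0 \<delta>)" "b 0 > 0" "\<And>x. 0 \<le> b x"
    using bump_exists[of "ball 0 \<delta>" 0] assms by auto
  have bz: "b x = 0" if "norm x \<ge> \<delta>" for x
    using test_C1c[OF b(1)] that unfolding C1c_def by fastforce
  have i: "integrable lborel b"
    using C1c_integrable_mult[OF C1c_mono[OF test_C1c[OF b(1)]], of "\<lambda>x. 1"] by simp
  have "(\<integral>x. b x \<partial>lborel) \<noteq> 0"
  proof
    assume "(\<integral>x. b x \<partial>lborel) = 0"
    then have "AE x in lborel. b x = 0"
      using integral_nonneg_eq_0_iff_AE[OF i] b(3) by simp
    then have "AE x in lebesgue. b x = 0" by (rule AE_completion)
    then have "AE x in lebesgue_on UNIV. b x = 0"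
      by (simp add: AE_restrict_space_iff)
    from continuous_AE_zero[OF open_UNIV C1c_cont(1)[OF test_C1c[OF b(1)]] this, of 0]
    show False using b(2) by simp
  qed
  then have p: "(\<integral>x. b x \<partial>lborel) > 0"
    using b(3) by (simp add: less_le)
  show thesis
    by (rule that[of "\<lambda>x. inverse (\<integral>x. b x \<partial>lborel) * b x"])
      (use b p bz test_smooth[OF b(1)] in \<open>auto intro!: Ck_cmult\<close>)
qed

lemma csupp_uniformly_continuous:
  fixes f :: "'a::euclidean_space \<Rightarrow> real"
  assumes "continuous_on UNIV f" "bounded K" "\<And>x. x \<notin> K \<Longrightarrow> f x = 0" "\<epsilon> > 0"
  shows "\<exists>\<delta>>0. \<forall>x y. dist x y < \<delta> \<longrightarrow> \<bar>f x - f y\<bar> \<le> \<epsilon>"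
proof -
  obtain R where R: "\<And>x. x \<in> K \<Longrightarrow> norm x \<le> R" using assms(2) bounded_iff by blast
  have "uniformly_continuous_on (cball 0 (R + 1)) f"
    by (intro compact_uniformly_continuous continuous_on_subset[OF assms(1)]) auto
  then obtain d where d: "d > 0" "\<And>x y. x \<in> cball 0 (R+1) \<Longrightarrow> y \<in> cball 0 (R+1) \<Longrightarrow> dist x y < d \<Longrightarrow> dist (f x) (f y) < \<epsilon>"
    using assms(4) unfolding uniformly_continuous_on_def by metis
  show ?thesis
  proof (intro exI[of _ "min d 1"] conjI allI impI)
    fix x y :: 'a assume xy: "dist x y < min d 1"
    show "\<bar>f x - f y\<bar> \<le> \<epsilon>"
    proof (cases "x \<in> K \<or> y \<in> K")
      case True
      have "norm x \<le> norm y + dist x y" "norm y \<le> norm x + dist x y"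
        using norm_triangle_sub[of x y] norm_triangle_sub[of y x] by (simp_all add: dist_norm norm_minus_commute)
      then have "x \<in> cball 0 (R+1)" "y \<in> cball 0 (R+1)"
        using True R[of x] R[of y] xy by auto
      then show ?thesis using d(2)[of x y] xy by (auto simp: dist_real_def)
    next
      case False
      then show ?thesis using assms by simp
    qed
  qed (use d in auto)
qed

lemma mollify_close:
  fixes f :: "real ^ 'n \<Rightarrow> real"
  assumes f: "continuous_on UNIV f" "bounded K" "\<And>x. x \<notin> K \<Longrightarrow> f x = 0"
    and r: "\<And>x. \<rho> x \<ge> 0" "\<And>x. norm x \<ge> \<delta> \<Longrightarrow> \<rho> x = 0" "(\<integral>x. \<rho> x \<partial>lborel) = 1" "continuous_on UNIV \<rho>"
    and u: "\<And>x y. dist x y < \<delta> \<Longrightarrow> \<bar>f x - f y\<bar> \<le> \<epsilon>"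
  shows "\<bar>mollify \<rho> f x - f x\<bar> \<le> \<epsilon>"
proof -
  note [measurable] = borel_cont[OF r(4)]
  have c: "continuous_on UNIV (\<lambda>y. \<rho> (x - y))"
    by (intro continuous_on_compose2[OF r(4)] continuous_intros) auto
  have z: "\<rho> (x - y) = 0" if "y \<notin> cball x \<delta>" for y
    using that r(2)[of "x - y"] by (simp add: dist_norm)
  have i1: "integrable lborel (\<lambda>y. \<rho> (x - y))"
    by (rule csupp_integrable[OF c, of "cball x \<delta>"]) (use z in auto)
  have i2: "integrable lborel (\<lambda>y. f y * \<rho> (x - y))"
    by (rule csupp_integrable[of _ K]) (use f c in \<open>auto intro!: continuous_intros\<close>)
  have one: "(\<integral>y. \<rho> (x - y) \<partial>lborel) = 1" using lborel_reflect[of \<rho> x] r(3) by simp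
  have "mollify \<rho> f x - f x = (\<integral>y. f y * \<rho> (x - y) \<partial>lborel) - (\<integral>y. f x * \<rho> (x - y) \<partial>lborel)"
    using one i1 by (simp add: mollify_def)
  also have "\<dots> = (\<integral>y. f y * \<rho> (x - y) - f x * \<rho> (x - y) \<partial>lborel)"
    using i1 i2 by simp
  finally have "mollify \<rho> f x - f x = (\<integral>y. f y * \<rho> (x - y) - f x * \<rho> (x - y) \<partial>lborel)" .
  also have "\<bar>\<dots>\<bar> \<le> (\<integral>y. \<epsilon> * \<rho> (x - y) \<partial>lborel)"
  proof (rule integral_abs_bound_integral)
    fix y
    show "\<bar>f y * \<rho> (x - y) - f x * \<rho> (x - y)\<bar> \<le> \<epsilon> * \<rho> (x - y)"
    proof (cases "dist y x < \<delta>")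
      case True
      have "\<bar>f y * \<rho> (x - y) - f x * \<rho> (x - y)\<bar> = \<bar>f y - f x\<bar> * \<rho> (x - y)"
        using r(1)[of "x - y"] by (simp add: abs_mult left_diff_distrib[symmetric])
      then show ?thesis using u[OF True] r(1)[of "x - y"] by (simp add: mult_right_mono)
    next
      case False
      then show ?thesis using r(2)[of "x - y"] by (simp add: dist_norm norm_minus_commute)
    qed
  qed (use i1 i2 in auto)
  finally show ?thesis using one i1 by simp
qed

lemma mollify_support:
  fixes f :: "real ^ 'n \<Rightarrow> real"
  assumes "\<And>x. x \<notin> K \<Longrightarrow> f x = 0" "\<And>x. norm x \<ge> \<delta> \<Longrightarrow> \<rho> x = 0"
    and "\<And>y. y \<in> K \<Longrightarrow> dist x y \<ge> \<delta>"
  shows "mollify \<rho> f x = 0"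
proof -
  have "(\<lambda>y. f y * \<rho> (x - y)) = (\<lambda>y. 0)"
    using assms by (fastforce simp: dist_norm)
  then show ?thesis by (simp add: mollify_def)
qed

lemma compact_neighbourhood:
  fixes K :: "'a::euclidean_space set"
  assumes "compact K" "open U" "K \<subseteq> U"
  obtains d K' where "d > 0" "compact K'" "K \<subseteq> K'" "K' \<subseteq> U" "\<And>x y. y \<in> K \<Longrightarrow> dist x y < d \<Longrightarrow> x \<in> K'"
proof -
  obtain e where e: "e > 0" "(\<Union>x\<in>K. cball x e) \<subseteq> U"
    using compact_subset_open_imp_cball_epsilon_subset[OF assms] by metis
  have "compact {x + y |x y. x \<in> K \<and> y \<in> cball 0 e}"
    by (intro compact_sums assms(1)) auto
  moreover have "{x + y |x y. x \<in> K \<and> y \<in> cball 0 e} = (\<Union>x\<in>K. cball x e)"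
  proof safe
    fix x y :: 'a assume "x \<in> K" "y \<in> cball 0 e"
    then show "x + y \<in> (\<Union>x\<in>K. cball x e)" by (auto simp: dist_norm intro!: bexI[of _ x])
  next
    fix x y :: 'a assume "x \<in> K" "y \<in> cball x e"
    then show "\<exists>xa ya. y = xa + ya \<and> xa \<in> K \<and> ya \<in> cball 0 e"
      by (intro exI[of _ x] exI[of _ "y - x"]) (auto simp: dist_norm norm_minus_commute)
  qed
  ultimately show thesis
    by (intro that[of e "\<Union>x\<in>K. cball x e"]) (use e in \<open>auto simp: dist_commute intro: less_imp_le\<close>)
qed

text \<open>One kernel of small support approximates \<open>f\<close> and, when they exist, all its partial derivatives
  uniformly. The set \<open>K'\<close> does not depend on \<open>\<epsilon>\<close>, so that uniform convergence implies convergence in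
  mean square.\<close>

lemma continuous_approx_test:
  fixes f :: "real ^ 'n \<Rightarrow> real"
  assumes U: "open U" and f: "continuous_on UNIV f" and K: "compact K" "K \<subseteq> U" "\<And>x. x \<notin> K \<Longrightarrow> f x = 0"
  obtains K' where "compact K'" "K \<subseteq> K'" "K' \<subseteq> U"
    "\<And>\<epsilon>. \<epsilon> > 0 \<Longrightarrow> \<exists>\<phi>\<in>test_functions U. (\<forall>x. x \<notin> K' \<longrightarrow> \<phi> x = 0) \<and> (\<forall>x. \<bar>\<phi> x - f x\<bar> \<le> \<epsilon>) \<and>
       (C1 f \<longrightarrow> (\<forall>x. norm (grad \<phi> x - grad f x) \<le> \<epsilon>))"
proof -
  obtain d K' where d: "d > 0" "compact K'" "K \<subseteq> K'" "K' \<subseteq> U" "\<And>x y. y \<in> K \<Longrightarrow> dist x y < d \<Longrightarrow> x \<in> K'"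
    by (rule compact_neighbourhood[OF K(1) U K(2)]) blast
  have bK: "bounded K" using K(1) compact_imp_bounded by blast
  show thesis
  proof (rule that[OF d(2,3,4)])
    fix \<epsilon> :: real assume e: "\<epsilon> > 0"
    define e' where "e' = \<epsilon> / real CARD('n)"
    have e': "e' > 0" using e by (simp add: e'_def)
    obtain d1 where d1: "d1 > 0" "\<And>x y. dist x y < d1 \<Longrightarrow> \<bar>f x - f y\<bar> \<le> \<epsilon>"
      using csupp_uniformly_continuous[OF f bK K(3) e] by blast
    have "\<exists>d2>0. C1 f \<longrightarrow> (\<forall>x y. dist x y < d2 \<longrightarrow> \<bar>grad f x $ i - grad f y $ i\<bar> \<le> e')" for i
    proof (cases "C1 f")
      case True
      have g0: "grad f x = 0" if "x \<notin> K" for x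
        using K that by (intro grad_zero_outside[of K]) (auto simp: compact_imp_closed)
      show ?thesis
        using csupp_uniformly_continuous[of "\<lambda>x. grad f x $ i" K e'] g0 bK e' C1_continuous_grad[OF True]
        by (auto intro!: continuous_intros)
    qed (auto intro: exI[of _ 1])
    then obtain d2 where d2: "\<And>i. d2 i > 0" "\<And>i x y. C1 f \<Longrightarrow> dist x y < d2 i \<Longrightarrow> \<bar>grad f x $ i - grad f y $ i\<bar> \<le> e'"
      by metis
    define \<delta> where "\<delta> = Min (insert d (insert d1 (range d2)))"
    have dl: "\<delta> > 0" "\<delta> \<le> d" "\<delta> \<le> d1"
      using d(1) d1(1) d2(1) unfolding \<delta>_def by auto
    have dl2: "\<delta> \<le> d2 i" for i
      unfolding \<delta>_def by (rule Min_le) auto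
    obtain \<rho> :: "real ^ 'n \<Rightarrow> real" where r: "\<And>m. Ck_function m \<rho>" "\<And>x. \<rho> x \<ge> 0"
      "\<And>x. norm x \<ge> \<delta> \<Longrightarrow> \<rho> x = 0" "(\<integral>x. \<rho> x \<partial>lborel) = 1"
      using mollifier_exists[OF dl(1)] by blast
    have cr: "continuous_on UNIV \<rho>" using r(1) Ck_continuous by blast
    have z: "mollify \<rho> f x = 0" if "x \<notin> K'" for x
      by (rule mollify_support[OF K(3) r(3)]) (use that d(5) dl(2) in force)+
    show "\<exists>\<phi>\<in>test_functions U. (\<forall>x. x \<notin> K' \<longrightarrow> \<phi> x = 0) \<and> (\<forall>x. \<bar>\<phi> x - f x\<bar> \<le> \<epsilon>) \<and>
       (C1 f \<longrightarrow> (\<forall>x. norm (grad \<phi> x - grad f x) \<le> \<epsilon>))"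
    proof (intro bexI[of _ "mollify \<rho> f"] conjI allI impI)
      show "mollify \<rho> f \<in> test_functions U"
        by (rule test_functionsI[of _ K']) (use mollify_smooth[OF f bK K(3) r(1)] d z in auto)
      show "\<bar>mollify \<rho> f x - f x\<bar> \<le> \<epsilon>" for x
        by (rule mollify_close[OF f bK K(3) r(2,3,4) cr]) (use d1 dl in auto)
      fix x assume C: "C1 f"
      have Cc: "C1c UNIV f" using C K unfolding C1c_def by blast
      have g0: "grad f x = 0" if "x \<notin> K" for x
        using K that by (intro grad_zero_outside[of K]) (auto simp: compact_imp_closed)
      have "\<bar>mollify \<rho> (\<lambda>y. grad f y $ i) x - grad f x $ i\<bar> \<le> e'" for i
      proof (rule mollify_close[OF _ bK _ r(2,3,4) cr])
        show "continuous_on UNIV (\<lambda>y. grad f y $ i)"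
          using C1_continuous_grad[OF C] by (intro continuous_intros)
        show "\<bar>grad f x $ i - grad f y $ i\<bar> \<le> e'" if "dist x y < \<delta>" for x y
          using d2(2)[OF C, of x y i] that dl2[of i] by linarith
      qed (use g0 in auto)
      then have "\<bar>(grad (mollify \<rho> f) x - grad f x) $ i\<bar> \<le> e'" for i
        using grad_mollify[OF Cc r(1)] by simp
      then have "norm (grad (mollify \<rho> f) x - grad f x) \<le> (\<Sum>i\<in>(UNIV::'n set). e')"
        by (intro order_trans[OF norm_le_l1_cart] sum_mono)
      then show "norm (grad (mollify \<rho> f) x - grad f x) \<le> \<epsilon>" by (simp add: e'_def)
    qed (use z in auto)
  qed
qed

section \<open>Square integrable functions\<close>

lemma L2D:
  assumes "f \<in> L2_on U"
  shows "f \<in> borel_measurable (lebesgue_on U)" "integrable (lebesgue_on U) (\<lambda>x. (norm (f x))\<^sup>2)"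
  using assms by (auto simp: L2_on_def)

lemma L2_inner:
  fixes f g :: "real ^ 'n \<Rightarrow> 'b::euclidean_space"
  assumes "f \<in> L2_on U" "g \<in> L2_on U"
  shows "integrable (lebesgue_on U) (\<lambda>x. f x \<bullet> g x)"
proof (rule Bochner_Integration.integrable_bound)
  show "integrable (lebesgue_on U) (\<lambda>x. (norm (f x))\<^sup>2 + (norm (g x))\<^sup>2)"
    using assms by (intro Bochner_Integration.integrable_add L2D)
  show "AE x in lebesgue_on U. norm (f x \<bullet> g x) \<le> norm ((norm (f x))\<^sup>2 + (norm (g x))\<^sup>2)"
  proof (rule AE_I2)
    fix x
    have "\<bar>f x \<bullet> g x\<bar> \<le> norm (f x) * norm (g x)" by (rule Cauchy_Schwarz_ineq2)
    also have "\<dots> \<le> (norm (f x))\<^sup>2 + (norm (g x))\<^sup>2"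
    proof -
      have "0 \<le> norm (f x) * norm (g x)" by simp
      then show ?thesis using sum_squares_bound[of "norm (f x)" "norm (g x)"] by linarith
    qed
    finally show "norm (f x \<bullet> g x) \<le> norm ((norm (f x))\<^sup>2 + (norm (g x))\<^sup>2)" by simp
  qed
qed (use assms[THEN L2D(1)] in measurable)

lemma L2_mult:
  fixes f g :: "real ^ 'n \<Rightarrow> real"
  assumes "f \<in> L2_on U" "g \<in> L2_on U"
  shows "integrable (lebesgue_on U) (\<lambda>x. f x * g x)"
  using L2_inner[OF assms] by simp

lemma norm_add_sq: "(norm (a + b))\<^sup>2 \<le> 2 * (norm a)\<^sup>2 + 2 * (norm (b :: 'b::real_normed_vector))\<^sup>2"
proof -
  have "(norm (a + b))\<^sup>2 \<le> (norm a + norm b)\<^sup>2"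
    by (intro power_mono norm_triangle_ineq) auto
  also have "\<dots> \<le> 2 * (norm a)\<^sup>2 + 2 * (norm b)\<^sup>2"
    using sum_squares_bound[of "norm a" "norm b"] by (simp add: power2_eq_square algebra_simps)
  finally show ?thesis .
qed

lemma L2_add:
  assumes "f \<in> L2_on U" "g \<in> L2_on U"
  shows "(\<lambda>x. f x + g x) \<in> L2_on U"
proof -
  note [measurable] = assms[THEN L2D(1)]
  have "integrable (lebesgue_on U) (\<lambda>x. (norm (f x + g x))\<^sup>2)"
  proof (rule Bochner_Integration.integrable_bound)
    show "integrable (lebesgue_on U) (\<lambda>x. 2 * (norm (f x))\<^sup>2 + 2 * (norm (g x))\<^sup>2)"
      using assms[THEN L2D(2)] by auto
    show "AE x in lebesgue_on U. norm ((norm (f x + g x))\<^sup>2) \<le> norm (2 * (norm (f x))\<^sup>2 + 2 * (norm (g x))\<^sup>2)"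
      using norm_add_sq[of "f _" "g _"] by (intro AE_I2) auto
  qed measurable
  then show ?thesis by (simp add: L2_on_def)
qed

lemma L2_scale:
  assumes "f \<in> L2_on U"
  shows "(\<lambda>x. c *\<^sub>R f x) \<in> L2_on U"
proof -
  note [measurable] = assms[THEN L2D(1)]
  show ?thesis using assms[THEN L2D(2)] by (simp add: L2_on_def power_mult_distrib)
qed

lemma L2_cmult: "f \<in> L2_on U \<Longrightarrow> (\<lambda>x. c * f x :: real) \<in> L2_on U"
  using L2_scale[of f U c] by simp

lemma L2_diff:
  assumes "f \<in> L2_on U" "g \<in> L2_on U"
  shows "(\<lambda>x. f x - g x) \<in> L2_on U"
  using L2_add[OF assms(1) L2_scale[OF assms(2), of "-1"]] by simp

lemma L2_component:
  fixes g :: "real ^ 'n \<Rightarrow> real ^ 'm"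
  assumes "g \<in> L2_on U"
  shows "(\<lambda>x. g x $ i) \<in> L2_on U"
proof -
  note [measurable] = assms[THEN L2D(1)]
  have m: "(\<lambda>x. g x $ i) \<in> borel_measurable (lebesgue_on U)"
    by (rule borel_measurable_continuous_on[of "\<lambda>v. v $ i"]) (auto intro: continuous_intros)
  have le: "(g x $ i)\<^sup>2 \<le> (norm (g x))\<^sup>2" for x
    using power_mono[OF component_le_norm_cart[of "g x" i] abs_ge_zero, of 2] by simp
  have "integrable (lebesgue_on U) (\<lambda>x. (norm (g x $ i))\<^sup>2)"
  proof (rule Bochner_Integration.integrable_bound[OF L2D(2)[OF assms]])
    show "AE x in lebesgue_on U. norm ((norm (g x $ i))\<^sup>2) \<le> norm ((norm (g x))\<^sup>2)"
      using le by (intro AE_I2) auto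
  qed (use m in measurable)
  then show ?thesis using m by (simp add: L2_on_def)
qed

text \<open>Along a subsequence with increments below \<open>4\<^sup>-\<^sup>k\<close> the weighted sum of squared
  increments with weights \<open>2\<^sup>k\<close> is integrable, hence finite almost everywhere, which gives
  pointwise convergence; Fatou's lemma turns this into convergence in mean.\<close>

lemma L2_complete:
  fixes f :: "nat \<Rightarrow> real ^ 'n \<Rightarrow> 'b::euclidean_space"
  assumes f: "\<And>n. f n \<in> L2_on U"
    and cauchy: "\<And>e. e > 0 \<Longrightarrow> \<exists>N. \<forall>m\<ge>N. \<forall>n\<ge>N. (\<integral>x. (norm (f m x - f n x))\<^sup>2 \<partial>lebesgue_on U) < e"
  obtains g where "g \<in> L2_on U" "(\<lambda>n. \<integral>x. (norm (f n x - g x))\<^sup>2 \<partial>lebesgue_on U) \<longlonglongrightarrow> 0"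
proof -
  let ?M = "lebesgue_on U"
  note [measurable] = f[THEN L2D(1)]
  have int: "integrable ?M (\<lambda>x. (norm (f m x - f n x))\<^sup>2)" for m n
    using L2D(2)[OF L2_diff[OF f f]] .
  have "\<forall>k. \<exists>N. \<forall>m\<ge>N. \<forall>n\<ge>N. (\<integral>x. (norm (f m x - f n x))\<^sup>2 \<partial>?M) < (1/4) ^ k"
    by (intro allI cauchy) simp
  then obtain N where N: "\<And>k m n. m \<ge> N k \<Longrightarrow> n \<ge> N k \<Longrightarrow> (\<integral>x. (norm (f m x - f n x))\<^sup>2 \<partial>?M) < (1/4) ^ k"
    by (auto dest!: choice)
  define r where "r k = (\<Sum>i\<le>k. N i) + k" for k
  have rN: "r k \<ge> N k" "r (Suc k) \<ge> N k" for k
  proof -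
    have "N k \<le> (\<Sum>i\<le>k. N i)" by (rule member_le_sum) auto
    then show "r k \<ge> N k" "r (Suc k) \<ge> N k" by (auto simp: r_def)
  qed
  have rk: "r k \<ge> k" for k by (simp add: r_def)
  define d where "d k x = (norm (f (r (Suc k)) x - f (r k) x))\<^sup>2" for k x
  have [measurable]: "d k \<in> borel_measurable ?M" for k unfolding d_def by measurable
  have "(\<integral>\<^sup>+x. (\<Sum>k. ennreal (2 ^ k * d k x)) \<partial>?M) = (\<Sum>k. \<integral>\<^sup>+x. ennreal (2 ^ k * d k x) \<partial>?M)"
    by (rule nn_integral_suminf) measurable
  also have "\<dots> \<le> (\<Sum>k. ennreal ((1/2) ^ k))"
  proof (rule suminf_le)
    fix k
    have "(\<integral>\<^sup>+x. ennreal (2 ^ k * d k x) \<partial>?M) = ennreal (\<integral>x. 2 ^ k * d k x \<partial>?M)"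
      using int[of "r (Suc k)" "r k"] by (intro nn_integral_eq_integral) (auto simp: d_def)
    also have "(\<integral>x. 2 ^ k * d k x \<partial>?M) \<le> 2 ^ k * (1/4) ^ k"
      using N[of k "r (Suc k)" "r k"] rN[of k] by (simp add: d_def)
    also have "\<dots> = (1/2::real) ^ k" by (simp flip: power_mult_distrib)
    finally show "(\<integral>\<^sup>+x. ennreal (2 ^ k * d k x) \<partial>?M) \<le> ennreal ((1/2) ^ k)"
      by (simp add: ennreal_leI)
  qed auto
  also have "\<dots> = ennreal (\<Sum>k. (1/2) ^ k)"
    by (rule suminf_ennreal2) (auto intro: summable_geometric)
  finally have "(\<integral>\<^sup>+x. (\<Sum>k. ennreal (2 ^ k * d k x)) \<partial>?M) \<noteq> \<infinity>"
    by (auto simp: top_unique)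
  then have "AE x in ?M. (\<Sum>k. ennreal (2 ^ k * d k x)) \<noteq> \<infinity>"
    by (intro nn_integral_PInf_AE) auto
  then have conv: "AE x in ?M. convergent (\<lambda>k. f (r k) x)"
  proof eventually_elim
    fix x assume fin: "(\<Sum>k. ennreal (2 ^ k * d k x)) \<noteq> \<infinity>"
    obtain S where S: "S \<ge> 0" "(\<Sum>k. ennreal (2 ^ k * d k x)) = ennreal S"
      using fin by (cases "\<Sum>k. ennreal (2 ^ k * d k x)") auto
    have "norm (f (r (Suc k)) x - f (r k) x) \<le> sqrt S * (sqrt (1/2)) ^ k" for k
    proof -
      have "ennreal (2 ^ k * d k x) \<le> ennreal S"
        unfolding S(2)[symmetric] using sum_le_suminf[of "\<lambda>k. ennreal (2 ^ k * d k x)" "{k}"] by simp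
      then have "2 ^ k * d k x \<le> S" using S(1) by (simp add: ennreal_le_iff)
      then have "d k x \<le> S * (1/2) ^ k" by (simp add: field_simps power_divide)
      then have "sqrt (d k x) \<le> sqrt (S * (1/2) ^ k)" by (rule real_sqrt_le_mono)
      then show ?thesis by (simp add: d_def real_sqrt_mult real_sqrt_power)
    qed
    moreover have "summable (\<lambda>k. sqrt S * (sqrt (1/2)) ^ k)"
      by (intro summable_mult summable_geometric) (simp add: real_sqrt_divide)
    ultimately have "summable (\<lambda>k. f (r (Suc k)) x - f (r k) x)"
      using summable_comparison_test'[of "\<lambda>k. sqrt S * (sqrt (1/2)) ^ k" 0 "\<lambda>k. f (r (Suc k)) x - f (r k) x"]
      by blast
    then have "convergent (\<lambda>n. \<Sum>k<n. f (r (Suc k)) x - f (r k) x)"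
      by (simp add: summable_iff_convergent)
    then have "convergent (\<lambda>n. f (r n) x - f (r 0) x)"
      by (simp only: sum_lessThan_telescope[of "\<lambda>k. f (r k) x"])
    then show "convergent (\<lambda>k. f (r k) x)"
      using convergent_add[OF _ convergent_const[of "f (r 0) x"]] by fastforce
  qed
  define g where "g x = lim (\<lambda>k. f (r k) x)" for x
  have [measurable]: "g \<in> borel_measurable ?M" unfolding g_def by measurable
  have lim: "AE x in ?M. (\<lambda>k. f (r k) x) \<longlonglongrightarrow> g x"
    using conv by eventually_elim (simp add: g_def convergent_LIMSEQ_iff)
  have fatou: "(\<integral>\<^sup>+x. ennreal ((norm (f n x - g x))\<^sup>2) \<partial>?M) \<le> ennreal e"
    if "e > 0" "\<forall>m\<ge>K. \<forall>n\<ge>K. (\<integral>x. (norm (f m x - f n x))\<^sup>2 \<partial>?M) < e" "n \<ge> K" for e K n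
  proof -
    have "(\<integral>\<^sup>+x. ennreal ((norm (f n x - g x))\<^sup>2) \<partial>?M)
        = (\<integral>\<^sup>+x. liminf (\<lambda>k. ennreal ((norm (f n x - f (r k) x))\<^sup>2)) \<partial>?M)"
    proof (rule nn_integral_cong_AE)
      show "AE x in ?M. ennreal ((norm (f n x - g x))\<^sup>2) = liminf (\<lambda>k. ennreal ((norm (f n x - f (r k) x))\<^sup>2))"
        using lim
      proof eventually_elim
        fix x assume "(\<lambda>k. f (r k) x) \<longlonglongrightarrow> g x"
        then have "(\<lambda>k. ennreal ((norm (f n x - f (r k) x))\<^sup>2)) \<longlonglongrightarrow> ennreal ((norm (f n x - g x))\<^sup>2)"
          by (intro tendsto_intros)
        then show "ennreal ((norm (f n x - g x))\<^sup>2) = liminf (\<lambda>k. ennreal ((norm (f n x - f (r k) x))\<^sup>2))"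
          using lim_imp_Liminf[OF sequentially_bot] by metis
      qed
    qed
    also have "\<dots> \<le> liminf (\<lambda>k. \<integral>\<^sup>+x. ennreal ((norm (f n x - f (r k) x))\<^sup>2) \<partial>?M)"
      by (rule nn_integral_liminf) measurable
    also have "\<dots> \<le> liminf (\<lambda>k::nat. ennreal e)"
    proof (rule Liminf_mono)
      show "\<forall>\<^sub>F k in sequentially. (\<integral>\<^sup>+x. ennreal ((norm (f n x - f (r k) x))\<^sup>2) \<partial>?M) \<le> ennreal e"
        using eventually_ge_at_top[of K]
      proof eventually_elim
        fix k assume "k \<ge> K"
        then have "r k \<ge> K" using rk[of k] by linarith
        then have "(\<integral>x. (norm (f n x - f (r k) x))\<^sup>2 \<partial>?M) < e" using that by blast
        then show "(\<integral>\<^sup>+x. ennreal ((norm (f n x - f (r k) x))\<^sup>2) \<partial>?M) \<le> ennreal e"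
          using nn_integral_eq_integral[OF int[of n "r k"]] by (simp add: ennreal_leI)
      qed
    qed
    also have "\<dots> = ennreal e" by (rule Liminf_const) simp
    finally show ?thesis .
  qed
  have diffL2: "(\<lambda>x. f n x - g x) \<in> L2_on U" if "\<forall>m\<ge>n. \<forall>k\<ge>n. (\<integral>x. (norm (f m x - f k x))\<^sup>2 \<partial>?M) < 1" for n
  proof -
    have "(\<integral>\<^sup>+x. ennreal ((norm (f n x - g x))\<^sup>2) \<partial>?M) < \<infinity>"
      using fatou[of 1 n n] that by (auto intro: le_less_trans)
    then have "integrable ?M (\<lambda>x. (norm (f n x - g x))\<^sup>2)"
      by (intro integrableI_bounded) auto
    then show ?thesis by (simp add: L2_on_def)
  qed
  obtain n0 where n0: "\<forall>m\<ge>n0. \<forall>n\<ge>n0. (\<integral>x. (norm (f m x - f n x))\<^sup>2 \<partial>?M) < 1"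
    using cauchy[of 1] by auto
  have gL2: "g \<in> L2_on U"
    using L2_diff[OF f[of n0] diffL2[OF n0]] by simp
  moreover have "(\<lambda>n. \<integral>x. (norm (f n x - g x))\<^sup>2 \<partial>?M) \<longlonglongrightarrow> 0"
  proof (rule LIMSEQ_I)
    fix e :: real assume e: "e > 0"
    obtain K where K: "\<forall>m\<ge>K. \<forall>n\<ge>K. (\<integral>x. (norm (f m x - f n x))\<^sup>2 \<partial>?M) < e/2"
      using cauchy[of "e/2"] e by auto
    show "\<exists>no. \<forall>n\<ge>no. norm ((\<integral>x. (norm (f n x - g x))\<^sup>2 \<partial>?M) - 0) < e"
    proof (intro exI[of _ K] allI impI)
      fix n assume "n \<ge> K"
      have "ennreal (\<integral>x. (norm (f n x - g x))\<^sup>2 \<partial>?M) \<le> ennreal (e/2)"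
        using fatou[of "e/2" K n] K e \<open>n \<ge> K\<close> nn_integral_eq_integral[OF L2D(2)[OF L2_diff[OF f[of n] gL2]]]
        by simp
      then have "(\<integral>x. (norm (f n x - g x))\<^sup>2 \<partial>?M) \<le> e/2" using e by (simp add: ennreal_le_iff)
      then show "norm ((\<integral>x. (norm (f n x - g x))\<^sup>2 \<partial>?M) - 0) < e" using e by simp
    qed
  qed
  ultimately show thesis by (rule that)
qed

text \<open>The discriminant of a nonnegative quadratic polynomial, the common source of the Cauchy--Schwarz
  inequality and of the first-order condition at a minimum.\<close>

lemma quadratic_nonneg:
  fixes a b c :: real
  assumes "\<And>t. a + 2 * b * t + c * t\<^sup>2 \<ge> 0" "c \<ge> 0"
  shows "b\<^sup>2 \<le> a * c"
proof (cases "c = 0")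
  case True
  have "b = 0"
  proof (rule ccontr)
    assume "b \<noteq> 0"
    then have "2 * b * (- (\<bar>a\<bar> + 1) / (2 * b)) = - (\<bar>a\<bar> + 1)" by simp
    then have "0 \<le> a - (\<bar>a\<bar> + 1)" using assms(1)[of "- (\<bar>a\<bar> + 1) / (2 * b)"] True by (simp only:)
    then show False by linarith
  qed
  then show ?thesis using True by simp
next
  case False
  have "0 \<le> c * (a + 2 * b * (- b / c) + c * (- b / c)\<^sup>2)"
    using assms(1)[of "- b / c"] assms(2) by (intro mult_nonneg_nonneg)
  also have "\<dots> = a * c - b\<^sup>2" using False by (simp add: field_simps power2_eq_square)
  finally show ?thesis by simp
qed

lemma L2_Cauchy_Schwarz:
  fixes f g :: "real ^ 'n \<Rightarrow> real"
  assumes f: "f \<in> L2_on U" and g: "g \<in> L2_on U"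
  shows "(\<integral>x. f x * g x \<partial>lebesgue_on U)\<^sup>2 \<le> (\<integral>x. (f x)\<^sup>2 \<partial>lebesgue_on U) * (\<integral>x. (g x)\<^sup>2 \<partial>lebesgue_on U)"
proof (rule quadratic_nonneg)
  fix t :: real
  have i: "integrable (lebesgue_on U) (\<lambda>x. (f x)\<^sup>2)" "integrable (lebesgue_on U) (\<lambda>x. (g x)\<^sup>2)"
    "integrable (lebesgue_on U) (\<lambda>x. f x * g x)"
    using L2_mult[OF f f] L2_mult[OF g g] L2_mult[OF f g] by (auto simp: power2_eq_square)
  have "0 \<le> (\<integral>x. (f x + t * g x)\<^sup>2 \<partial>lebesgue_on U)" by simp
  also have "(\<lambda>x. (f x + t * g x)\<^sup>2) = (\<lambda>x. (f x)\<^sup>2 + 2 * t * (f x * g x) + t\<^sup>2 * (g x)\<^sup>2)"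
    by (auto simp: power2_eq_square algebra_simps)
  also have "(\<integral>x. (f x)\<^sup>2 + 2 * t * (f x * g x) + t\<^sup>2 * (g x)\<^sup>2 \<partial>lebesgue_on U)
    = (\<integral>x. (f x)\<^sup>2 \<partial>lebesgue_on U) + 2 * t * (\<integral>x. f x * g x \<partial>lebesgue_on U) + t\<^sup>2 * (\<integral>x. (g x)\<^sup>2 \<partial>lebesgue_on U)"
    using i by simp
  finally show "0 \<le> (\<integral>x. (f x)\<^sup>2 \<partial>lebesgue_on U) + 2 * (\<integral>x. f x * g x \<partial>lebesgue_on U) * t
    + (\<integral>x. (g x)\<^sup>2 \<partial>lebesgue_on U) * t\<^sup>2" by (simp add: mult_ac)
qed simp

lemma L2_limit_mult:
  fixes f :: "nat \<Rightarrow> real ^ 'n \<Rightarrow> real"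
  assumes f: "\<And>n. f n \<in> L2_on U" "g \<in> L2_on U" "h \<in> L2_on U"
    and lim: "(\<lambda>n. \<integral>x. (f n x - g x)\<^sup>2 \<partial>lebesgue_on U) \<longlonglongrightarrow> 0"
  shows "(\<lambda>n. \<integral>x. f n x * h x \<partial>lebesgue_on U) \<longlonglongrightarrow> (\<integral>x. g x * h x \<partial>lebesgue_on U)"
proof -
  let ?I = "\<lambda>f. \<integral>x. f x \<partial>lebesgue_on U"
  have e: "?I (\<lambda>x. f n x * h x) - ?I (\<lambda>x. g x * h x) = ?I (\<lambda>x. (f n x - g x) * h x)" for n
    using L2_mult[OF f(1)[of n] f(3)] L2_mult[OF f(2) f(3)] by (simp add: left_diff_distrib)
  have "(\<lambda>n. ?I (\<lambda>x. (f n x - g x)\<^sup>2) * ?I (\<lambda>x. (h x)\<^sup>2)) \<longlonglongrightarrow> 0 * ?I (\<lambda>x. (h x)\<^sup>2)"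
    by (intro tendsto_intros lim)
  then have b: "(\<lambda>n. ?I (\<lambda>x. (f n x - g x)\<^sup>2) * ?I (\<lambda>x. (h x)\<^sup>2)) \<longlonglongrightarrow> 0" by (simp only: mult_zero_left)
  have "(\<lambda>n. (?I (\<lambda>x. f n x * h x) - ?I (\<lambda>x. g x * h x))\<^sup>2) \<longlonglongrightarrow> 0"
  proof (rule tendsto_sandwich[OF _ _ tendsto_const b])
    show "\<forall>\<^sub>F n in sequentially. (?I (\<lambda>x. f n x * h x) - ?I (\<lambda>x. g x * h x))\<^sup>2 \<le> ?I (\<lambda>x. (f n x - g x)\<^sup>2) * ?I (\<lambda>x. (h x)\<^sup>2)"
      unfolding e by (intro always_eventually allI L2_Cauchy_Schwarz L2_diff f)
  qed simp
  then have "(\<lambda>n. ?I (\<lambda>x. f n x * h x) - ?I (\<lambda>x. g x * h x)) \<longlonglongrightarrow> 0"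
    using tendsto_real_sqrt[of "\<lambda>n. (?I (\<lambda>x. f n x * h x) - ?I (\<lambda>x. g x * h x))\<^sup>2" 0 sequentially]
    by (simp add: tendsto_rabs_zero_iff)
  then show ?thesis by (simp add: LIM_zero_iff)
qed

lemma lebesgue_on_eq_lborel:
  fixes f :: "real ^ 'n \<Rightarrow> 'b::euclidean_space"
  assumes U: "open U" and f: "f \<in> borel_measurable borel" "\<And>x. x \<notin> U \<Longrightarrow> f x = 0"
  shows "(\<integral>x. f x \<partial>lebesgue_on U) = (\<integral>x. f x \<partial>lborel)"
    "integrable (lebesgue_on U) f \<longleftrightarrow> integrable lborel f"
    "f \<in> borel_measurable (lebesgue_on U)"
proof -
  have Us: "U \<inter> space lebesgue \<in> sets lebesgue" using U by auto
  have "(\<lambda>x. indicator U x *\<^sub>R f x) = f" using f(2) by (auto simp: indicator_def)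
  moreover have "f \<in> borel_measurable lborel" using f(1) by simp
  ultimately show "(\<integral>x. f x \<partial>lebesgue_on U) = (\<integral>x. f x \<partial>lborel)"
    "integrable (lebesgue_on U) f \<longleftrightarrow> integrable lborel f"
    unfolding integral_restrict_space[OF Us] integrable_restrict_space[OF Us]
    by (simp_all add: integral_completion integrable_completion)
  show "f \<in> borel_measurable (lebesgue_on U)"
    using f(1) by (intro measurable_restrict_space1 measurable_completion) simp
qed

lemma C1c_zero_outside:
  assumes "C1c U f" "x \<notin> U"
  shows "f x = 0" "grad f x = 0"
  using assms grad_zero_outside[of _ f x] unfolding C1c_def by (auto dest: compact_imp_closed)

lemma csupp_L2:
  fixes f :: "real ^ 'n \<Rightarrow> 'b::euclidean_space"
  assumes U: "open U" and f: "continuous_on UNIV f" "bounded K" "\<And>x. x \<notin> K \<Longrightarrow> f x = 0" "\<And>x. x \<notin> U \<Longrightarrow> f x = 0"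
  shows "f \<in> L2_on U"
proof -
  have "integrable lborel (\<lambda>x. (norm (f x))\<^sup>2)"
    by (rule csupp_integrable[of _ K]) (use f in \<open>auto intro!: continuous_intros\<close>)
  moreover have "(\<lambda>x. (norm (f x))\<^sup>2) \<in> borel_measurable borel"
    using f(1) by (intro borel_cont continuous_intros)
  ultimately have "integrable (lebesgue_on U) (\<lambda>x. (norm (f x))\<^sup>2)"
    using lebesgue_on_eq_lborel(2)[OF U, of "\<lambda>x. (norm (f x))\<^sup>2"] f(4) by auto
  then show ?thesis
    using lebesgue_on_eq_lborel(3)[OF U borel_cont[OF f(1)]] f(4) by (auto simp: L2_on_def)
qed

lemma C1c_L2:
  assumes U: "open U" and f: "C1c U f"
  shows "f \<in> L2_on U" "grad f \<in> L2_on U"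
proof -
  obtain R where R: "\<And>x. norm x > R \<Longrightarrow> f x = 0" "\<And>x. norm x > R \<Longrightarrow> grad f x = 0"
    using C1c_bounds[OF C1c_mono[OF f subset_UNIV]] by metis
  show "f \<in> L2_on U" "grad f \<in> L2_on U"
    by (rule csupp_L2[OF U _ bounded_cball[of 0 R]];
        use C1c_cont[OF f] R C1c_zero_outside[OF f] in auto)+
qed

lemma test_L2: "open U \<Longrightarrow> \<phi> \<in> test_functions U \<Longrightarrow> \<phi> \<in> L2_on U"
  "open U \<Longrightarrow> \<phi> \<in> test_functions U \<Longrightarrow> grad \<phi> \<in> L2_on U"
  using C1c_L2 test_C1c by blast+

section \<open>Uniqueness of weak gradients\<close>

text \<open>The fundamental lemma of the calculus of variations, in three steps: orthogonality to test
  functions extends to compactly supported continuous functions by uniform approximation, then to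
  indicators of compact sets as pointwise limits of continuous functions, and then, by inner
  regularity, to the set where \<open>h\<close> is positive.\<close>

lemma L2_orthogonal_test_imp_continuous:
  fixes h :: "real ^ 'n \<Rightarrow> real"
  assumes U: "open U" and h: "h \<in> L2_on U"
    and o: "\<And>\<psi>. \<psi> \<in> test_functions U \<Longrightarrow> (\<integral>x. h x * \<psi> x \<partial>lebesgue_on U) = 0"
    and f: "continuous_on UNIV f" and K: "compact K" "K \<subseteq> U" "\<And>x. x \<notin> K \<Longrightarrow> f x = 0"
  shows "(\<integral>x. h x * f x \<partial>lebesgue_on U) = 0"
proof -
  obtain K' where K': "compact K'" "K \<subseteq> K'" "K' \<subseteq> U"
    "\<And>\<epsilon>. \<epsilon> > 0 \<Longrightarrow> \<exists>\<phi>\<in>test_functions U. (\<forall>x. x \<notin> K' \<longrightarrow> \<phi> x = 0) \<and> (\<forall>x. \<bar>\<phi> x - f x\<bar> \<le> \<epsilon>) \<and>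
       (C1 f \<longrightarrow> (\<forall>x. norm (grad \<phi> x - grad f x) \<le> \<epsilon>))"
    using continuous_approx_test[OF U f K] by blast
  have fL: "f \<in> L2_on U"
    by (rule csupp_L2[OF U f compact_imp_bounded[OF K(1)]]) (use K in auto)
  have "emeasure lebesgue K' < \<infinity>" using emeasure_compact_finite[OF K'(1)] K'(1)
    by (simp add: borel_compact)
  moreover have "K' \<in> sets lebesgue" using K'(1) by (simp add: borel_compact)
  ultimately have "integrable lebesgue (\<lambda>x. indicator K' x :: real)"
    by (simp add: integrable_real_indicator)
  then have "integrable (lebesgue_on U) (\<lambda>x. indicator K' x :: real)"
  proof -
    have Us: "U \<inter> space lebesgue \<in> sets lebesgue" using U by auto
    have "(\<lambda>x. indicator U x *\<^sub>R (indicator K' x :: real)) = indicator K'"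
      using K'(3) by (auto simp: indicator_def fun_eq_iff)
    then show "integrable lebesgue (\<lambda>x. indicator K' x :: real) \<Longrightarrow> ?thesis"
      unfolding integrable_restrict_space[OF Us] by simp
  qed
  then have kL: "(\<lambda>x. indicator K' x :: real) \<in> L2_on U"
  proof -
    have "(norm (indicator K' x :: real))\<^sup>2 = indicator K' x" for x by (simp add: indicator_def)
    then show "integrable (lebesgue_on U) (\<lambda>x. indicator K' x :: real) \<Longrightarrow> ?thesis"
      unfolding L2_on_def by (simp add: borel_measurable_integrable)
  qed
  define A where "A = (\<integral>x. \<bar>h x\<bar> * indicator K' x \<partial>lebesgue_on U)"
  have hL: "(\<lambda>x. \<bar>h x\<bar>) \<in> L2_on U" using h by (auto simp: L2_on_def)
  have A: "A \<ge> 0" unfolding A_def by (intro integral_nonneg_AE) auto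
  have le: "\<bar>\<integral>x. h x * f x \<partial>lebesgue_on U\<bar> \<le> \<epsilon> * A" if e: "\<epsilon> > 0" for \<epsilon>
  proof -
    obtain \<phi> where p: "\<phi> \<in> test_functions U" "\<And>x. x \<notin> K' \<Longrightarrow> \<phi> x = 0" "\<And>x. \<bar>\<phi> x - f x\<bar> \<le> \<epsilon>"
      using K'(4)[OF e] by blast
    have i: "integrable (lebesgue_on U) (\<lambda>x. h x * f x)" "integrable (lebesgue_on U) (\<lambda>x. h x * \<phi> x)"
      using L2_mult[OF h fL] L2_mult[OF h test_L2(1)[OF U p(1)]] by auto
    have "(\<integral>x. h x * f x \<partial>lebesgue_on U) = (\<integral>x. h x * f x - h x * \<phi> x \<partial>lebesgue_on U)"
      using i o[OF p(1)] by simp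
    also have "\<bar>\<dots>\<bar> \<le> (\<integral>x. \<epsilon> * (\<bar>h x\<bar> * indicator K' x) \<partial>lebesgue_on U)"
    proof (rule integral_abs_bound_integral)
      show "integrable (lebesgue_on U) (\<lambda>x. \<epsilon> * (\<bar>h x\<bar> * indicator K' x))"
        using L2_mult[OF hL kL] by auto
      fix x
      show "\<bar>h x * f x - h x * \<phi> x\<bar> \<le> \<epsilon> * (\<bar>h x\<bar> * indicator K' x)"
      proof (cases "x \<in> K'")
        case True
        have "\<bar>h x * f x - h x * \<phi> x\<bar> = \<bar>h x\<bar> * \<bar>\<phi> x - f x\<bar>"
          by (simp add: abs_mult abs_minus_commute flip: right_diff_distrib)
        also have "\<dots> \<le> \<bar>h x\<bar> * \<epsilon>" by (intro mult_left_mono p) auto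
        finally show ?thesis using True by (simp add: mult.commute)
      next
        case False
        then have "x \<notin> K" using K'(2) by blast
        then have "f x = 0" "\<phi> x = 0" using K(3)[of x] p(2)[OF False] by simp_all
        then show ?thesis using False by simp
      qed
    qed (use i in auto)
    finally show ?thesis by (simp add: A_def)
  qed
  show ?thesis
  proof (rule ccontr)
    assume n: "(\<integral>x. h x * f x \<partial>lebesgue_on U) \<noteq> 0"
    define I where "I = \<bar>\<integral>x. h x * f x \<partial>lebesgue_on U\<bar>"
    have "I > 0" using n by (simp add: I_def)
    then have "I \<le> (I / (2 * (A + 1))) * A"
      using le[of "I / (2 * (A + 1))"] A by (simp add: I_def)
    also have "\<dots> < I"
    proof -
      have "0 < A * I + I * 2" using A \<open>I > 0\<close> by (intro add_nonneg_pos) auto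
      then show ?thesis using A by (simp add: field_simps)
    qed
    finally show False by simp
  qed
qed

lemma L2_orthogonal_test_imp_compact:
  fixes h :: "real ^ 'n \<Rightarrow> real"
  assumes U: "open U" and h: "h \<in> L2_on U"
    and o: "\<And>\<psi>. \<psi> \<in> test_functions U \<Longrightarrow> (\<integral>x. h x * \<psi> x \<partial>lebesgue_on U) = 0"
    and K: "compact K" "K \<subseteq> U"
  shows "integrable (lebesgue_on U) (\<lambda>x. h x * indicator K x)"
    "(\<integral>x. h x * indicator K x \<partial>lebesgue_on U) = 0"
proof -
  note [measurable] = L2D(1)[OF h]
  obtain d K' where d: "d > 0" "compact K'" "K \<subseteq> K'" "K' \<subseteq> U" "\<And>x y. y \<in> K \<Longrightarrow> dist x y < d \<Longrightarrow> x \<in> K'"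
    by (rule compact_neighbourhood[OF K(1) U K(2)]) blast
  obtain d2 K2 where d2: "d2 > 0" "compact K2" "K' \<subseteq> K2" "K2 \<subseteq> U" "\<And>x y. y \<in> K' \<Longrightarrow> dist x y < d2 \<Longrightarrow> x \<in> K2"
    by (rule compact_neighbourhood[OF d(2) U d(4)]) blast
  have goal: "integrable (lebesgue_on U) (\<lambda>x. h x * indicator K x) \<and> (\<integral>x. h x * indicator K x \<partial>lebesgue_on U) = 0"
  proof (cases "K = {}")
    case False
    define f where "f n x = max 0 (1 - (real n + 1 / d) * infdist x K)" for n x
    have fc: "continuous_on UNIV (f n)" for n
      unfolding f_def by (intro continuous_intros)
    have fz: "f n x = 0" if "x \<notin> K'" for n x
    proof -
      have "infdist x K \<ge> d"
        unfolding infdist_notempty[OF False]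
        by (rule cINF_greatest[OF False]) (use d(5)[of _ x] that in force)
      then have "1 \<le> (real n + 1 / d) * infdist x K"
        using d(1) mult_mono[of "1/d" "real n + 1 / d" d "infdist x K"] by simp
      then show ?thesis by (simp add: f_def)
    qed
    have f01: "0 \<le> f n x" "f n x \<le> 1" for n x
      using d(1) infdist_nonneg[of x K] by (auto simp: f_def)
    have lim: "(\<lambda>n. f n x) \<longlonglongrightarrow> indicator K x" for x
    proof (cases "x \<in> K")
      case True
      then show ?thesis by (simp add: f_def)
    next
      case False
      then have p: "infdist x K > 0"
        using infdist_pos_not_in_closed[OF compact_imp_closed[OF K(1)] \<open>K \<noteq> {}\<close>] by simp
      obtain n0 :: nat where n0: "real n0 > 1 / infdist x K" using reals_Archimedean2 by blast
      have "f n x = 0" if "n \<ge> n0" for n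
      proof -
        have "1 \<le> real n0 * infdist x K" using n0 p by (simp add: field_simps)
        also have "\<dots> \<le> (real n + 1 / d) * infdist x K"
          using that d(1) p by (intro mult_right_mono) (auto intro: add_increasing2)
        finally show ?thesis by (simp add: f_def)
      qed
      then have "eventually (\<lambda>n. f n x = 0) sequentially"
        by (auto simp: eventually_sequentially)
      then show ?thesis using False by (simp add: tendsto_eventually)
    qed
    define w where "w x = max 0 (1 - infdist x K' / d2)" for x
    have wL: "w \<in> L2_on U"
    proof (rule csupp_L2[OF U _ compact_imp_bounded[OF d2(2)]])
      show "continuous_on UNIV w" unfolding w_def using d2(1) by (intro continuous_intros) auto
      show "w x = 0" if "x \<notin> K2" for x
      proof -
        have ne: "K' \<noteq> {}" using d(3) False by auto
        have "infdist x K' \<ge> d2"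
          unfolding infdist_notempty[OF ne]
          by (rule cINF_greatest[OF ne]) (use d2(5)[of _ x] that in force)
        then show ?thesis using d2(1) by (simp add: w_def field_simps)
      qed
      then show "w x = 0" if "x \<notin> U" for x using that d2(4) by auto
    qed
    have w1: "f n x \<le> w x" "0 \<le> w x" for n x
    proof -
      show "0 \<le> w x" by (simp add: w_def)
      show "f n x \<le> w x"
        using f01[of n x] fz[of x n] by (cases "x \<in> K'") (auto simp: w_def)
    qed
    have hL: "(\<lambda>x. \<bar>h x\<bar>) \<in> L2_on U" using h by (auto simp: L2_on_def)
    have wi: "integrable (lebesgue_on U) (\<lambda>x. \<bar>h x\<bar> * w x)" by (rule L2_mult[OF hL wL])
    have [measurable]: "f n \<in> borel_measurable (lebesgue_on U)" for n
      using borel_cont[OF fc[of n]] by (intro measurable_restrict_space1 measurable_completion) simp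
    have [measurable]: "(\<lambda>x. indicator K x :: real) \<in> borel_measurable (lebesgue_on U)"
      using borel_compact[OF K(1)]
      by (intro measurable_restrict_space1 measurable_completion borel_measurable_indicator) simp
    have l: "AE x in lebesgue_on U. (\<lambda>n. h x * f n x) \<longlonglongrightarrow> h x * indicator K x"
      by (intro AE_I2 tendsto_intros lim)
    have b: "AE x in lebesgue_on U. norm (h x * f n x) \<le> \<bar>h x\<bar> * w x" for n
      using w1 f01 by (intro AE_I2) (auto simp: abs_mult intro!: mult_left_mono)
    have "integrable (lebesgue_on U) (\<lambda>x. h x * indicator K x)"
      by (rule integrable_dominated_convergence[OF _ _ wi l b]) measurable
    moreover have "(\<lambda>n. \<integral>x. h x * f n x \<partial>lebesgue_on U) \<longlonglongrightarrow> (\<integral>x. h x * indicator K x \<partial>lebesgue_on U)"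
      by (rule integral_dominated_convergence[OF _ _ wi l b]) measurable
    moreover have "(\<integral>x. h x * f n x \<partial>lebesgue_on U) = 0" for n
      by (rule L2_orthogonal_test_imp_continuous[OF U h o fc d(2,4) fz])
    ultimately show ?thesis using LIMSEQ_unique[OF _ tendsto_const[of 0]] by auto
  qed simp
  then show "integrable (lebesgue_on U) (\<lambda>x. h x * indicator K x)"
    "(\<integral>x. h x * indicator K x \<partial>lebesgue_on U) = 0" by auto
qed

text \<open>The positivity set is exhausted up to measure \<open>e\<close> by a compact set, on which a positive function
  has integral zero; so this set is null.\<close>

lemma L2_orthogonal_test_AE_le:
  fixes h :: "real ^ 'n \<Rightarrow> real"
  assumes U: "open U" "bounded U" and h: "h \<in> L2_on U"
    and o: "\<And>\<psi>. \<psi> \<in> test_functions U \<Longrightarrow> (\<integral>x. h x * \<psi> x \<partial>lebesgue_on U) = 0"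
  shows "AE x in lebesgue_on U. h x \<le> 0"
proof -
  note [measurable] = L2D(1)[OF h]
  define P where "P = {x \<in> U. h x > 0}"
  have "{x \<in> space (lebesgue_on U). h x > 0} \<in> sets (lebesgue_on U)" by measurable
  then have P: "P \<in> sets lebesgue"
    using U(1) by (simp add: P_def sets_restrict_space_iff)
  have "emeasure lebesgue P \<le> ennreal e" if "e > 0" for e
  proof -
    obtain T where T: "closed T" "T \<subseteq> P" "P - T \<in> lmeasurable" "emeasure lebesgue (P - T) < ennreal e"
      using sets_lebesgue_inner_closed[OF P \<open>e > 0\<close>] by metis
    have "bounded T" using T(2) U(2) by (auto simp: P_def intro: bounded_subset)
    then have cT: "compact T" "T \<subseteq> U" using T by (auto simp: compact_eq_bounded_closed P_def)
    have Tm: "T \<in> sets lebesgue" using cT(1) by (simp add: borel_compact)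
    note z = L2_orthogonal_test_imp_compact[OF U(1) h o cT]
    have nn: "AE x in lebesgue_on U. 0 \<le> h x * indicator T x"
      using T(2) by (intro AE_I2) (auto simp: P_def indicator_def less_imp_le)
    have "AE x in lebesgue_on U. h x * indicator T x = 0"
      using integral_nonneg_eq_0_iff_AE[OF z(1) nn] z(2) by blast
    then have "AE x in lebesgue. x \<in> U \<longrightarrow> h x * indicator T x = 0"
      using U(1) by (subst (asm) AE_restrict_space_iff) auto
    then have "AE x in lebesgue. x \<notin> T"
      by eventually_elim (use T(2) in \<open>auto simp: P_def split: split_indicator_asm\<close>)
    then have T0: "T \<in> null_sets lebesgue" using Tm by (simp add: AE_iff_null_sets)
    have "emeasure lebesgue P \<le> emeasure lebesgue (P - T) + emeasure lebesgue T"
    proof -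
      have "P = (P - T) \<union> T" using T(2) by auto
      then show ?thesis using emeasure_subadditive[of "P - T" lebesgue T] P Tm by (metis sets.Diff)
    qed
    then show ?thesis using T(4) T0 by (simp add: null_setsD1 order.strict_implies_order)
  qed
  then have "emeasure lebesgue P = 0"
    by (metis ennreal_eq_0_iff le_zero_eq ennreal_le_epsilon add.left_neutral)
  then have "AE x in lebesgue. x \<notin> P" by (intro AE_not_in null_setsI P)
  then show ?thesis
    using U(1) by (subst AE_restrict_space_iff) (auto simp: P_def not_less)
qed

lemma L2_orthogonal_test_AE_zero:
  fixes h :: "real ^ 'n \<Rightarrow> real"
  assumes U: "open U" "bounded U" and h: "h \<in> L2_on U"
    and o: "\<And>\<psi>. \<psi> \<in> test_functions U \<Longrightarrow> (\<integral>x. h x * \<psi> x \<partial>lebesgue_on U) = 0"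
  shows "AE x in lebesgue_on U. h x = 0"
proof -
  have "AE x in lebesgue_on U. (-1) * h x \<le> 0"
    using L2_orthogonal_test_AE_le[OF U L2_cmult[OF h, of "-1"]] o by simp
  moreover have "AE x in lebesgue_on U. h x \<le> 0"
    by (rule L2_orthogonal_test_AE_le[OF U h o])
  ultimately show ?thesis
    by eventually_elim simp
qed

lemma weak_gradient_unique:
  fixes g g' :: "real ^ 'n \<Rightarrow> real ^ 'n"
  assumes U: "open U" "bounded U" and g: "g \<in> L2_on U" "g' \<in> L2_on U"
    and w: "is_weak_gradient U u g" "is_weak_gradient U u g'"
  shows "AE x in lebesgue_on U. g x = g' x"
proof -
  have "AE x in lebesgue_on U. g x $ i - g' x $ i = 0" for i
  proof (rule L2_orthogonal_test_AE_zero[OF U])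
    show "(\<lambda>x. g x $ i - g' x $ i) \<in> L2_on U"
      by (intro L2_diff L2_component g)
    fix \<psi> :: "real ^ 'n \<Rightarrow> real" assume p: "\<psi> \<in> test_functions U"
    have "(\<integral>x. g x $ i * \<psi> x \<partial>lebesgue_on U) = (\<integral>x. g' x $ i * \<psi> x \<partial>lebesgue_on U)"
    proof -
      note w' = w[unfolded is_weak_gradient_def, rule_format, OF p, of i]
      show ?thesis using w'(1) unfolding w'(2) by simp
    qed
    then show "(\<integral>x. (g x $ i - g' x $ i) * \<psi> x \<partial>lebesgue_on U) = 0"
      using L2_mult[OF L2_component[OF g(1), of i] test_L2(1)[OF U(1) p]]
        L2_mult[OF L2_component[OF g(2), of i] test_L2(1)[OF U(1) p]]
      by (simp add: left_diff_distrib)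
  qed
  then have "AE x in lebesgue_on U. \<forall>i\<in>UNIV. g x $ i - g' x $ i = 0"
    by (intro AE_finite_allI) auto
  then show ?thesis by eventually_elim (simp add: vec_eq_iff)
qed

section \<open>The space H10 as a closure of test functions\<close>

definition H1_sq :: "(real ^ 'n) set \<Rightarrow> (real ^ 'n \<Rightarrow> real) \<Rightarrow> (real ^ 'n \<Rightarrow> real ^ 'n) \<Rightarrow> real" where
  "H1_sq U u g = (\<integral>x. (u x)\<^sup>2 + (norm (g x))\<^sup>2 \<partial>lebesgue_on U)"

text \<open>The function \<open>weak_gradient U u\<close> is an arbitrary choice among almost everywhere equal ones. The
  relation \<open>sobolev U u g\<close> says that \<open>u\<close> lies in \<open>H10 U\<close> and that \<open>g\<close> is one of them, without
  mentioning the choice; that \<open>g\<close> is a weak gradient is a consequence (\<open>sobolev_weak_gradient\<close>).\<close>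

definition sobolev :: "(real ^ 'n) set \<Rightarrow> (real ^ 'n \<Rightarrow> real) \<Rightarrow> (real ^ 'n \<Rightarrow> real ^ 'n) \<Rightarrow> bool" where
  "sobolev U u g \<longleftrightarrow> u \<in> L2_on U \<and> g \<in> L2_on U \<and>
     (\<forall>e>0. \<exists>\<phi>\<in>test_functions U. H1_sq U (\<lambda>x. \<phi> x - u x) (\<lambda>x. grad \<phi> x - g x) < e)"

lemma L2_sq: "u \<in> L2_on U \<Longrightarrow> integrable (lebesgue_on U) (\<lambda>x. (u x :: real)\<^sup>2)"
  using L2D(2)[of u U] by simp

lemma H1_sq_integrable:
  "u \<in> L2_on U \<Longrightarrow> g \<in> L2_on U \<Longrightarrow> integrable (lebesgue_on U) (\<lambda>x. (u x :: real)\<^sup>2 + (norm (g x))\<^sup>2)"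
  by (intro Bochner_Integration.integrable_add L2_sq L2D(2))

lemma H1_sq_split:
  "u \<in> L2_on U \<Longrightarrow> g \<in> L2_on U \<Longrightarrow>
    H1_sq U u g = (\<integral>x. (u x)\<^sup>2 \<partial>lebesgue_on U) + (\<integral>x. (norm (g x))\<^sup>2 \<partial>lebesgue_on U)"
  unfolding H1_sq_def by (intro Bochner_Integration.integral_add L2_sq L2D(2))

lemma H1_sq_nonneg: "H1_sq U u g \<ge> 0"
  unfolding H1_sq_def by simp

lemma H1_sq_add:
  assumes "u \<in> L2_on U" "g \<in> L2_on U" "v \<in> L2_on U" "h \<in> L2_on U"
  shows "H1_sq U (\<lambda>x. u x + v x) (\<lambda>x. g x + h x) \<le> 2 * H1_sq U u g + 2 * H1_sq U v h"
proof -
  have "H1_sq U (\<lambda>x. u x + v x) (\<lambda>x. g x + h x)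
    \<le> (\<integral>x. 2 * ((u x)\<^sup>2 + (norm (g x))\<^sup>2) + 2 * ((v x)\<^sup>2 + (norm (h x))\<^sup>2) \<partial>lebesgue_on U)"
    unfolding H1_sq_def
  proof (rule integral_mono)
    show "(u x + v x)\<^sup>2 + (norm (g x + h x))\<^sup>2 \<le> 2 * ((u x)\<^sup>2 + (norm (g x))\<^sup>2) + 2 * ((v x)\<^sup>2 + (norm (h x))\<^sup>2)" for x
      using norm_add_sq[of "u x" "v x"] norm_add_sq[of "g x" "h x"] by simp
  qed (intro H1_sq_integrable L2_add Bochner_Integration.integrable_add integrable_mult_right assms)+
  also have "\<dots> = 2 * H1_sq U u g + 2 * H1_sq U v h"
    unfolding H1_sq_def using H1_sq_integrable[OF assms(1,2)] H1_sq_integrable[OF assms(3,4)]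
    by (simp del: distrib_left_numeral)
  finally show ?thesis .
qed

lemma H1_sq_scale:
  assumes "u \<in> L2_on U" "g \<in> L2_on U"
  shows "H1_sq U (\<lambda>x. c * u x) (\<lambda>x. c *\<^sub>R g x) = c\<^sup>2 * H1_sq U u g"
  unfolding H1_sq_def by (simp add: power_mult_distrib flip: distrib_left)

lemma H1_sq_cong_AE:
  assumes "AE x in lebesgue_on U. g x = h x" "g \<in> L2_on U" "h \<in> L2_on U" "u \<in> L2_on U"
  shows "H1_sq U u g = H1_sq U u h"
  unfolding H1_sq_def
proof (rule integral_cong_AE)
  note [measurable] = assms(2-4)[THEN L2D(1)]
  show "(\<lambda>x. (u x)\<^sup>2 + (norm (g x))\<^sup>2) \<in> borel_measurable (lebesgue_on U)"
    "(\<lambda>x. (u x)\<^sup>2 + (norm (h x))\<^sup>2) \<in> borel_measurable (lebesgue_on U)" by measurable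
  show "AE x in lebesgue_on U. (u x)\<^sup>2 + (norm (g x))\<^sup>2 = (u x)\<^sup>2 + (norm (h x))\<^sup>2"
    using assms(1) by eventually_elim simp
qed

lemma sobolevD:
  assumes "sobolev U u g"
  shows "u \<in> L2_on U" "g \<in> L2_on U"
    "\<And>e. e > 0 \<Longrightarrow> \<exists>\<phi>\<in>test_functions U. H1_sq U (\<lambda>x. \<phi> x - u x) (\<lambda>x. grad \<phi> x - g x) < e"
  using assms unfolding sobolev_def by auto

lemma sobolev_seq:
  assumes "sobolev U u g"
  obtains \<phi> where "\<And>n::nat. \<phi> n \<in> test_functions U"
    "(\<lambda>n. H1_sq U (\<lambda>x. \<phi> n x - u x) (\<lambda>x. grad (\<phi> n) x - g x)) \<longlonglongrightarrow> 0"
proof -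
  have "\<forall>n. \<exists>\<phi>. \<phi> \<in> test_functions U \<and> H1_sq U (\<lambda>x. \<phi> x - u x) (\<lambda>x. grad \<phi> x - g x) < inverse (real (Suc n))"
    using sobolevD(3)[OF assms, of "inverse (real (Suc _))"] by (auto simp: Bex_def simp del: of_nat_Suc)
  then obtain \<phi> where p: "\<And>n. \<phi> n \<in> test_functions U"
    "\<And>n. H1_sq U (\<lambda>x. \<phi> n x - u x) (\<lambda>x. grad (\<phi> n) x - g x) < inverse (real (Suc n))" by metis
  have "(\<lambda>n. H1_sq U (\<lambda>x. \<phi> n x - u x) (\<lambda>x. grad (\<phi> n) x - g x)) \<longlonglongrightarrow> 0"
    by (rule tendsto_sandwich[OF _ _ tendsto_const LIMSEQ_inverse_real_of_nat])
      (intro always_eventually allI H1_sq_nonneg less_imp_le p(2))+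
  then show thesis using that p(1) by blast
qed

lemma H1_sq_ge:
  assumes "u \<in> L2_on U" "g \<in> L2_on U"
  shows "(\<integral>x. (u x)\<^sup>2 \<partial>lebesgue_on U) \<le> H1_sq U u g" "(\<integral>x. (g x $ i)\<^sup>2 \<partial>lebesgue_on U) \<le> H1_sq U u g"
proof -
  show "(\<integral>x. (u x)\<^sup>2 \<partial>lebesgue_on U) \<le> H1_sq U u g"
    unfolding H1_sq_def by (intro integral_mono L2_sq H1_sq_integrable assms) simp
  show "(\<integral>x. (g x $ i)\<^sup>2 \<partial>lebesgue_on U) \<le> H1_sq U u g"
    unfolding H1_sq_def
  proof (intro integral_mono L2_sq L2_component H1_sq_integrable assms)
    show "(g x $ i)\<^sup>2 \<le> (u x)\<^sup>2 + (norm (g x))\<^sup>2" for x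
    proof -
      have "(g x $ i)\<^sup>2 \<le> (norm (g x))\<^sup>2"
        using power_mono[OF component_le_norm_cart[of "g x" i] abs_ge_zero, of 2] by simp
      then show ?thesis using zero_le_power2[of "u x"] by linarith
    qed
  qed
qed

lemma test_weak_gradient:
  assumes U: "open U" and p: "\<phi> \<in> test_functions U"
  shows "is_weak_gradient U \<phi> (grad \<phi>)"
  unfolding is_weak_gradient_def
proof (intro ballI allI)
  fix \<psi> i assume q: "\<psi> \<in> test_functions U"
  note cp = C1c_cont[OF test_C1c[OF p]] and cq = C1c_cont[OF test_C1c[OF q]]
  have e: "frechet_derivative \<psi> (at x) (axis i 1) = grad \<psi> x \<bullet> axis i 1" for x
    by (rule frechet_eq_grad[OF C1_differentiable[OF cq(3)]])
  have "(\<integral>x. \<phi> x * (grad \<psi> x \<bullet> axis i 1) \<partial>lebesgue_on U) = (\<integral>x. \<phi> x * (grad \<psi> x \<bullet> axis i 1) \<partial>lborel)"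
    by (rule lebesgue_on_eq_lborel(1)[OF U]) (use cp cq C1c_zero_outside[OF test_C1c[OF p]] in \<open>auto intro!: borel_cont continuous_intros\<close>)
  also have "\<dots> = - (\<integral>x. \<psi> x * (grad \<phi> x \<bullet> axis i 1) \<partial>lborel)"
    by (rule integral_by_parts[OF C1c_mono[OF test_C1c[OF p] subset_UNIV] cq(3)])
  also have "(\<integral>x. \<psi> x * (grad \<phi> x \<bullet> axis i 1) \<partial>lborel) = (\<integral>x. \<psi> x * (grad \<phi> x \<bullet> axis i 1) \<partial>lebesgue_on U)"
    by (rule lebesgue_on_eq_lborel(1)[OF U, symmetric]) (use cp cq C1c_zero_outside[OF test_C1c[OF p]] in \<open>auto intro!: borel_cont continuous_intros\<close>)
  finally show "(\<integral>x. \<phi> x * frechet_derivative \<psi> (at x) (axis i 1) \<partial>lebesgue_on U) =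
      - (\<integral>x. grad \<phi> x $ i * \<psi> x \<partial>lebesgue_on U)"
    by (simp add: e inner_axis mult.commute)
qed

text \<open>Integration by parts holds for the approximating test functions and passes to the limit.\<close>

lemma sobolev_weak_gradient:
  assumes U: "open U" and s: "sobolev U u g"
  shows "is_weak_gradient U u g"
  unfolding is_weak_gradient_def
proof (intro ballI allI)
  fix \<psi> i assume q: "\<psi> \<in> test_functions U"
  obtain \<phi> where p: "\<And>n::nat. \<phi> n \<in> test_functions U"
    "(\<lambda>n. H1_sq U (\<lambda>x. \<phi> n x - u x) (\<lambda>x. grad (\<phi> n) x - g x)) \<longlonglongrightarrow> 0"
    by (rule sobolev_seq[OF s]) blast
  note uL = sobolevD(1)[OF s] and gL = sobolevD(2)[OF s]
  note pL = test_L2(1)[OF U p(1)] and pgL = test_L2(2)[OF U p(1)]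
  have e: "frechet_derivative \<psi> (at x) (axis i 1) = grad \<psi> x $ i" for x
    by (simp add: grad_def)
  have "(\<lambda>n. \<integral>x. (\<phi> n x - u x)\<^sup>2 \<partial>lebesgue_on U) \<longlonglongrightarrow> 0"
    by (rule tendsto_sandwich[OF _ _ tendsto_const p(2)])
      (use H1_sq_ge(1)[OF L2_diff[OF pL uL] L2_diff[OF pgL gL]] in auto)
  then have l1: "(\<lambda>n. \<integral>x. \<phi> n x * (grad \<psi> x $ i) \<partial>lebesgue_on U) \<longlonglongrightarrow> (\<integral>x. u x * (grad \<psi> x $ i) \<partial>lebesgue_on U)"
    by (intro L2_limit_mult pL uL L2_component test_L2(2)[OF U q])
  have "(\<lambda>n. \<integral>x. (grad (\<phi> n) x $ i - g x $ i)\<^sup>2 \<partial>lebesgue_on U) \<longlonglongrightarrow> 0"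
    by (rule tendsto_sandwich[OF _ _ tendsto_const p(2)])
      (use H1_sq_ge(2)[OF L2_diff[OF pL uL] L2_diff[OF pgL gL], where i=i] in auto)
  then have l2: "(\<lambda>n. \<integral>x. grad (\<phi> n) x $ i * \<psi> x \<partial>lebesgue_on U) \<longlonglongrightarrow> (\<integral>x. g x $ i * \<psi> x \<partial>lebesgue_on U)"
    by (intro L2_limit_mult L2_component pgL gL test_L2(1)[OF U q])
  have "(\<integral>x. \<phi> n x * (grad \<psi> x $ i) \<partial>lebesgue_on U) = - (\<integral>x. grad (\<phi> n) x $ i * \<psi> x \<partial>lebesgue_on U)" for n
    using test_weak_gradient[OF U p(1)[of n]] q unfolding is_weak_gradient_def e[symmetric] by blast
  then have "(\<lambda>n. \<integral>x. \<phi> n x * (grad \<psi> x $ i) \<partial>lebesgue_on U) \<longlonglongrightarrow> - (\<integral>x. g x $ i * \<psi> x \<partial>lebesgue_on U)"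
    using tendsto_minus[OF l2] by simp
  then show "(\<integral>x. u x * frechet_derivative \<psi> (at x) (axis i 1) \<partial>lebesgue_on U) =
      - (\<integral>x. g x $ i * \<psi> x \<partial>lebesgue_on U)"
    unfolding e using LIMSEQ_unique[OF l1] by blast
qed

lemma H1_weak_gradient:
  assumes "u \<in> H1 U"
  shows "u \<in> L2_on U" "weak_gradient U u \<in> L2_on U" "is_weak_gradient U u (weak_gradient U u)"
proof -
  have "\<exists>g. g \<in> L2_on U \<and> is_weak_gradient U u g" using assms unfolding H1_def by auto
  from someI_ex[OF this] show "weak_gradient U u \<in> L2_on U" "is_weak_gradient U u (weak_gradient U u)"
    unfolding weak_gradient_def by auto
  show "u \<in> L2_on U" using assms unfolding H1_def by auto
qed

lemma test_H1:
  assumes U: "open U" "bounded U" and p: "\<phi> \<in> test_functions U"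
  shows "\<phi> \<in> H1 U" "AE x in lebesgue_on U. weak_gradient U \<phi> x = grad \<phi> x"
proof -
  show h: "\<phi> \<in> H1 U"
    unfolding H1_def using test_L2[OF U(1) p] test_weak_gradient[OF U(1) p] by auto
  show "AE x in lebesgue_on U. weak_gradient U \<phi> x = grad \<phi> x"
    using weak_gradient_unique[OF U H1_weak_gradient(2)[OF h] test_L2(2)[OF U(1) p]
        H1_weak_gradient(3)[OF h] test_weak_gradient[OF U(1) p]] .
qed

lemma H1_dist_test:
  assumes U: "open U" "bounded U" and p: "\<phi> \<in> test_functions U" and u: "u \<in> H1 U"
    and g: "g \<in> L2_on U" "AE x in lebesgue_on U. weak_gradient U u x = g x"
  shows "H1_dist U \<phi> u = sqrt (H1_sq U (\<lambda>x. \<phi> x - u x) (\<lambda>x. grad \<phi> x - g x))"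
proof -
  note hp = H1_weak_gradient[OF test_H1(1)[OF U p]] and hu = H1_weak_gradient[OF u]
  have "H1_sq U (\<lambda>x. \<phi> x - u x) (\<lambda>x. weak_gradient U \<phi> x - weak_gradient U u x)
      = H1_sq U (\<lambda>x. \<phi> x - u x) (\<lambda>x. grad \<phi> x - g x)"
  proof (rule H1_sq_cong_AE)
    show "AE x in lebesgue_on U. weak_gradient U \<phi> x - weak_gradient U u x = grad \<phi> x - g x"
      using test_H1(2)[OF U p] g(2) by eventually_elim simp
  qed (intro L2_diff hp hu g test_L2[OF U(1) p])+
  then show ?thesis unfolding H1_dist_def H1_sq_def by simp
qed

lemma sobolev_H10:
  assumes U: "open U" "bounded U" and s: "sobolev U u g"
  shows "u \<in> H10 U" "AE x in lebesgue_on U. weak_gradient U u x = g x"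
proof -
  note w = sobolev_weak_gradient[OF U(1) s]
  have h: "u \<in> H1 U" unfolding H1_def using w sobolevD[OF s] by auto
  show ae: "AE x in lebesgue_on U. weak_gradient U u x = g x"
    using weak_gradient_unique[OF U H1_weak_gradient(2)[OF h] sobolevD(2)[OF s] H1_weak_gradient(3)[OF h] w] .
  obtain \<phi> where p: "\<And>n::nat. \<phi> n \<in> test_functions U"
    "(\<lambda>n. H1_sq U (\<lambda>x. \<phi> n x - u x) (\<lambda>x. grad (\<phi> n) x - g x)) \<longlonglongrightarrow> 0"
    by (rule sobolev_seq[OF s]) blast
  have "(\<lambda>n. H1_dist U (\<phi> n) u) \<longlonglongrightarrow> 0"
    using tendsto_real_sqrt[OF p(2)] H1_dist_test[OF U p(1) h sobolevD(2)[OF s] ae] by simp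
  then show "u \<in> H10 U" unfolding H10_def using h p(1) by auto
qed

lemma H10_sobolev:
  assumes U: "open U" "bounded U" and u: "u \<in> H10 U"
  shows "sobolev U u (weak_gradient U u)"
proof -
  obtain \<phi> where p: "\<And>m::nat. \<phi> m \<in> test_functions U" "(\<lambda>m. H1_dist U (\<phi> m) u) \<longlonglongrightarrow> 0" and h: "u \<in> H1 U"
    using u unfolding H10_def by auto
  note hu = H1_weak_gradient[OF h]
  have "(\<lambda>m. (H1_dist U (\<phi> m) u)\<^sup>2) \<longlonglongrightarrow> 0\<^sup>2" by (intro tendsto_intros p)
  then have l: "(\<lambda>m. H1_sq U (\<lambda>x. \<phi> m x - u x) (\<lambda>x. grad (\<phi> m) x - weak_gradient U u x)) \<longlonglongrightarrow> 0"
    using H1_dist_test[OF U p(1) h hu(2)] by (simp add: H1_sq_nonneg del: power_tendsto_0_iff)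
  show ?thesis unfolding sobolev_def
  proof (intro conjI hu allI impI)
    fix e :: real assume "e > 0"
    then obtain m where "H1_sq U (\<lambda>x. \<phi> m x - u x) (\<lambda>x. grad (\<phi> m) x - weak_gradient U u x) < e"
      using order_tendstoD(2)[OF l, of e] by (auto simp: eventually_sequentially)
    then show "\<exists>\<phi>\<in>test_functions U. H1_sq U (\<lambda>x. \<phi> x - u x) (\<lambda>x. grad \<phi> x - weak_gradient U u x) < e"
      using p(1) by blast
  qed
qed

lemma sobolev_limit:
  assumes U: "open U" and s: "\<And>n. sobolev U (u n) (g n)" and L: "v \<in> L2_on U" "h \<in> L2_on U"
    and lim: "(\<lambda>n. H1_sq U (\<lambda>x. u n x - v x) (\<lambda>x. g n x - h x)) \<longlonglongrightarrow> 0"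
  shows "sobolev U v h"
  unfolding sobolev_def
proof (intro conjI L allI impI)
  fix e :: real assume e: "e > 0"
  then obtain n where n: "H1_sq U (\<lambda>x. u n x - v x) (\<lambda>x. g n x - h x) < e/4"
    using order_tendstoD(2)[OF lim, of "e/4"] by (auto simp: eventually_sequentially)
  obtain \<phi> where p: "\<phi> \<in> test_functions U" "H1_sq U (\<lambda>x. \<phi> x - u n x) (\<lambda>x. grad \<phi> x - g n x) < e/4"
    using sobolevD(3)[OF s[of n], of "e/4"] e by auto
  have "H1_sq U (\<lambda>x. (\<phi> x - u n x) + (u n x - v x)) (\<lambda>x. (grad \<phi> x - g n x) + (g n x - h x))
    \<le> 2 * H1_sq U (\<lambda>x. \<phi> x - u n x) (\<lambda>x. grad \<phi> x - g n x) + 2 * H1_sq U (\<lambda>x. u n x - v x) (\<lambda>x. g n x - h x)"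
    by (intro H1_sq_add L2_diff L sobolevD[OF s] test_L2[OF U p(1)])
  then have "H1_sq U (\<lambda>x. \<phi> x - v x) (\<lambda>x. grad \<phi> x - h x) < e" using n p(2) by simp
  then show "\<exists>\<phi>\<in>test_functions U. H1_sq U (\<lambda>x. \<phi> x - v x) (\<lambda>x. grad \<phi> x - h x) < e"
    using p(1) by blast
qed

lemma sobolev_test: "open U \<Longrightarrow> \<phi> \<in> test_functions U \<Longrightarrow> sobolev U \<phi> (grad \<phi>)"
  unfolding sobolev_def using test_L2[of U \<phi>] by (auto intro!: bexI[of _ \<phi>] simp: H1_sq_def)

lemma sobolev_lincomb:
  assumes U: "open U" and s: "sobolev U u g" "sobolev U v h"
  shows "sobolev U (\<lambda>x. a * u x + b * v x) (\<lambda>x. a *\<^sub>R g x + b *\<^sub>R h x)"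
proof -
  note L = sobolevD(1,2)[OF s(1)] sobolevD(1,2)[OF s(2)]
  show ?thesis unfolding sobolev_def
  proof (intro conjI L2_add L2_cmult L2_scale L allI impI)
    fix e :: real assume e: "e > 0"
    define e' where "e' = e / (4 * (a\<^sup>2 + b\<^sup>2 + 1))"
    have pos: "a\<^sup>2 + b\<^sup>2 + 1 > 0" by (simp add: add_nonneg_pos)
    then have e': "e' > 0" using e by (simp add: e'_def)
    obtain \<phi> where p: "\<phi> \<in> test_functions U" "H1_sq U (\<lambda>x. \<phi> x - u x) (\<lambda>x. grad \<phi> x - g x) < e'"
      using sobolevD(3)[OF s(1) e'] by auto
    obtain \<psi> where q: "\<psi> \<in> test_functions U" "H1_sq U (\<lambda>x. \<psi> x - v x) (\<lambda>x. grad \<psi> x - h x) < e'"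
      using sobolevD(3)[OF s(2) e'] by auto
    have t: "(\<lambda>x. a * \<phi> x + b * \<psi> x) \<in> test_functions U"
      using test_functions_sum[of "{0, Suc 0}" "\<lambda>i. if i = 0 then \<phi> else \<psi>" U "\<lambda>i. if i = 0 then a else b"] p q by simp
    have gr: "grad (\<lambda>x. a * \<phi> x + b * \<psi> x) x = a *\<^sub>R grad \<phi> x + b *\<^sub>R grad \<psi> x" for x
      using C1c_cont(3)[OF test_C1c[OF p(1)]] C1c_cont(3)[OF test_C1c[OF q(1)]]
      by (simp add: grad_add[OF Ck_cmult Ck_cmult] grad_cmult del: One_nat_def)
    have "H1_sq U (\<lambda>x. a * (\<phi> x - u x) + b * (\<psi> x - v x)) (\<lambda>x. a *\<^sub>R (grad \<phi> x - g x) + b *\<^sub>R (grad \<psi> x - h x))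
      \<le> 2 * H1_sq U (\<lambda>x. a * (\<phi> x - u x)) (\<lambda>x. a *\<^sub>R (grad \<phi> x - g x))
       + 2 * H1_sq U (\<lambda>x. b * (\<psi> x - v x)) (\<lambda>x. b *\<^sub>R (grad \<psi> x - h x))"
      by (intro H1_sq_add L2_cmult L2_scale L2_diff L test_L2[OF U p(1)] test_L2[OF U q(1)])
    also have "\<dots> = 2 * (a\<^sup>2 * H1_sq U (\<lambda>x. \<phi> x - u x) (\<lambda>x. grad \<phi> x - g x))
       + 2 * (b\<^sup>2 * H1_sq U (\<lambda>x. \<psi> x - v x) (\<lambda>x. grad \<psi> x - h x))"
      by (subst (1 2) H1_sq_scale) (intro L2_diff L test_L2[OF U p(1)] test_L2[OF U q(1)] refl)+
    also have "\<dots> \<le> 2 * (a\<^sup>2 * e') + 2 * (b\<^sup>2 * e')"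
      using p(2) q(2) by (intro add_mono mult_left_mono) auto
    also have "\<dots> < 4 * (a\<^sup>2 + b\<^sup>2 + 1) * e'"
    proof -
      have "0 \<le> a\<^sup>2 * e'" "0 \<le> b\<^sup>2 * e'" using e' by auto
      moreover have "4 * (a\<^sup>2 + b\<^sup>2 + 1) * e' = 4 * (a\<^sup>2 * e') + 4 * (b\<^sup>2 * e') + 4 * e'"
        by (simp add: algebra_simps)
      ultimately show ?thesis using e' by linarith
    qed
    also have "\<dots> = e" using pos by (simp add: e'_def)
    finally have "H1_sq U (\<lambda>x. (a * \<phi> x + b * \<psi> x) - (a * u x + b * v x))
        (\<lambda>x. grad (\<lambda>x. a * \<phi> x + b * \<psi> x) x - (a *\<^sub>R g x + b *\<^sub>R h x)) < e"
      unfolding gr by (simp add: algebra_simps)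
    then show "\<exists>\<phi>\<in>test_functions U. H1_sq U (\<lambda>x. \<phi> x - (a * u x + b * v x)) (\<lambda>x. grad \<phi> x - (a *\<^sub>R g x + b *\<^sub>R h x)) < e"
      by (rule bexI[OF _ t])
  qed
qed

lemma sobolev_complete:
  assumes U: "open U" and s: "\<And>n::nat. sobolev U (u n) (g n)"
    and c: "\<And>e. e > 0 \<Longrightarrow> \<exists>N. \<forall>m\<ge>N. \<forall>n\<ge>N. H1_sq U (\<lambda>x. u m x - u n x) (\<lambda>x. g m x - g n x) < e"
  obtains v h where "sobolev U v h" "(\<lambda>n. H1_sq U (\<lambda>x. u n x - v x) (\<lambda>x. g n x - h x)) \<longlonglongrightarrow> 0"
proof -
  note L = sobolevD(1,2)[OF s]
  have sp: "H1_sq U (\<lambda>x. u m x - u n x) (\<lambda>x. g m x - g n x) =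
    (\<integral>x. (u m x - u n x)\<^sup>2 \<partial>lebesgue_on U) + (\<integral>x. (norm (g m x - g n x))\<^sup>2 \<partial>lebesgue_on U)" for m n
    by (intro H1_sq_split L2_diff L)
  have nn: "(\<integral>x. (u m x - u n x)\<^sup>2 \<partial>lebesgue_on U) \<ge> 0" "(\<integral>x. (norm (g m x - g n x))\<^sup>2 \<partial>lebesgue_on U) \<ge> 0" for m n
    by auto
  obtain v where v: "v \<in> L2_on U" "(\<lambda>n. \<integral>x. (norm (u n x - v x))\<^sup>2 \<partial>lebesgue_on U) \<longlonglongrightarrow> 0"
  proof (rule L2_complete[of u U])
    fix e :: real assume "e > 0"
    from c[OF this] obtain N where N: "\<forall>m\<ge>N. \<forall>n\<ge>N. H1_sq U (\<lambda>x. u m x - u n x) (\<lambda>x. g m x - g n x) < e" by blast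
    have "(\<integral>x. (norm (u m x - u n x))\<^sup>2 \<partial>lebesgue_on U) < e" if "m \<ge> N" "n \<ge> N" for m n
      using N[rule_format, OF that] sp[of m n] nn(2)[of m n] unfolding real_norm_def power2_abs by linarith
    then show "\<exists>N. \<forall>m\<ge>N. \<forall>n\<ge>N. (\<integral>x. (norm (u m x - u n x))\<^sup>2 \<partial>lebesgue_on U) < e" by blast
  qed (use L in auto)
  obtain h where h: "h \<in> L2_on U" "(\<lambda>n. \<integral>x. (norm (g n x - h x))\<^sup>2 \<partial>lebesgue_on U) \<longlonglongrightarrow> 0"
  proof (rule L2_complete[of g U])
    fix e :: real assume "e > 0"
    from c[OF this] obtain N where N: "\<forall>m\<ge>N. \<forall>n\<ge>N. H1_sq U (\<lambda>x. u m x - u n x) (\<lambda>x. g m x - g n x) < e" by blast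
    have "(\<integral>x. (norm (g m x - g n x))\<^sup>2 \<partial>lebesgue_on U) < e" if "m \<ge> N" "n \<ge> N" for m n
      using N[rule_format, OF that] sp[of m n] nn(1)[of m n] by linarith
    then show "\<exists>N. \<forall>m\<ge>N. \<forall>n\<ge>N. (\<integral>x. (norm (g m x - g n x))\<^sup>2 \<partial>lebesgue_on U) < e" by blast
  qed (use L in auto)
  have "H1_sq U (\<lambda>x. u n x - v x) (\<lambda>x. g n x - h x) =
      (\<integral>x. (u n x - v x)\<^sup>2 \<partial>lebesgue_on U) + (\<integral>x. (norm (g n x - h x))\<^sup>2 \<partial>lebesgue_on U)" for n
    by (intro H1_sq_split L2_diff L v h)
  then have l: "(\<lambda>n. H1_sq U (\<lambda>x. u n x - v x) (\<lambda>x. g n x - h x)) \<longlonglongrightarrow> 0"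
    using tendsto_add[OF v(2) h(2)] by simp
  show thesis by (rule that[OF sobolev_limit[where u=u and g=g, OF U s v(1) h(1) l] l])
qed

text \<open>Mollification approximates \<open>f\<close> and its gradient uniformly, hence in mean square, since \<open>U\<close> has
  finite measure.\<close>

lemma sobolev_C1c:
  assumes U: "open U" "bounded U" and f: "C1c U f"
  shows "sobolev U f (grad f)"
  unfolding sobolev_def
proof (intro conjI C1c_L2[OF U(1) f] allI impI)
  fix e :: real assume e: "e > 0"
  obtain K where K: "compact K" "K \<subseteq> U" "\<And>x. x \<notin> K \<Longrightarrow> f x = 0" using f unfolding C1c_def by blast
  note cf = C1c_cont[OF f]
  define A where "A = measure lebesgue U"
  have A: "A \<ge> 0" by (simp add: A_def)
  define \<epsilon> where "\<epsilon> = sqrt (e / (4 * (A + 1)))"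
  have ep: "\<epsilon> > 0" "\<epsilon>\<^sup>2 = e / (4 * (A + 1))" using e A by (auto simp: \<epsilon>_def)
  obtain \<phi> where p: "\<phi> \<in> test_functions U" "\<And>x. \<bar>\<phi> x - f x\<bar> \<le> \<epsilon>" "\<And>x. norm (grad \<phi> x - grad f x) \<le> \<epsilon>"
    using continuous_approx_test[OF U(1) cf(1) K] ep(1) cf(3) by metis
  have fin: "U \<in> lmeasurable" using U by (simp add: lmeasurable_open)
  have "H1_sq U (\<lambda>x. \<phi> x - f x) (\<lambda>x. grad \<phi> x - grad f x) \<le> (\<integral>x. 2 * \<epsilon>\<^sup>2 \<partial>lebesgue_on U)"
    unfolding H1_sq_def
  proof (rule integral_mono)
    show "integrable (lebesgue_on U) (\<lambda>x. (\<phi> x - f x)\<^sup>2 + (norm (grad \<phi> x - grad f x))\<^sup>2)"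
      by (intro H1_sq_integrable L2_diff C1c_L2[OF U(1) f] test_L2[OF U(1) p(1)])
    show "integrable (lebesgue_on U) (\<lambda>x. 2 * \<epsilon>\<^sup>2)"
      by (rule finite_measure.integrable_const[OF finite_measure_lebesgue_on[OF fin]])
    show "(\<phi> x - f x)\<^sup>2 + (norm (grad \<phi> x - grad f x))\<^sup>2 \<le> 2 * \<epsilon>\<^sup>2" for x
      using power_mono[OF p(2)[of x], of 2] power_mono[OF p(3)[of x], of 2] by simp
  qed
  also have "\<dots> = A * (2 * \<epsilon>\<^sup>2)"
    using fin U(1) by (simp add: A_def measure_restrict_space)
  also have "\<dots> < e"
  proof -
    have "0 < e * 4 + A * (e * 2)" using A e by (intro add_pos_nonneg) auto
    then show ?thesis using A unfolding ep(2) by (simp add: field_simps)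
  qed
  finally show "\<exists>\<phi>\<in>test_functions U. H1_sq U (\<lambda>x. \<phi> x - f x) (\<lambda>x. grad \<phi> x - grad f x) < e"
    using p(1) by blast
qed

section \<open>Compactness\<close>

text \<open>The half-open cubes of side \<open>h\<close> of the grid \<open>h \<int>\<^sup>N\<close>; half-open, so that they partition the space.\<close>

definition cell :: "real \<Rightarrow> ('n \<Rightarrow> int) \<Rightarrow> (real ^ 'n) set" where
  "cell h k = {x. \<forall>i. h * k i \<le> x $ i \<and> x $ i < h * (k i + 1)}"

lemma cell_borel [measurable]: "cell h k \<in> sets borel"
proof -
  have "cell h k = (\<Inter>i. {x. h * k i \<le> x $ i} \<inter> {x. x $ i < h * (k i + 1)})"
    by (auto simp: cell_def)
  moreover have "{x :: real ^ 'a. h * k i \<le> x $ i} \<in> sets borel" "{x :: real ^ 'a. x $ i < h * (k i + 1)} \<in> sets borel" for i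
    by (auto intro!: borel_closed borel_open closed_Collect_le open_Collect_less continuous_intros)
  ultimately show ?thesis by auto
qed

lemma prod_inner_Basis_const:
  "(\<Prod>b\<in>(Basis :: (real ^ 'n) set). (\<chi> i. h) \<bullet> b) = h ^ CARD('n)"
proof -
  have "(\<chi> i. h) \<bullet> b = h" if "b \<in> (Basis :: (real ^ 'n) set)" for b
    using that by (auto simp: Basis_vec_def inner_axis)
  then show ?thesis by simp
qed

lemma cell_measure:
  fixes k :: "'n::finite \<Rightarrow> int"
  assumes "h > 0"
  shows "emeasure lborel (cell h k) = ennreal (h ^ CARD('n))"
proof -
  define a b :: "real ^ 'n" where "a = (\<chi> i. h * k i)" and "b = (\<chi> i. h * (k i + 1))"
  have sub: "box a b \<subseteq> cell h k" "cell h k \<subseteq> cbox a b"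
    by (auto simp: cell_def mem_box_cart a_def b_def less_imp_le)
  have ab: "b - a = (\<chi> i. h)" by (simp add: a_def b_def vec_eq_iff algebra_simps)
  have le: "\<forall>c\<in>Basis. a \<bullet> c \<le> b \<bullet> c"
    using assms by (auto simp: Basis_vec_def inner_axis a_def b_def)
  have "emeasure lborel (box a b) \<le> emeasure lborel (cell h k)" "emeasure lborel (cell h k) \<le> emeasure lborel (cbox a b)"
    using sub by (auto intro!: emeasure_mono)
  moreover have "emeasure lborel (box a b) = ennreal (h ^ CARD('n))" "emeasure lborel (cbox a b) = ennreal (h ^ CARD('n))"
    using le by (simp_all add: emeasure_lborel_box_eq emeasure_lborel_cbox_eq ab prod_inner_Basis_const)
  ultimately show ?thesis by simp
qed

lemma cell_integral:
  fixes k :: "'n::finite \<Rightarrow> int"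
  assumes "h > 0"
  shows "integrable lborel (indicator (cell h k) :: real ^ 'n \<Rightarrow> real)"
    "(\<integral>x. indicator (cell h k) x \<partial>lborel) = h ^ CARD('n)"
proof -
  have e: "emeasure lborel (cell h k) = ennreal (h ^ CARD('n))" by (rule cell_measure[OF assms])
  then show "integrable lborel (indicator (cell h k) :: real ^ 'n \<Rightarrow> real)"
    by (intro integrable_real_indicator) auto
  have "measure lborel (cell h k) = h ^ CARD('n)"
    using assms unfolding measure_def e by simp
  then show "(\<integral>x. indicator (cell h k) x \<partial>lborel) = h ^ CARD('n)" by simp
qed

text \<open>Poincare's inequality summed over all cells of a grid. On a cell, the deviation of \<open>f\<close> from its
  mean is controlled by the mean square of \<open>f x - f y\<close> over pairs of points of the cell. As \<open>y - x\<close>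
  lies in the cube of half-side \<open>h\<close>, the sum over the cells is at most the double integral of
  \<open>(f (x + z) - f x)\<^sup>2\<close>; after exchanging the integrals, \<open>translation_estimate\<close> applies.\<close>

lemma grid_Poincare:
  fixes f :: "real ^ 'n \<Rightarrow> real"
  assumes f: "C1c UNIV f" and h: "h > 0" and I: "finite I"
    and cover: "\<And>x. f x \<noteq> 0 \<Longrightarrow> \<exists>k\<in>I. x \<in> cell h k"
  shows "h ^ CARD('n) * (\<integral>x. (f x)\<^sup>2 \<partial>lborel)
    \<le> (\<Sum>k\<in>I. (\<integral>x. indicator (cell h k) x * f x \<partial>lborel)\<^sup>2) + (2 * h) ^ CARD('n) * (real CARD('n) * h\<^sup>2) * energy f"
proof -
  define m where "m = h ^ CARD('n)"
  note cf = C1c_cont(1)[OF f]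
  note [measurable] = borel_cont[OF cf]
  obtain R where R: "R > 0" "\<And>x. norm x > R \<Longrightarrow> f x = 0" using C1c_bounds[OF f] by metis
  define Z where "Z = cbox (\<chi> i. - h) (\<chi> i. h :: real ^ 'n)"
  define q :: "('n \<Rightarrow> int) \<Rightarrow> real ^ 'n \<Rightarrow> real" where "q = (\<lambda>k. indicator (cell h k))"
  have qi: "integrable lborel (q k)" "(\<integral>x. q k x \<partial>lborel) = m" for k
    using cell_integral[OF h, of k] by (simp_all add: q_def m_def)
  have [measurable]: "q k \<in> borel_measurable borel" for k unfolding q_def by measurable
  have i1: "integrable lborel f" using C1c_integrable_mult[OF f, of "\<lambda>x. 1"] by simp
  have i2: "integrable lborel (\<lambda>x. (f x)\<^sup>2)" by (rule C1c_integrable_sq[OF f])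
  have iq: "integrable lborel (\<lambda>x. q k x * g x)" if "integrable lborel g" for g :: "real ^ 'n \<Rightarrow> real" and k
  proof (rule Bochner_Integration.integrable_bound[OF that])
    show "AE x in lborel. norm (q k x * g x) \<le> norm (g x)"
      by (intro AE_I2) (simp add: q_def indicator_def)
  qed (use that in measurable)
  define F G where "F k = (\<integral>x. q k x * f x \<partial>lborel)" and "G k = (\<integral>x. q k x * (f x)\<^sup>2 \<partial>lborel)" for k
  define g where "g = (\<lambda>(x, z). indicator Z z * (f (x + z) - f x)\<^sup>2)"
  have Zn: "norm z \<le> sqrt (real CARD('n)) * h" "(norm z)\<^sup>2 \<le> real CARD('n) * h\<^sup>2" if "z \<in> Z" for z
  proof -
    have "\<bar>z $ i\<bar> \<le> h" for i using that by (auto simp: Z_def mem_box_cart abs_le_iff minus_le_iff)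
    then have "(z $ i)\<^sup>2 \<le> h\<^sup>2" for i using h by (metis abs_le_square_iff abs_of_pos)
    then have "(\<Sum>i\<in>UNIV. (z $ i)\<^sup>2) \<le> (\<Sum>i\<in>(UNIV::'n set). h\<^sup>2)" by (intro sum_mono)
    then show s: "(norm z)\<^sup>2 \<le> real CARD('n) * h\<^sup>2"
      by (simp add: norm_vec_def L2_set_def sum_nonneg)
    show "norm z \<le> sqrt (real CARD('n)) * h"
      using real_sqrt_le_mono[OF s] h by (simp add: real_sqrt_mult)
  qed
  have gint: "integrable (lborel \<Otimes>\<^sub>M lborel) g"
  proof -
    define S where "S = cball (0 :: real ^ 'n) (R + sqrt (real CARD('n)) * h) \<times> Z"
    have "compact S" unfolding S_def Z_def by (intro compact_Times compact_cball compact_cbox)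
    then have "integrable lborel (\<lambda>p. indicator S p *\<^sub>R (f (fst p + snd p) - f (fst p))\<^sup>2)"
      by (intro borel_integrable_compact continuous_intros continuous_on_compose2[OF cf]) auto
    moreover have "indicator S p *\<^sub>R (f (fst p + snd p) - f (fst p))\<^sup>2 = g p" for p
    proof (cases "snd p \<in> Z \<and> norm (fst p) > R + sqrt (real CARD('n)) * h")
      case True
      have "norm (fst p) \<le> norm (fst p + snd p) + norm (snd p)"
        by (metis norm_triangle_ineq4 add_diff_cancel)
      then have "norm (fst p + snd p) > R" using True Zn(1)[of "snd p"] by linarith
      moreover have "norm (fst p) > R" using True Zn(1)[of "snd p"] norm_ge_zero[of "snd p"] by linarith
      ultimately show ?thesis using R(2) by (simp add: g_def split_beta)
    next
      case False
      then show ?thesis by (cases p) (auto simp: g_def S_def indicator_def)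
    qed
    ultimately show ?thesis by (simp add: lborel_prod)
  qed
  \<comment> \<open>\<open>J x\<close> is the inner of the two integrals of \<open>(f (x + z) - f x)\<^sup>2\<close>.\<close>
  define J where "J x = (\<integral>z. g (x, z) \<partial>lborel)" for x
  have Ji: "integrable lborel J" unfolding J_def by (rule lborel_pair.integrable_fst'[OF gint])
  have gz: "integrable lborel (\<lambda>z. g (x, z))" for x
  proof -
    have "integrable lborel (\<lambda>z. indicator Z z *\<^sub>R (f (x + z) - f x)\<^sup>2)"
      unfolding Z_def by (intro borel_integrable_compact continuous_intros continuous_on_compose2[OF cf]) auto
    then show ?thesis by (simp add: g_def)
  qed
  have J_le: "(\<integral>x. J x \<partial>lborel) \<le> (2 * h) ^ CARD('n) * (real CARD('n) * h\<^sup>2) * energy f"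
  proof -
    have "(\<integral>x. J x \<partial>lborel) = (\<integral>z. (\<integral>x. g (x, z) \<partial>lborel) \<partial>lborel)"
      unfolding J_def using lborel_pair.Fubini_integral[of "\<lambda>x z. g (x, z)"] gint by simp
    also have "\<dots> \<le> (\<integral>z. indicator Z z * (real CARD('n) * h\<^sup>2 * energy f) \<partial>lborel)"
    proof (rule integral_mono)
      show "integrable lborel (\<lambda>z. \<integral>x. g (x, z) \<partial>lborel)"
        using lborel_pair.integrable_snd[of "\<lambda>x z. g (x, z)"] gint by simp
      show "integrable lborel (\<lambda>z. indicator Z z * (real CARD('n) * h\<^sup>2 * energy f))"
        unfolding Z_def by (intro integrable_mult_left integrable_real_indicator emeasure_bounded_finite) auto
      fix z
      show "(\<integral>x. g (x, z) \<partial>lborel) \<le> indicator Z z * (real CARD('n) * h\<^sup>2 * energy f)"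
      proof (cases "z \<in> Z")
        case True
        have "(\<integral>x. (f (x + z) - f x)\<^sup>2 \<partial>lborel) \<le> (norm z)\<^sup>2 * energy f" by (rule translation_estimate[OF f])
        also have "\<dots> \<le> real CARD('n) * h\<^sup>2 * energy f"
          by (intro mult_right_mono Zn True energy_nonneg)
        finally show ?thesis using True by (simp add: g_def)
      qed (simp add: g_def)
    qed
    also have "\<dots> = (2 * h) ^ CARD('n) * (real CARD('n) * h\<^sup>2 * energy f)"
    proof -
      have "(\<chi> i. h :: real ^ 'n) - (\<chi> i. - h) = (\<chi> i. 2 * h)" by (simp add: vec_eq_iff)
      moreover have "\<forall>c\<in>Basis. (\<chi> i. - h) \<bullet> c \<le> (\<chi> i. h :: real ^ 'n) \<bullet> c"
        using h by (auto simp: Basis_vec_def inner_axis)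
      ultimately have "measure lborel Z = (2 * h) ^ CARD('n)"
        unfolding Z_def measure_lborel_cbox_eq by (simp add: prod_inner_Basis_const)
      then show ?thesis by (simp add: Z_def)
    qed
    finally show ?thesis by simp
  qed
  have inner: "(\<integral>y. q k y * (f x - f y)\<^sup>2 \<partial>lborel) = m * (f x)\<^sup>2 - 2 * f x * F k + G k" for k x
  proof -
    have e: "(\<lambda>y. q k y * (f x - f y)\<^sup>2) = (\<lambda>y. (f x)\<^sup>2 * q k y - 2 * f x * (q k y * f y) + q k y * (f y)\<^sup>2)"
      by (auto simp: power2_eq_square algebra_simps)
    show ?thesis unfolding e F_def G_def using qi[of k] iq[OF i1, of k] iq[OF i2, of k] by simp
  qed
  have outer: "(\<integral>x. q k x * (m * (f x)\<^sup>2 - 2 * f x * F k + G k) \<partial>lborel) = 2 * m * G k - 2 * (F k)\<^sup>2"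
    "integrable lborel (\<lambda>x. q k x * (m * (f x)\<^sup>2 - 2 * f x * F k + G k))" for k
  proof -
    have e: "(\<lambda>x. q k x * (m * (f x)\<^sup>2 - 2 * f x * F k + G k)) = (\<lambda>x. m * (q k x * (f x)\<^sup>2) - 2 * F k * (q k x * f x) + G k * q k x)"
      by (auto simp: algebra_simps)
    show "(\<integral>x. q k x * (m * (f x)\<^sup>2 - 2 * f x * F k + G k) \<partial>lborel) = 2 * m * G k - 2 * (F k)\<^sup>2"
    proof -
      have "(\<integral>x. m * (q k x * (f x)\<^sup>2) - 2 * F k * (q k x * f x) + G k * q k x \<partial>lborel)
          = m * G k - 2 * F k * F k + G k * m"
        using qi[of k] iq[OF i1, of k] iq[OF i2, of k] by (simp flip: F_def G_def)
      then show ?thesis unfolding e by (simp add: power2_eq_square)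
    qed
    show "integrable lborel (\<lambda>x. q k x * (m * (f x)\<^sup>2 - 2 * f x * F k + G k))"
      unfolding e using qi[of k] iq[OF i1, of k] iq[OF i2, of k] by simp
  qed
  have disj: "k = k'" if "x \<in> cell h k" "x \<in> cell h k'" for x k k'
  proof
    fix i
    have "h * k i < h * (k' i + 1)" "h * k' i < h * (k i + 1)"
      using that unfolding cell_def by (auto intro: le_less_trans)
    then have "real_of_int (k i) < real_of_int (k' i) + 1" "real_of_int (k' i) < real_of_int (k i) + 1"
      by (simp_all only: mult_less_cancel_left_pos[OF h])
    then show "k i = k' i" by linarith
  qed
  have qsum: "(\<Sum>k\<in>I. q k x * a k) = (if \<exists>k\<in>I. x \<in> cell h k then a (THE k. x \<in> cell h k) else 0)" for x a
  proof (cases "\<exists>k\<in>I. x \<in> cell h k")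
    case True
    then obtain k where k: "k \<in> I" "x \<in> cell h k" by blast
    have "(\<Sum>k'\<in>I. q k' x * a k') = (\<Sum>k'\<in>I. if k' = k then a k else 0)"
      by (intro sum.cong refl) (use k disj in \<open>auto simp: q_def indicator_def\<close>)
    moreover have "(THE k. x \<in> cell h k) = k" using k disj by blast
    ultimately show ?thesis unfolding if_P[OF True] using k I by simp
  next
    case False
    then show ?thesis by (auto simp: q_def indicator_def intro!: sum.neutral)
  qed
  have pt: "(\<Sum>k\<in>I. q k x * (m * (f x)\<^sup>2 - 2 * f x * F k + G k)) \<le> J x" for x
  proof -
    have J0: "J x \<ge> 0" unfolding J_def by (intro integral_nonneg_AE) (auto simp: g_def)
    have le: "m * (f x)\<^sup>2 - 2 * f x * F k + G k \<le> J x" if x: "x \<in> cell h k" for k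
    proof -
      have "m * (f x)\<^sup>2 - 2 * f x * F k + G k = (\<integral>y. q k y * (f x - f y)\<^sup>2 \<partial>lborel)" using inner by simp
      also have "\<dots> = (\<integral>z. q k (z + x) * (f x - f (z + x))\<^sup>2 \<partial>lborel)"
        by (rule lborel_translate(1)[symmetric]) measurable
      also have "\<dots> \<le> J x"
        unfolding J_def
      proof (rule integral_mono[OF _ gz])
        have e: "(\<lambda>y. q k y * (f x - f y)\<^sup>2) = (\<lambda>y. (f x)\<^sup>2 * q k y - 2 * f x * (q k y * f y) + q k y * (f y)\<^sup>2)"
          by (auto simp: power2_eq_square algebra_simps)
        have "integrable lborel (\<lambda>y. q k y * (f x - f y)\<^sup>2)"
          unfolding e using qi[of k] iq[OF i1, of k] iq[OF i2, of k] by simp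
        then show "integrable lborel (\<lambda>z. q k (z + x) * (f x - f (z + x))\<^sup>2)"
          by (subst lborel_translate(2)[where f="\<lambda>y. q k y * (f x - f y)\<^sup>2"]) measurable
        fix z
        show "q k (z + x) * (f x - f (z + x))\<^sup>2 \<le> g (x, z)"
        proof (cases "z + x \<in> cell h k")
          case True
          have "- h \<le> z $ i \<and> z $ i \<le> h" for i
          proof -
            have "h * k i \<le> z $ i + x $ i" "z $ i + x $ i < h * (k i + 1)" "h * k i \<le> x $ i" "x $ i < h * (k i + 1)"
              using True x by (auto simp: cell_def)
            then show ?thesis by (simp add: algebra_simps)
          qed
          then have "z \<in> Z" by (simp add: Z_def mem_box_cart)
          then show ?thesis using True by (simp add: g_def q_def power2_commute add.commute)
        qed (simp add: q_def g_def)
      qed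
      finally show ?thesis .
    qed
    show ?thesis
    proof (cases "\<exists>k\<in>I. x \<in> cell h k")
      case True
      then obtain k where k: "k \<in> I" "x \<in> cell h k" by blast
      then have "(THE k. x \<in> cell h k) = k" using disj by blast
      then show ?thesis unfolding qsum using True le[OF k(2)] by simp
    qed (simp add: qsum J0)
  qed
  have "(\<Sum>k\<in>I. 2 * m * G k - 2 * (F k)\<^sup>2) = (\<integral>x. (\<Sum>k\<in>I. q k x * (m * (f x)\<^sup>2 - 2 * f x * F k + G k)) \<partial>lborel)"
    using outer by simp
  also have "\<dots> \<le> (\<integral>x. J x \<partial>lborel)"
    using outer Ji pt by (intro integral_mono) auto
  also note J_le
  finally have main: "(\<Sum>k\<in>I. 2 * m * G k - 2 * (F k)\<^sup>2) \<le> (2 * h) ^ CARD('n) * (real CARD('n) * h\<^sup>2) * energy f" .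
  have "(\<Sum>k\<in>I. G k) = (\<integral>x. (\<Sum>k\<in>I. q k x * (f x)\<^sup>2) \<partial>lborel)"
    unfolding G_def using iq[OF i2] by simp
  also have "\<dots> = (\<integral>x. (f x)\<^sup>2 \<partial>lborel)"
    using cover by (intro Bochner_Integration.integral_cong refl) (auto simp: qsum)
  finally have "(\<Sum>k\<in>I. 2 * m * G k - 2 * (F k)\<^sup>2) = 2 * (m * (\<integral>x. (f x)\<^sup>2 \<partial>lborel)) - 2 * (\<Sum>k\<in>I. (F k)\<^sup>2)"
    by (simp add: sum_subtractf flip: sum_distrib_left)
  moreover have "0 \<le> (\<Sum>k\<in>I. (F k)\<^sup>2)" by (intro sum_nonneg) auto
  moreover have "0 \<le> (2 * h) ^ CARD('n) * (real CARD('n) * h\<^sup>2) * energy f"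
    using h energy_nonneg by (intro mult_nonneg_nonneg) auto
  ultimately have "m * (\<integral>x. (f x)\<^sup>2 \<partial>lborel) \<le> (\<Sum>k\<in>I. (F k)\<^sup>2) + (2 * h) ^ CARD('n) * (real CARD('n) * h\<^sup>2) * energy f"
    using main by linarith
  then show ?thesis by (simp add: m_def F_def q_def)
qed

lemma finite_cells: "finite {k :: 'n::finite \<Rightarrow> int. \<forall>i. \<bar>k i\<bar> \<le> N}"
proof -
  have "{k :: 'n \<Rightarrow> int. \<forall>i. \<bar>k i\<bar> \<le> N} = PiE UNIV (\<lambda>_. {- N..N})"
    by (auto simp: PiE_def abs_le_iff minus_le_iff Pi_def)
  then show ?thesis by (simp add: finite_PiE)
qed

lemma cells_cover:
  fixes x :: "real ^ 'n"
  assumes "h > 0" "norm x \<le> R"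
  shows "\<exists>k\<in>{k. \<forall>i. \<bar>k i\<bar> \<le> \<lceil>R / h\<rceil> + 1}. x \<in> cell h k"
proof
  define k where "k = (\<lambda>i. \<lfloor>x $ i / h\<rfloor>)"
  have "of_int (k i) \<le> x $ i / h" "x $ i / h < of_int (k i) + 1" for i unfolding k_def by linarith+
  then show "x \<in> cell h k" using assms(1) unfolding cell_def by (auto simp: field_simps)
  have "\<bar>x $ i\<bar> \<le> R" for i using component_le_norm_cart[of x i] assms by linarith
  then have b: "\<bar>x $ i / h\<bar> \<le> R / h" for i using assms(1) by (simp add: divide_right_mono)
  have "\<bar>k i\<bar> \<le> \<lceil>R / h\<rceil> + 1" for i using b[of i] unfolding k_def by linarith
  then show "k \<in> {k. \<forall>i. \<bar>k i\<bar> \<le> \<lceil>R / h\<rceil> + 1}" by simp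
qed

text \<open>Cantor's diagonal argument.\<close>

lemma common_convergent_subsequence:
  fixes S :: "nat \<Rightarrow> nat \<Rightarrow> real"
  assumes "\<And>p. \<exists>b. \<forall>n. \<bar>S n p\<bar> \<le> b"
  shows "\<exists>r :: nat \<Rightarrow> nat. strict_mono r \<and> (\<forall>p. convergent (\<lambda>n. S (r n) p))"
proof -
  interpret subseqs "\<lambda>p r. convergent (\<lambda>n. S (r n) p)"
  proof
    fix p and s :: "nat \<Rightarrow> nat" assume "strict_mono s"
    obtain b where "\<forall>n. \<bar>S n p\<bar> \<le> b" using assms by blast
    then have "bounded (range (\<lambda>n. S (s n) p))" by (auto simp: bounded_iff)
    then obtain l r where "strict_mono r" "((\<lambda>n. S (s n) p) \<circ> r) \<longlonglongrightarrow> l"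
      using bounded_imp_convergent_subsequence by blast
    then show "\<exists>r'. strict_mono r' \<and> convergent (\<lambda>n. S ((s \<circ> r') n) p)"
      by (auto simp: o_def convergent_def)
  qed
  have "convergent (\<lambda>n. S (diagseq n) p)" for p
  proof -
    have "convergent (\<lambda>n. S ((diagseq \<circ> (+) (Suc p)) n) p)"
    proof (rule diagseq_holds)
      fix r s n assume "strict_mono (r :: nat \<Rightarrow> nat)" "convergent (\<lambda>na. S (s na) n)"
      then show "convergent (\<lambda>na. S ((s \<circ> r) na) n)"
        using convergent_subseq_convergent[of "\<lambda>na. S (s na) n" r] by (simp add: o_def)
    qed
    then have "convergent (\<lambda>n. S (diagseq (n + Suc p)) p)" by (simp add: o_def add.commute)
    then show ?thesis using convergent_ignore_initial_segment[of "\<lambda>n. S (diagseq n) p" "Suc p"] by simp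
  qed
  then show ?thesis using subseq_diagseq by blast
qed

lemma energy_diff_le:
  assumes "C1c UNIV f" "C1c UNIV g"
  shows "energy (\<lambda>x. f x - g x) \<le> 2 * energy f + 2 * energy g"
proof -
  have gr: "grad (\<lambda>x. f x - g x) x = grad f x - grad g x" for x
    using grad_add[OF C1c_cont(3)[OF assms(1)] Ck_cmult[OF C1c_cont(3)[OF assms(2)], of "-1"], of x]
      grad_cmult[OF C1c_cont(3)[OF assms(2)], of "-1" x] by simp
  have "energy (\<lambda>x. f x - g x) \<le> (\<integral>x. 2 * (norm (grad f x))\<^sup>2 + 2 * (norm (grad g x))\<^sup>2 \<partial>lborel)"
    unfolding energy_def gr
  proof (rule integral_mono)
    show "(norm (grad f x - grad g x))\<^sup>2 \<le> 2 * (norm (grad f x))\<^sup>2 + 2 * (norm (grad g x))\<^sup>2" for x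
      using norm_add_sq[of "grad f x" "- grad g x"] by simp
    have "C1c UNIV (\<lambda>x. f x - g x)"
      using C1c_sum[of "{0, Suc 0}" UNIV "\<lambda>i. if i = 0 then f else g" "\<lambda>i. if i = 0 then 1 else -1"] assms by simp
    from C1c_integrable_grad_sq[OF this] show "integrable lborel (\<lambda>x. (norm (grad f x - grad g x))\<^sup>2)"
      unfolding gr .
  qed (use assms[THEN C1c_integrable_grad_sq] in auto)
  also have "\<dots> = 2 * energy f + 2 * energy g"
    unfolding energy_def using assms[THEN C1c_integrable_grad_sq] by simp
  finally show ?thesis .
qed

text \<open>Along a subsequence on which the integrals over all cells of all grids of side \<open>1 / (j + 1)\<close>
  converge, \<open>grid_Poincare\<close> bounds the distance of two terms by a multiple of \<open>h\<^sup>2\<close> times their energy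
  plus finitely many differences of cell integrals. First the grid is chosen to make the former small,
  then the indices to make the latter small.\<close>

lemma Rellich:
  fixes f :: "nat \<Rightarrow> real ^ 'n \<Rightarrow> real"
  assumes f: "\<And>n. C1c UNIV (f n)" and R: "\<And>n x. norm x > R \<Longrightarrow> f n x = 0"
    and b: "\<And>n. (\<integral>x. (f n x)\<^sup>2 \<partial>lborel) \<le> M" "\<And>n. energy (f n) \<le> M"
  shows "\<exists>r :: nat \<Rightarrow> nat. strict_mono r \<and> (\<forall>e>0. \<exists>N. \<forall>m\<ge>N. \<forall>n\<ge>N. (\<integral>x. (f (r m) x - f (r n) x)\<^sup>2 \<partial>lborel) < e)"
proof -
  define l where "l h k n = (\<integral>x. indicator (cell h k) x * f n x \<partial>lborel)" for h k n
  define h where "h j = inverse (real (Suc j))" for j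
  have hp: "h j > 0" for j by (simp add: h_def)
  have i1: "integrable lborel (f n)" for n using C1c_integrable_mult[OF f, of "\<lambda>x. 1"] by simp
  have i2: "integrable lborel (\<lambda>x. (f n x)\<^sup>2)" for n by (rule C1c_integrable_sq[OF f])
  have li: "integrable lborel (\<lambda>x. indicator (cell (h j) k) x * f n x)" for j k n
  proof (rule Bochner_Integration.integrable_bound[OF i1[of n]])
    note [measurable] = borel_cont[OF C1c_cont(1)[OF f[of n]]]
    show "(\<lambda>x. indicator (cell (h j) k) x * f n x) \<in> borel_measurable lborel" by measurable
    show "AE x in lborel. norm (indicator (cell (h j) k) x * f n x) \<le> norm (f n x)"
      by (intro AE_I2) (simp add: indicator_def)
  qed
  have lb: "\<bar>l (h j) k n\<bar> \<le> h j ^ CARD('n) + M" for j k n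
  proof -
    have "\<bar>l (h j) k n\<bar> \<le> (\<integral>x. indicator (cell (h j) k) x + (f n x)\<^sup>2 \<partial>lborel)"
      unfolding l_def
    proof (rule integral_abs_bound_integral[OF li])
      show "integrable lborel (\<lambda>x. indicator (cell (h j) k) x + (f n x)\<^sup>2)"
        by (intro Bochner_Integration.integrable_add cell_integral(1)[OF hp] i2)
      show "\<bar>indicator (cell (h j) k) x * f n x\<bar> \<le> indicator (cell (h j) k) x + (f n x)\<^sup>2" for x
      proof (cases "x \<in> cell (h j) k")
        case True
        have "\<bar>f n x\<bar> \<le> 1 + (f n x)\<^sup>2"
          using sum_squares_bound[of 1 "\<bar>f n x\<bar>"] by simp
        then show ?thesis using True by simp
      qed simp
    qed
    also have "\<dots> \<le> h j ^ CARD('n) + M"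
    proof -
      have "(\<integral>x. indicator (cell (h j) k) x + (f n x)\<^sup>2 \<partial>lborel)
          = (\<integral>x. indicator (cell (h j) k) x \<partial>lborel) + (\<integral>x. (f n x)\<^sup>2 \<partial>lborel)"
        by (intro Bochner_Integration.integral_add cell_integral(1)[OF hp] i2)
      then show ?thesis using cell_integral(2)[OF hp, of j k] b(1)[of n] by linarith
    qed
    finally show ?thesis .
  qed
  define S where "S n p = (case from_nat p :: nat \<times> ('n \<Rightarrow> int) of (j, k) \<Rightarrow> l (h j) k n)" for n p
  have "\<exists>b. \<forall>n. \<bar>S n p\<bar> \<le> b" for p
    using lb by (cases "from_nat p :: nat \<times> ('n \<Rightarrow> int)") (auto simp: S_def)
  then obtain r where r: "strict_mono r" "\<And>p. convergent (\<lambda>n. S (r n) p)"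
    using common_convergent_subsequence[of S] by blast
  have lc: "convergent (\<lambda>n. l (h j) k (r n))" for j k
    using r(2)[of "to_nat (j, k)"] by (simp add: S_def)
  have M0: "M \<ge> 0" using b(2)[of 0] energy_nonneg[of "f 0"] by linarith
  have cauchy: "\<exists>N. \<forall>m\<ge>N. \<forall>n\<ge>N. (\<integral>x. (f (r m) x - f (r n) x)\<^sup>2 \<partial>lborel) < e" if e: "e > 0" for e
  proof -
    \<comment> \<open>\<open>4 * M\<close> bounds the energy of a difference of two terms; the summand \<open>1\<close> only keeps \<open>A\<close> positive.\<close>
    define A where "A = 2 ^ CARD('n) * real CARD('n) * (4 * M) + 1"
    have A: "A > 0" using M0 by (simp add: A_def add_nonneg_pos)
    obtain j where j: "h j < min 1 (e / (2 * A))"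
      using reals_Archimedean[of "min 1 (e / (2 * A))"] e A by (auto simp: h_def)
    define m0 where "m0 = h j ^ CARD('n)"
    have m0: "m0 > 0" using hp by (simp add: m0_def)
    define I where "I = {k :: 'n \<Rightarrow> int. \<forall>i. \<bar>k i\<bar> \<le> \<lceil>R / h j\<rceil> + 1}"
    have I: "finite I" unfolding I_def by (rule finite_cells)
    define e' where "e' = sqrt (m0 * e / (2 * (real (card I) + 1)))"
    have e': "e' > 0" "e'\<^sup>2 = m0 * e / (2 * (real (card I) + 1))" using m0 e by (auto simp: e'_def)
    have "\<exists>N. \<forall>m\<ge>N. \<forall>n\<ge>N. \<bar>l (h j) k (r m) - l (h j) k (r n)\<bar> < e'" for k
      using convergent_Cauchy[OF lc[of j k]] e'(1) unfolding Cauchy_def dist_real_def by blast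
    then obtain N where N: "\<And>k m n. m \<ge> N k \<Longrightarrow> n \<ge> N k \<Longrightarrow> \<bar>l (h j) k (r m) - l (h j) k (r n)\<bar> < e'"
      by metis
    define N0 where "N0 = Max (insert 0 (N ` I))"
    have N0: "N k \<le> N0" if "k \<in> I" for k unfolding N0_def using I that by (intro Max_ge) auto
    have "(\<integral>x. (f (r m) x - f (r n) x)\<^sup>2 \<partial>lborel) < e" if mn: "m \<ge> N0" "n \<ge> N0" for m n
    proof -
      define g where "g = (\<lambda>x. f (r m) x - f (r n) x)"
      have g: "C1c UNIV g" unfolding g_def
        using C1c_sum[of "{0, Suc 0}" UNIV "\<lambda>i. if i = 0 then f (r m) else f (r n)" "\<lambda>i. if i = 0 then 1 else -1"] f by simp
      have cov: "\<exists>k\<in>I. x \<in> cell (h j) k" if "g x \<noteq> 0" for x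
      proof -
        have "norm x \<le> R"
        proof (rule ccontr)
          assume "\<not> norm x \<le> R"
          then have "R < norm x" by simp
          then show False using that R[of x "r m"] R[of x "r n"] by (simp add: g_def)
        qed
        then show ?thesis unfolding I_def by (rule cells_cover[OF hp])
      qed
      have gl: "(\<integral>x. indicator (cell (h j) k) x * g x \<partial>lborel) = l (h j) k (r m) - l (h j) k (r n)" for k
        unfolding l_def g_def using li by (simp add: right_diff_distrib)
      have "(\<integral>x. indicator (cell (h j) k) x * g x \<partial>lborel)\<^sup>2 \<le> e'\<^sup>2" if "k \<in> I" for k
        unfolding gl using N[of k m n] N0[OF that] mn e'(1) by (intro power2_le_iff_abs_le[THEN iffD2]) auto
      then have "(\<Sum>k\<in>I. (\<integral>x. indicator (cell (h j) k) x * g x \<partial>lborel)\<^sup>2) \<le> real (card I) * e'\<^sup>2"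
        using sum_mono[of I _ "\<lambda>_. e'\<^sup>2"] by simp
      also have "\<dots> < m0 * e / 2"
      proof -
        have "real (card I) / (real (card I) + 1) < 1" by simp
        then have "(m0 * e / 2) * (real (card I) / (real (card I) + 1)) < (m0 * e / 2) * 1"
          using m0 e by (intro mult_strict_left_mono) auto
        then show ?thesis unfolding e'(2) by (simp add: field_simps)
      qed
      finally have s: "(\<Sum>k\<in>I. (\<integral>x. indicator (cell (h j) k) x * g x \<partial>lborel)\<^sup>2) < m0 * e / 2" .
      have "energy g \<le> 4 * M"
        using energy_diff_le[OF f[of "r m"] f[of "r n"]] b(2)[of "r m"] b(2)[of "r n"] by (simp add: g_def)
      then have "2 ^ CARD('n) * real CARD('n) * energy g \<le> A"
        unfolding A_def using mult_left_mono[of "energy g" "4 * M" "2 ^ CARD('n) * real CARD('n)"]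
        by (simp add: add_increasing2)
      moreover have "(h j)\<^sup>2 \<le> h j"
        using j hp[of j] by (simp add: power2_eq_square mult_le_cancel_left1)
      ultimately have "(h j)\<^sup>2 * (2 ^ CARD('n) * real CARD('n) * energy g) \<le> h j * A"
        using hp[of j] energy_nonneg[of g] by (intro mult_mono) auto
      also have "\<dots> < e / 2" using j A by (simp add: field_simps)
      finally have t: "(h j)\<^sup>2 * (2 ^ CARD('n) * real CARD('n) * energy g) < e / 2" .
      have "m0 * (\<integral>x. (g x)\<^sup>2 \<partial>lborel) \<le> (\<Sum>k\<in>I. (\<integral>x. indicator (cell (h j) k) x * g x \<partial>lborel)\<^sup>2)
          + (2 * h j) ^ CARD('n) * (real CARD('n) * (h j)\<^sup>2) * energy g"
        unfolding m0_def by (rule grid_Poincare[OF g hp I cov])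
      also have "(2 * h j) ^ CARD('n) * (real CARD('n) * (h j)\<^sup>2) * energy g
          = m0 * ((h j)\<^sup>2 * (2 ^ CARD('n) * real CARD('n) * energy g))"
        by (simp add: m0_def power_mult_distrib)
      also have "(\<Sum>k\<in>I. (\<integral>x. indicator (cell (h j) k) x * g x \<partial>lborel)\<^sup>2) + \<dots> < m0 * e / 2 + m0 * (e / 2)"
        using s t m0 by (intro add_strict_mono mult_strict_left_mono) auto
      also have "\<dots> = m0 * e" by simp
      finally show ?thesis using m0 by (simp add: g_def)
    qed
    then show ?thesis by blast
  qed
  show ?thesis by (intro exI[of _ r] conjI allI impI r(1) cauchy)
qed

section \<open>Spectral theory of a pair of quadratic forms\<close>

text \<open>Gaussian elimination: either the last equation is trivial, or it determines one unknown \<open>p\<close> in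
  terms of the others, which are renumbered by \<open>s\<close>.\<close>

lemma underdetermined_system:
  fixes A :: "nat \<Rightarrow> nat \<Rightarrow> real"
  assumes "m < n"
  shows "\<exists>c. (\<exists>j<n. c j \<noteq> 0) \<and> (\<forall>i<m. (\<Sum>j<n. c j * A i j) = 0)"
  using assms
proof (induction m arbitrary: n A)
  case 0
  then show ?case by (intro exI[of _ "\<lambda>j. 1"]) auto
next
  case (Suc m)
  show ?case
  proof (cases "\<forall>j<n. A m j = 0")
    case True
    obtain c where c: "\<exists>j<n. c j \<noteq> 0" "\<forall>i<m. (\<Sum>j<n. c j * A i j) = 0"
      using Suc.IH[of n A] Suc.prems by auto
    have "(\<Sum>j<n. c j * A i j) = 0" if "i < Suc m" for i
      using c(2) True that by (cases "i = m") auto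
    then show ?thesis using c(1) by blast
  next
    case False
    then obtain p where p: "p < n" "A m p \<noteq> 0" by blast
    \<comment> \<open>The increasing enumeration of the indices below \<open>n\<close> other than \<open>p\<close>.\<close>
    define s where "s j = (if j < p then j else Suc j)" for j
    have sinj: "inj_on s {..<n - 1}" by (auto simp: s_def inj_on_def split: if_splits)
    have sim: "s ` {..<n - 1} = {..<n} - {p}"
    proof (intro subset_antisym subsetI)
      fix x assume "x \<in> {..<n} - {p}"
      then show "x \<in> s ` {..<n - 1}"
        using p by (cases "x < p") (auto simp: s_def image_iff intro!: bexI[of _ x] bexI[of _ "x - 1"])
    qed (use p in \<open>auto simp: s_def split: if_splits\<close>)
    define A' where "A' i j = A i (s j) - A m (s j) / A m p * A i p" for i j
    have "m < n - 1" using Suc.prems by simp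
    from Suc.IH[OF this, of A'] obtain c where
      c: "\<exists>j<n - 1. c j \<noteq> 0" "\<forall>i<m. (\<Sum>j<n - 1. c j * A' i j) = 0" by blast
    define c' where "c' x = (if x = p then - (\<Sum>j<n - 1. c j * A m (s j)) / A m p else c (the_inv_into {..<n - 1} s x))" for x
    have cs: "c' (s j) = c j" if "j < n - 1" for j
      using that the_inv_into_f_f[OF sinj, of j] by (auto simp: c'_def s_def)
    have sum: "(\<Sum>x<n. c' x * A i x) = c' p * A i p + (\<Sum>j<n - 1. c j * A i (s j))" for i
    proof -
      have "(\<Sum>x<n. c' x * A i x) = c' p * A i p + (\<Sum>x\<in>{..<n} - {p}. c' x * A i x)"
        using p by (simp add: sum.remove)
      also have "(\<Sum>x\<in>{..<n} - {p}. c' x * A i x) = (\<Sum>j<n - 1. c' (s j) * A i (s j))"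
        by (simp only: sim[symmetric] sum.reindex[OF sinj] o_def)
      finally show ?thesis using cs by simp
    qed
    have "(\<Sum>x<n. c' x * A i x) = 0" if "i < Suc m" for i
    proof (cases "i = m")
      case True
      then show ?thesis unfolding sum using p by (simp add: c'_def)
    next
      case False
      have "(\<Sum>j<n - 1. c j * A' i j) = (\<Sum>j<n - 1. c j * A i (s j)) - (\<Sum>j<n - 1. c j * A m (s j)) / A m p * A i p"
        unfolding A'_def by (simp add: right_diff_distrib sum_subtractf sum_distrib_right sum_divide_distrib mult.assoc)
      then show ?thesis unfolding sum using c(2) False that by (simp add: c'_def)
    qed
    moreover have "\<exists>x<n. c' x \<noteq> 0"
    proof -
      obtain j where "j < n - 1" "c j \<noteq> 0" using c(1) by blast
      then show ?thesis using cs[of j] sim by (intro exI[of _ "s j"]) auto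
    qed
    ultimately show ?thesis by blast
  qed
qed

abbreviation lincomb :: "nat \<Rightarrow> (nat \<Rightarrow> real) \<Rightarrow> (nat \<Rightarrow> 'a \<Rightarrow> real) \<Rightarrow> 'a \<Rightarrow> real" where
  "lincomb k c e \<equiv> \<lambda>x. \<Sum>i<k. c i * e i x"

abbreviation sq :: "('a \<Rightarrow> 'a \<Rightarrow> real) \<Rightarrow> 'a \<Rightarrow> real" where
  "sq F u \<equiv> F u u"

locale psd_form =
  fixes V :: "('a \<Rightarrow> real) set" and F :: "('a \<Rightarrow> real) \<Rightarrow> ('a \<Rightarrow> real) \<Rightarrow> real"
  assumes zero: "(\<lambda>x. 0) \<in> V"
    and comb: "\<And>u v a b. u \<in> V \<Longrightarrow> v \<in> V \<Longrightarrow> (\<lambda>x. a * u x + b * v x) \<in> V"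
    and lin: "\<And>u v w a b. u \<in> V \<Longrightarrow> v \<in> V \<Longrightarrow> w \<in> V \<Longrightarrow> F (\<lambda>x. a * u x + b * v x) w = a * F u w + b * F v w"
    and sym: "\<And>u v. u \<in> V \<Longrightarrow> v \<in> V \<Longrightarrow> F u v = F v u"
    and nonneg: "\<And>u. u \<in> V \<Longrightarrow> F u u \<ge> 0"
begin

lemma diff_in: "u \<in> V \<Longrightarrow> v \<in> V \<Longrightarrow> (\<lambda>x. u x - v x) \<in> V"
  using comb[of u v 1 "-1"] by simp

lemma scale_in: "u \<in> V \<Longrightarrow> (\<lambda>x. a * u x) \<in> V"
  using comb[of u u a 0] by simp

lemma lin2: "u \<in> V \<Longrightarrow> v \<in> V \<Longrightarrow> w \<in> V \<Longrightarrow> F w (\<lambda>x. a * u x + b * v x) = a * F w u + b * F w v"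
  using lin[of u v w a b] sym comb by metis

lemma quad:
  assumes "u \<in> V" "v \<in> V"
  shows "sq F (\<lambda>x. a * u x + b * v x) = a\<^sup>2 * F u u + 2 * (a * b) * F u v + b\<^sup>2 * F v v"
  using assms by (simp add: lin lin2 comb sym[OF assms(2,1)] power2_eq_square algebra_simps)

lemma diff_left: "u \<in> V \<Longrightarrow> v \<in> V \<Longrightarrow> w \<in> V \<Longrightarrow> F (\<lambda>x. u x - v x) w = F u w - F v w"
  using lin[of u v w 1 "-1"] by simp

lemma quad_diff: "u \<in> V \<Longrightarrow> v \<in> V \<Longrightarrow> sq F (\<lambda>x. u x - v x) = F u u - 2 * F u v + F v v"
  using quad[of u v 1 "-1"] by simp

lemma quad_add: "u \<in> V \<Longrightarrow> v \<in> V \<Longrightarrow> sq F (\<lambda>x. u x + v x) = F u u + 2 * F u v + F v v"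
  using quad[of u v 1 1] by simp

lemma quad_scale: "u \<in> V \<Longrightarrow> sq F (\<lambda>x. a * u x) = a\<^sup>2 * F u u"
  using quad[of u u a 0] by simp

lemma sum_in: fixes k :: nat shows "(\<And>i. i < k \<Longrightarrow> e i \<in> V) \<Longrightarrow> (lincomb k c e) \<in> V"
proof (induction k)
  case (Suc k)
  then have "(\<lambda>x. 1 * (\<Sum>i<k. c i * e i x) + c k * e k x) \<in> V" by (intro comb) auto
  then show ?case by simp
qed (simp add: zero)

lemma zero_left: "w \<in> V \<Longrightarrow> F (\<lambda>x. 0) w = 0"
  using lin[of w w w 0 0] by simp

lemma sum_left:
  fixes k :: nat
  shows "\<forall>i<k. e i \<in> V \<Longrightarrow> w \<in> V \<Longrightarrow> F (lincomb k c e) w = (\<Sum>i<k. c i * F (e i) w)"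
proof (induction k)
  case (Suc k)
  have "F (\<lambda>x. 1 * (\<Sum>i<k. c i * e i x) + c k * e k x) w = 1 * F (lincomb k c e) w + c k * F (e k) w"
    using Suc.prems by (intro lin sum_in) auto
  then show ?case using Suc by simp
qed (simp add: zero_left)

lemma sum_right:
  fixes k :: nat
  shows "\<forall>i<k. e i \<in> V \<Longrightarrow> w \<in> V \<Longrightarrow> F w (lincomb k c e) = (\<Sum>i<k. c i * F w (e i))"
  using sum_left[of k e w c] sym[of w "\<lambda>x. \<Sum>i<k. c i * e i x"] sym[of w] sum_in[of k e c] by simp

lemma Cauchy_Schwarz:
  assumes "u \<in> V" "v \<in> V"
  shows "(F u v)\<^sup>2 \<le> F u u * F v v"
proof (rule quadratic_nonneg)
  show "0 \<le> F u u + 2 * F u v * t + F v v * t\<^sup>2" for t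
    using nonneg[OF comb[OF assms, of 1 t]] quad[OF assms, of 1 t] by (simp add: mult_ac)
qed (rule nonneg[OF assms(2)])

lemma null_orthogonal: "u \<in> V \<Longrightarrow> v \<in> V \<Longrightarrow> F u u = 0 \<Longrightarrow> F u v = 0"
  using Cauchy_Schwarz[of u v] by simp

lemma limit_mixed:
  assumes "\<And>n::nat. z n \<in> V" "u \<in> V" "v \<in> V"
    and "(\<lambda>n. sq F (\<lambda>x. z n x - u x)) \<longlonglongrightarrow> 0"
  shows "(\<lambda>n. F (z n) v) \<longlonglongrightarrow> F u v"
proof -
  have "(\<lambda>n. sq F (\<lambda>x. z n x - u x) * F v v) \<longlonglongrightarrow> 0 * F v v"
    by (intro tendsto_intros assms)
  then have l: "(\<lambda>n. sq F (\<lambda>x. z n x - u x) * F v v) \<longlonglongrightarrow> 0" by (simp only: mult_zero_left)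
  have "(\<lambda>n. (F (\<lambda>x. z n x - u x) v)\<^sup>2) \<longlonglongrightarrow> 0"
  proof (rule tendsto_sandwich[OF _ _ tendsto_const l])
    show "\<forall>\<^sub>F n in sequentially. (F (\<lambda>x. z n x - u x) v)\<^sup>2 \<le> sq F (\<lambda>x. z n x - u x) * F v v"
      by (intro always_eventually allI Cauchy_Schwarz diff_in assms)
  qed simp
  then have "(\<lambda>n. F (z n) v - F u v) \<longlonglongrightarrow> 0"
    using assms diff_left by simp
  then show ?thesis by (simp add: LIM_zero_iff)
qed

lemma limit_square:
  assumes "\<And>n::nat. z n \<in> V" "u \<in> V"
    and "(\<lambda>n. sq F (\<lambda>x. z n x - u x)) \<longlonglongrightarrow> 0"
  shows "(\<lambda>n. sq F (z n)) \<longlonglongrightarrow> F u u"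
proof -
  have "(\<lambda>n. sq F (\<lambda>x. z n x - u x) + 2 * F (z n) u - F u u) \<longlonglongrightarrow> 0 + 2 * F u u - F u u"
    by (intro tendsto_intros assms limit_mixed)
  then show ?thesis using assms by (simp add: quad_diff)
qed

text \<open>A finite-dimensional perturbation bound: the Gram matrix of the \<open>d i\<close> is dominated by the rank-one
  matrix of the square roots of its diagonal.\<close>

lemma sum_bound:
  fixes k :: nat
  assumes d: "\<forall>i<k. d i \<in> V"
  shows "sq F (lincomb k c d) \<le> (\<Sum>i<k. (c i)\<^sup>2) * (\<Sum>i<k. sq F (d i))"
proof -
  have dV: "(lincomb k c d) \<in> V" using d by (intro sum_in) auto
  define s where "s i = sqrt (sq F (d i))" for i
  have s: "F (d i) (d j) \<le> s i * s j" "- (s i * s j) \<le> F (d i) (d j)" "0 \<le> s i" "(s i)\<^sup>2 = sq F (d i)"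
    if "i < k" "j < k" for i j
  proof -
    have n: "0 \<le> sq F (d i)" "0 \<le> sq F (d j)" using nonneg d that by auto
    then show "0 \<le> s i" "(s i)\<^sup>2 = sq F (d i)" by (auto simp: s_def)
    have "(F (d i) (d j))\<^sup>2 \<le> (s i * s j)\<^sup>2"
      using Cauchy_Schwarz[of "d i" "d j"] d that n by (simp add: s_def power_mult_distrib)
    then have "\<bar>F (d i) (d j)\<bar> \<le> \<bar>s i * s j\<bar>" by (simp only: abs_le_square_iff)
    then have "\<bar>F (d i) (d j)\<bar> \<le> s i * s j" using n by (simp add: s_def)
    then show "F (d i) (d j) \<le> s i * s j" "- (s i * s j) \<le> F (d i) (d j)" by linarith+
  qed
  have "sq F (lincomb k c d) = (\<Sum>i<k. c i * (\<Sum>j<k. c j * F (d i) (d j)))"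
    unfolding sum_left[OF d dV] using d by (intro sum.cong refl) (simp add: sum_right)
  also have "\<dots> \<le> (\<Sum>i<k. \<bar>c i\<bar> * s i * (\<Sum>j<k. \<bar>c j\<bar> * s j))"
    unfolding sum_distrib_left
  proof (intro sum_mono)
    fix i j assume "i \<in> {..<k}" "j \<in> {..<k}"
    then have "\<bar>F (d i) (d j)\<bar> \<le> s i * s j" using s[of i j] by auto
    then have "\<bar>c i\<bar> * (\<bar>c j\<bar> * \<bar>F (d i) (d j)\<bar>) \<le> \<bar>c i\<bar> * (\<bar>c j\<bar> * (s i * s j))"
      by (intro mult_left_mono) auto
    moreover have "c i * (c j * F (d i) (d j)) \<le> \<bar>c i\<bar> * (\<bar>c j\<bar> * \<bar>F (d i) (d j)\<bar>)"
      using abs_ge_self[of "c i * (c j * F (d i) (d j))"] by (simp add: abs_mult)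
    ultimately show "c i * (c j * F (d i) (d j)) \<le> \<bar>c i\<bar> * s i * (\<bar>c j\<bar> * s j)" by (simp add: mult_ac)
  qed
  also have "\<dots> = (\<Sum>i<k. \<bar>c i\<bar> * s i)\<^sup>2" by (simp add: power2_eq_square sum_distrib_right)
  also have "\<dots> \<le> (\<Sum>i<k. \<bar>c i\<bar>\<^sup>2) * (\<Sum>i<k. (s i)\<^sup>2)" by (rule Cauchy_Schwarz_ineq_sum)
  also have "\<dots> = (\<Sum>i<k. (c i)\<^sup>2) * (\<Sum>i<k. sq F (d i))"
    using s(4) by simp
  finally show ?thesis .
qed

lemma Young:
  assumes "u \<in> V" "v \<in> V" "\<eta> > 0"
  shows "sq F (\<lambda>x. u x + v x) \<le> (1 + \<eta>) * F u u + (1 + 1 / \<eta>) * F v v"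
proof -
  have "0 \<le> sq F (\<lambda>x. \<eta> * u x + (-1) * v x)"
    by (intro nonneg comb assms)
  then have "0 \<le> \<eta>\<^sup>2 * F u u - 2 * \<eta> * F u v + F v v" unfolding quad[OF assms(1,2)] by simp
  then have "0 \<le> (\<eta>\<^sup>2 * F u u - 2 * \<eta> * F u v + F v v) / \<eta>" using assms(3) by (intro divide_nonneg_pos)
  also have "\<dots> = \<eta> * F u u - 2 * F u v + F v v / \<eta>"
    using assms(3) by (simp add: field_simps power2_eq_square)
  finally show ?thesis unfolding quad_add[OF assms(1,2)] by (simp add: algebra_simps)
qed

end

text \<open>The form \<open>B\<close> plays the role of the scalar product of \<open>L\<^sup>2\<close> and \<open>E\<close> that of the energy. Functions are
  not identified when \<open>B\<close> does not distinguish them, so \<open>B\<close> is only semidefinite, and linear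
  independence is understood modulo its null space.\<close>

locale spectral_forms = B: psd_form V B + E: psd_form V E
  for V :: "('a \<Rightarrow> real) set" and B E :: "('a \<Rightarrow> real) \<Rightarrow> ('a \<Rightarrow> real) \<Rightarrow> real" +
  assumes compact: "\<And>(u :: nat \<Rightarrow> 'a \<Rightarrow> real) M. (\<And>n. u n \<in> V) \<Longrightarrow> (\<And>n. sq B (u n) + sq E (u n) \<le> M) \<Longrightarrow>
      \<exists>r :: nat \<Rightarrow> nat. strict_mono r \<and> (\<forall>e>0. \<exists>N. \<forall>m\<ge>N. \<forall>n\<ge>N.
        sq B (\<lambda>x. u (r m) x - u (r n) x) < e)"
    and complete: "\<And>u :: nat \<Rightarrow> 'a \<Rightarrow> real. (\<And>n. u n \<in> V) \<Longrightarrow>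
      (\<And>e. e > 0 \<Longrightarrow> \<exists>N. \<forall>m\<ge>N. \<forall>n\<ge>N. sq B (\<lambda>x. u m x - u n x) +
          sq E (\<lambda>x. u m x - u n x) < e) \<Longrightarrow>
      \<exists>v\<in>V. (\<lambda>n. sq B (\<lambda>x. u n x - v x)) \<longlonglongrightarrow> 0 \<and> (\<lambda>n. sq E (\<lambda>x. u n x - v x)) \<longlonglongrightarrow> 0"
    and infinite_dim: "\<And>k::nat. \<exists>u. (\<forall>i<k. u i \<in> V) \<and>
      (\<forall>c. sq B (lincomb k c u) = 0 \<longrightarrow> (\<forall>i<k. c i = 0))"
begin

definition eigenfunction :: "('a \<Rightarrow> real) \<Rightarrow> real \<Rightarrow> bool" where
  "eigenfunction u l \<longleftrightarrow> u \<in> V \<and> (\<forall>v\<in>V. E u v = l * B u v)"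

text \<open>An orthonormal list of eigenfunctions; by the last clause no eigenvalue has been skipped.\<close>

definition eigensystem :: "nat \<Rightarrow> (nat \<Rightarrow> 'a \<Rightarrow> real) \<Rightarrow> (nat \<Rightarrow> real) \<Rightarrow> bool" where
  "eigensystem k e \<sigma> \<longleftrightarrow> (\<forall>i<k. eigenfunction (e i) (\<sigma> i)) \<and>
     (\<forall>i<k. \<forall>j<k. B (e i) (e j) = (if i = j then 1 else 0)) \<and>
     (\<forall>i<k. \<forall>v\<in>V. (\<forall>j<i. B v (e j) = 0) \<longrightarrow> \<sigma> i * B v v \<le> E v v)"

lemma eigensystemD:
  assumes "eigensystem k e \<sigma>" "i < k"
  shows "e i \<in> V" "\<And>v. v \<in> V \<Longrightarrow> E (e i) v = \<sigma> i * B (e i) v"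
    "\<And>j. j < k \<Longrightarrow> B (e i) (e j) = (if i = j then 1 else 0)"
    "\<And>v. v \<in> V \<Longrightarrow> (\<And>j. j < i \<Longrightarrow> B v (e j) = 0) \<Longrightarrow> \<sigma> i * B v v \<le> E v v"
  using assms unfolding eigensystem_def eigenfunction_def by auto

lemma eigenvalues_mono:
  assumes s: "eigensystem k e \<sigma>" and "i \<le> j" "j < k"
  shows "\<sigma> i \<le> \<sigma> j"
proof -
  have j: "e j \<in> V" "sq E (e j) = \<sigma> j" "sq B (e j) = 1"
    using eigensystemD[OF s \<open>j < k\<close>] assms by auto
  show ?thesis
  proof (cases "i = j")
    case False
    then have "i < j" using assms by simp
    have "\<sigma> i * sq B (e j) \<le> sq E (e j)"
      by (rule eigensystemD(4)[OF s]) (use \<open>i < j\<close> \<open>j < k\<close> j(1) eigensystemD(3)[OF s \<open>j < k\<close>] in auto)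
    then show ?thesis using j by simp
  qed simp
qed

text \<open>Both forms are expanded along the projection, because eigenfunctions diagonalise both.\<close>

lemma project_off:
  fixes k :: nat
  assumes e: "\<forall>i<k. e i \<in> V" "\<forall>i<k. \<forall>j<k. B (e i) (e j) = (if i = j then 1 else 0)"
    and v: "v \<in> V"
  defines "r \<equiv> (\<lambda>x. v x - (\<Sum>i<k. B v (e i) * e i x))"
  shows "r \<in> V" "\<And>j. j < k \<Longrightarrow> B r (e j) = 0"
    "\<And>w. w \<in> V \<Longrightarrow> B v w = B r w + (\<Sum>i<k. B v (e i) * B (e i) w)"
    "\<And>w. w \<in> V \<Longrightarrow> E v w = E r w + (\<Sum>i<k. B v (e i) * E (e i) w)"
proof -
  have p: "(\<lambda>x. \<Sum>i<k. B v (e i) * e i x) \<in> V" using e(1) by (intro B.sum_in) auto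
  show r: "r \<in> V" unfolding r_def by (intro B.diff_in v p)
  show b: "B v w = B r w + (\<Sum>i<k. B v (e i) * B (e i) w)" if "w \<in> V" for w
    unfolding r_def B.diff_left[OF v p that] by (simp add: B.sum_left[OF e(1) that])
  show "E v w = E r w + (\<Sum>i<k. B v (e i) * E (e i) w)" if "w \<in> V" for w
    unfolding r_def E.diff_left[OF v p that] by (simp add: E.sum_left[OF e(1) that])
  show "B r (e j) = 0" if j: "j < k" for j
  proof -
    have "(\<Sum>i<k. B v (e i) * B (e i) (e j)) = (\<Sum>i<k. if i = j then B v (e i) else 0)"
      using e(2) j by (intro sum.cong) auto
    then show ?thesis using b[of "e j"] e(1) j by simp
  qed
qed

text \<open>The direct method. Let \<open>l\<close> be the infimum of the Rayleigh quotient on the orthogonal complement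
  \<open>W\<close> of the given eigenfunctions. By compactness, a minimising sequence converges with respect to
  \<open>B\<close> along a subsequence. As the sum of two of its terms has Rayleigh quotient at least \<open>l\<close>, the
  parallelogram law shows that it also converges with respect to \<open>E\<close>. The first-order condition
  at the limit is the eigenvalue equation tested with \<open>W\<close>, and testing with the given
  eigenfunctions yields zero on both sides.\<close>

lemma next_eigenfunction:
  assumes s: "eigensystem k e \<sigma>"
  obtains u l where "eigenfunction u l" "B u u = 1" "\<And>i. i < k \<Longrightarrow> B u (e i) = 0"
    "\<And>w. w \<in> V \<Longrightarrow> (\<And>i. i < k \<Longrightarrow> B w (e i) = 0) \<Longrightarrow> l * B w w \<le> E w w"
proof -
  note ev = eigensystemD[OF s]
  have eV: "\<forall>i<k. e i \<in> V" and eO: "\<forall>i<k. \<forall>j<k. B (e i) (e j) = (if i = j then 1 else 0)"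
    using ev(1,3) by auto
  define W where "W = {w \<in> V. \<forall>i<k. B w (e i) = 0}"
  have Wc: "(\<lambda>x. a * u x + b * v x) \<in> W" if "u \<in> W" "v \<in> W" for u v a b
    using that ev(1) by (auto simp: W_def B.comb B.lin)
  have WV: "w \<in> W \<Longrightarrow> w \<in> V" for w by (simp add: W_def)
  define S where "S = {E w w |w. w \<in> W \<and> B w w = 1}"
  have norm1: "E w w / B w w \<in> S" if "w \<in> W" "B w w > 0" for w
  proof -
    define a where "a = 1 / sqrt (B w w)"
    have a2: "a\<^sup>2 = 1 / B w w" using that(2) by (simp add: a_def power_divide)
    have "(\<lambda>x. a * w x) \<in> W" using Wc[OF that(1) that(1), of a 0] by simp
    moreover have "sq B (\<lambda>x. a * w x) = 1" "sq E (\<lambda>x. a * w x) = E w w / B w w"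
      using that(2) by (simp_all add: B.quad_scale[OF WV[OF that(1)]] E.quad_scale[OF WV[OF that(1)]] a2)
    ultimately show ?thesis unfolding S_def by force
  qed
  have "S \<noteq> {}"
  proof -
    obtain u where u: "\<And>i. i < Suc k \<Longrightarrow> u i \<in> V"
      "\<And>c. sq B (lincomb (Suc k) c u) = 0 \<Longrightarrow> \<forall>i<Suc k. c i = 0"
      using infinite_dim[of "Suc k"] by blast
    obtain c where c: "\<exists>j<Suc k. c j \<noteq> 0" "\<forall>i<k. (\<Sum>j<Suc k. c j * B (u j) (e i)) = 0"
      using underdetermined_system[of k "Suc k" "\<lambda>i j. B (u j) (e i)"] by auto
    define w where "w = (lincomb (Suc k) c u)"
    have wV: "w \<in> V" unfolding w_def by (intro B.sum_in u)
    have "B w (e i) = 0" if "i < k" for i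
      using B.sum_left[of "Suc k" u "e i" c] u(1) ev(1)[OF that] c(2) that by (simp add: w_def del: sum.lessThan_Suc)
    then have w: "w \<in> W" using wV by (simp add: W_def)
    have "B w w \<noteq> 0" using u(2)[of c] c(1) unfolding w_def by blast
    then have "B w w > 0" using B.nonneg[OF wV] by simp
    from norm1[OF w this] show ?thesis by blast
  qed
  have bdd: "bdd_below S" by (rule bdd_belowI[of _ 0]) (use E.nonneg WV in \<open>auto simp: S_def\<close>)
  define l where "l = Inf S"
  have l0: "l \<ge> 0" unfolding l_def using \<open>S \<noteq> {}\<close>
    by (intro cInf_greatest) (use E.nonneg WV in \<open>auto simp: S_def\<close>)
  have ray: "l * B w w \<le> E w w" if "w \<in> W" for w
  proof (cases "B w w = 0")
    case True
    then show ?thesis using E.nonneg[OF WV[OF that]] by simp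
  next
    case False
    then have p: "B w w > 0" using B.nonneg[OF WV[OF that]] by simp
    have "E w w / B w w \<in> S" by (rule norm1[OF that p])
    then have "l \<le> E w w / B w w" unfolding l_def by (intro cInf_lower bdd)
    then show ?thesis using p by (simp add: field_simps)
  qed
  have "\<forall>n. \<exists>w. w \<in> W \<and> B w w = 1 \<and> E w w < l + inverse (real (Suc n))"
  proof
    fix n
    have "Inf S < l + inverse (real (Suc n))" by (simp add: l_def)
    then show "\<exists>w. w \<in> W \<and> B w w = 1 \<and> E w w < l + inverse (real (Suc n))"
      using cInf_lessD[OF \<open>S \<noteq> {}\<close>] by (auto simp: S_def)
  qed
  then obtain y where y: "\<And>n. y n \<in> W" "\<And>n. sq B (y n) = 1" "\<And>n. sq E (y n) < l + inverse (real (Suc n))"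
    by metis
  have "sq B (y n) + sq E (y n) \<le> 1 + (l + 1)" for n
  proof -
    have "inverse (real (Suc n)) \<le> 1" by (simp add: field_simps)
    then show ?thesis using y(2,3)[of n] by linarith
  qed
  then obtain r :: "nat \<Rightarrow> nat" where r: "strict_mono r" "\<forall>e>0. \<exists>N. \<forall>m\<ge>N. \<forall>n\<ge>N.
        sq B (\<lambda>x. y (r m) x - y (r n) x) < e"
    using compact[of y "1 + (l + 1)", OF WV[OF y(1)]] by auto
  define z where "z n = y (r n)" for n
  have z: "z n \<in> W" "z n \<in> V" "sq B (z n) = 1" for n :: nat using y WV by (auto simp: z_def)
  have Ez: "sq E (z n) < l + inverse (real (Suc n))" for n
  proof -
    have "inverse (real (Suc (r n))) \<le> inverse (real (Suc n))"
      using seq_suble[OF r(1), of n] by (intro le_imp_inverse_le) auto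
    then show ?thesis using y(3)[of "r n"] unfolding z_def by linarith
  qed
  \<comment> \<open>The parallelogram law, with \<open>ray\<close> applied to the sum of two terms.\<close>
  have Ed: "sq E (\<lambda>x. z m x - z n x) \<le>
      2 * inverse (real (Suc m)) + 2 * inverse (real (Suc n)) + l * sq B (\<lambda>x. z m x - z n x)" for m n
  proof -
    have "(\<lambda>x. z m x + z n x) \<in> W" using Wc[OF z(1)[of m] z(1)[of n], of 1 1] by simp
    from ray[OF this] have "l * (2 + 2 * B (z m) (z n)) \<le> sq E (z m) + 2 * E (z m) (z n) + sq E (z n)"
      by (simp add: B.quad_add[OF z(2) z(2)] E.quad_add[OF z(2) z(2)] z(3))
    then show ?thesis
      using Ez[of m] Ez[of n] unfolding B.quad_diff[OF z(2) z(2)] E.quad_diff[OF z(2) z(2)] z(3)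
      by (simp add: algebra_simps del: of_nat_Suc)
  qed
  have "\<exists>N. \<forall>m\<ge>N. \<forall>n\<ge>N. sq B (\<lambda>x. z m x - z n x) +
          sq E (\<lambda>x. z m x - z n x) < \<epsilon>" if ep: "\<epsilon> > 0" for \<epsilon>
  proof -
    obtain N1 where N1: "\<And>m n. m \<ge> N1 \<Longrightarrow> n \<ge> N1 \<Longrightarrow> sq B (\<lambda>x. z m x - z n x) < \<epsilon> / (2 * (l + 1))"
      using r(2)[rule_format, of "\<epsilon> / (2 * (l + 1))"] ep l0 unfolding z_def by auto
    obtain N2 where N2: "inverse (real (Suc N2)) < \<epsilon> / 8"
      using reals_Archimedean[of "\<epsilon> / 8"] ep by auto
    have "sq B (\<lambda>x. z m x - z n x) + sq E (\<lambda>x. z m x - z n x) < \<epsilon>"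
      if "m \<ge> max N1 N2" "n \<ge> max N1 N2" for m n
    proof -
      have "inverse (real (Suc m)) \<le> inverse (real (Suc N2))" "inverse (real (Suc n)) \<le> inverse (real (Suc N2))"
        using that by (auto intro!: le_imp_inverse_le)
      then have i: "inverse (real (Suc m)) < \<epsilon> / 8" "inverse (real (Suc n)) < \<epsilon> / 8" using N2 by linarith+
      have "(l + 1) * sq B (\<lambda>x. z m x - z n x) < (l + 1) * (\<epsilon> / (2 * (l + 1)))"
        using N1[of m n] that l0 by (intro mult_strict_left_mono) auto
      also have "\<dots> = \<epsilon> / 2" using l0 by (simp add: field_simps)
      finally have b: "(l + 1) * sq B (\<lambda>x. z m x - z n x) < \<epsilon> / 2" .
      have "(l + 1) * sq B (\<lambda>x. z m x - z n x) =
        l * sq B (\<lambda>x. z m x - z n x) + sq B (\<lambda>x. z m x - z n x)"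
        by (simp add: algebra_simps)
      then show ?thesis using Ed[of m n] i b by linarith
    qed
    then show ?thesis by blast
  qed
  then obtain u where u: "u \<in> V" "(\<lambda>n. sq B (\<lambda>x. z n x - u x)) \<longlonglongrightarrow> 0"
      "(\<lambda>n. sq E (\<lambda>x. z n x - u x)) \<longlonglongrightarrow> 0"
    using complete[of z] z(2) by blast
  have "(\<lambda>n. sq B (z n)) \<longlonglongrightarrow> B u u" by (rule B.limit_square[OF z(2) u(1,2)])
  then have Bu: "B u u = 1" using z(3) LIMSEQ_unique[OF _ tendsto_const[of 1]] by simp
  have uo: "B u (e i) = 0" if "i < k" for i
  proof -
    have "(\<lambda>n. B (z n) (e i)) \<longlonglongrightarrow> B u (e i)" by (rule B.limit_mixed[OF z(2) u(1) ev(1)[OF that] u(2)])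
    moreover have "B (z n) (e i) = 0" for n using z(1) that by (simp add: W_def)
    ultimately show ?thesis using LIMSEQ_unique[OF _ tendsto_const[of 0]] by simp
  qed
  have uW: "u \<in> W" using u(1) uo by (simp add: W_def)
  have "E u u \<le> l"
  proof -
    have "(\<lambda>n. l + inverse (real (Suc n))) \<longlonglongrightarrow> l + 0"
      by (intro tendsto_intros LIMSEQ_inverse_real_of_nat)
    then show ?thesis
      using LIMSEQ_le[OF E.limit_square[OF z(2) u(1,3)], of "\<lambda>n. l + inverse (real (Suc n))" l] Ez
      by (auto intro: less_imp_le)
  qed
  then have Eu: "E u u = l" using ray[OF uW] Bu by simp
  have el: "E u w = l * B u w" if w: "w \<in> W" for w
  proof -
    have "(E u w - l * B u w)\<^sup>2 \<le> 0 * (E w w - l * B w w)"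
    proof (rule quadratic_nonneg)
      fix t
      have "l * sq B (\<lambda>x. 1 * u x + t * w x) \<le> sq E (\<lambda>x. 1 * u x + t * w x)"
        by (intro ray Wc uW w)
      then show "0 \<le> 0 + 2 * (E u w - l * B u w) * t + (E w w - l * B w w) * t\<^sup>2"
        unfolding B.quad[OF u(1) WV[OF w]] E.quad[OF u(1) WV[OF w]] Bu Eu by (simp add: algebra_simps)
    qed (use ray[OF w] in simp)
    then show ?thesis by simp
  qed
  have "E u v = l * B u v" if v: "v \<in> V" for v
  proof -
    define w where "w = (\<lambda>x. v x - (\<Sum>i<k. B v (e i) * e i x))"
    note pr = project_off[OF eV eO v, folded w_def]
    have w: "w \<in> W" using pr(1,2) by (simp add: W_def)
    have "E (e i) u = 0" "B (e i) u = 0" if "i < k" for i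
      using ev(2)[OF that u(1)] B.sym[OF ev(1)[OF that] u(1)] uo[OF that] by auto
    then have "E v u = E w u" "B v u = B w u" using pr(3,4)[OF u(1)] by auto
    then show ?thesis using el[OF w] B.sym E.sym u(1) v pr(1) by metis
  qed
  then have "eigenfunction u l" using u(1) by (simp add: eigenfunction_def)
  then show thesis
    by (rule that) (use Bu uo ray in \<open>auto simp: W_def\<close>)
qed

lemma eigensystem_exists: "\<exists>e \<sigma>. eigensystem k e \<sigma>"
proof (induction k)
  case 0
  show ?case by (simp add: eigensystem_def)
next
  case (Suc k)
  then obtain e \<sigma> where s: "eigensystem k e \<sigma>" by blast
  obtain u l where u: "eigenfunction u l" "B u u = 1" "\<And>i. i < k \<Longrightarrow> B u (e i) = 0"
    "\<And>w. w \<in> V \<Longrightarrow> (\<And>i. i < k \<Longrightarrow> B w (e i) = 0) \<Longrightarrow> l * B w w \<le> E w w"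
    by (rule next_eigenfunction[OF s]) blast
  have uV: "u \<in> V" using u(1) by (simp add: eigenfunction_def)
  have "B (e i) u = 0" if "i < k" for i
    using u(3)[OF that] B.sym[OF uV eigensystemD(1)[OF s that]] by simp
  then have "eigensystem (Suc k) (e(k := u)) (\<sigma>(k := l))"
    using s u unfolding eigensystem_def by (auto simp: less_Suc_eq)
  then show ?case by blast
qed

text \<open>Courant--Fischer: a \<open>k\<close>-dimensional space contains a vector orthogonal to the first
  \<open>k - 1\<close> eigenfunctions.\<close>

lemma eigenvalue_le_of_subspace:
  assumes s: "eigensystem (Suc k) e \<sigma>" and p: "\<And>i. i < Suc k \<Longrightarrow> p i \<in> V"
    and ind: "\<And>c. \<exists>i<Suc k. c i \<noteq> 0 \<Longrightarrow> sq B (lincomb (Suc k) c p) > 0"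
    and le: "\<And>c. sq E (lincomb (Suc k) c p)
      \<le> t * sq B (lincomb (Suc k) c p)"
  shows "\<sigma> k \<le> t"
proof -
  obtain c where c: "\<exists>j<Suc k. c j \<noteq> 0" "\<forall>i<k. (\<Sum>j<Suc k. c j * B (p j) (e i)) = 0"
    using underdetermined_system[of k "Suc k" "\<lambda>i j. B (p j) (e i)"] by auto
  define w where "w = (lincomb (Suc k) c p)"
  have wV: "w \<in> V" unfolding w_def by (intro B.sum_in p)
  have "B w (e i) = 0" if "i < k" for i
  proof -
    have "e i \<in> V" using eigensystemD(1)[OF s] that by simp
    then show ?thesis using B.sum_left[of "Suc k" p "e i" c] p c(2) that by (simp add: w_def del: sum.lessThan_Suc)
  qed
  then have "\<sigma> k * B w w \<le> E w w" using eigensystemD(4)[OF s _ wV] by simp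
  also have "\<dots> \<le> t * B w w" unfolding w_def by (rule le)
  finally show ?thesis using ind[OF c(1)] unfolding w_def by simp
qed

text \<open>The component of \<open>u\<close> orthogonal to the first \<open>k\<close> eigenfunctions has energy \<open>l\<close> times its mass,
  but orthogonality forces at least \<open>\<sigma> k\<close> times its mass.\<close>

lemma eigenfunction_below_in_span:
  assumes s: "eigensystem (Suc k) e \<sigma>" and u: "eigenfunction u l" "l < \<sigma> k"
  defines "r \<equiv> (\<lambda>x. u x - (\<Sum>i<k. B u (e i) * e i x))"
  shows "B r r = 0"
proof -
  have uV: "u \<in> V" and ue: "\<And>v. v \<in> V \<Longrightarrow> E u v = l * B u v" using u by (auto simp: eigenfunction_def)
  note ev = eigensystemD[OF s]
  have k: "\<And>i. i < k \<Longrightarrow> i < Suc k" by simp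
  have eV: "\<forall>i<k. e i \<in> V" and eO: "\<forall>i<k. \<forall>j<k. B (e i) (e j) = (if i = j then 1 else 0)"
    using ev(1,3) by auto
  note pr = project_off[OF eV eO uV, folded r_def]
  have re: "B (e i) r = 0" if "i < k" for i
    using pr(2)[OF that] B.sym[OF pr(1) ev(1)[OF k[OF that]]] by simp
  have "E (e i) r = 0" if "i < k" for i
    using ev(2)[OF k[OF that] pr(1)] re[OF that] by simp
  then have "E r r = l * B r r"
    using pr(3,4)[OF pr(1)] re ue[OF pr(1)] by simp
  moreover have "\<sigma> k * B r r \<le> E r r"
    using ev(4)[of k r] pr(1,2) by simp
  ultimately have "(\<sigma> k - l) * B r r \<le> 0" by (simp add: algebra_simps)
  then show ?thesis using u(2) B.nonneg[OF pr(1)] by (simp add: mult_le_0_iff)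
qed

text \<open>Otherwise all \<open>k + 1\<close> eigenfunctions would lie, modulo null vectors, in the span of the first \<open>k\<close>
  members of the eigensystem.\<close>

lemma independent_eigenfunctions_ge:
  assumes s: "eigensystem (Suc k) e \<sigma>"
    and u: "\<And>i. i < Suc k \<Longrightarrow> eigenfunction (u i) (l i)" "\<And>i. i < Suc k \<Longrightarrow> l i \<le> t"
    and ind: "\<And>c. sq B (lincomb (Suc k) c u) = 0 \<Longrightarrow> \<forall>i<Suc k. c i = 0"
  shows "\<sigma> k \<le> t"
proof (rule ccontr)
  assume "\<not> \<sigma> k \<le> t"
  then have l: "l i < \<sigma> k" if "i < Suc k" for i using u(2)[OF that] by simp
  have uV: "u i \<in> V" if "i < Suc k" for i using u(1)[OF that] by (simp add: eigenfunction_def)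
  note ev = eigensystemD[OF s]
  have k: "\<And>i. i < k \<Longrightarrow> i < Suc k" by simp
  have eV: "\<forall>i<k. e i \<in> V" and eO: "\<forall>i<k. \<forall>j<k. B (e i) (e j) = (if i = j then 1 else 0)"
    using ev(1,3) by auto
  obtain c where c: "\<exists>j<Suc k. c j \<noteq> 0" "\<forall>i<k. (\<Sum>j<Suc k. c j * B (u j) (e i)) = 0"
    using underdetermined_system[of k "Suc k" "\<lambda>i j. B (u j) (e i)"] by auto
  define w where "w = (lincomb (Suc k) c u)"
  have wV: "w \<in> V" unfolding w_def by (intro B.sum_in uV)
  have we: "B (e i) w = 0" if "i < k" for i
    using B.sym[OF ev(1)[OF k[OF that]] wV] B.sum_left[of "Suc k" u "e i" c] uV ev(1)[OF k[OF that]] c(2) that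
    by (simp add: w_def del: sum.lessThan_Suc)
  have "B (u i) w = 0" if i: "i < Suc k" for i
  proof -
    define r where "r = (\<lambda>x. u i x - (\<Sum>j<k. B (u i) (e j) * e j x))"
    note pr = project_off[OF eV eO uV[OF i], folded r_def]
    have "B r r = 0" unfolding r_def by (rule eigenfunction_below_in_span[OF s u(1)[OF i] l[OF i]])
    then show ?thesis using B.null_orthogonal[OF pr(1) wV] pr(3)[OF wV] we by simp
  qed
  then have "B w w = 0" using B.sum_left[of "Suc k" u w c] uV wV by (simp add: w_def del: sum.lessThan_Suc)
  then show False using ind[of c] c(1) unfolding w_def by blast
qed

lemma eigensystem_independent:
  assumes s: "eigensystem k e \<sigma>" and z: "sq B (lincomb k c e) = 0" and i: "i < k"
  shows "c i = 0"
proof -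
  note ev = eigensystemD[OF s]
  have V: "(lincomb k c e) \<in> V" by (intro B.sum_in ev)
  have "B (lincomb k c e) (e i) = (\<Sum>j<k. c j * B (e j) (e i))"
    using ev(1) i by (intro B.sum_left) auto
  also have "\<dots> = (\<Sum>j<k. if j = i then c j else 0)"
    using ev(3) i by (intro sum.cong) auto
  finally have "B (lincomb k c e) (e i) = (\<Sum>j<k. if j = i then c j else 0)" .
  then show ?thesis using B.null_orthogonal[OF V ev(1)[OF i] z] i by simp
qed

lemma eigensystem_nonneg: "eigensystem k e \<sigma> \<Longrightarrow> i < k \<Longrightarrow> \<sigma> i \<ge> 0"
  using E.nonneg[of "e i"] eigensystemD(1,3)[of k e \<sigma> i] eigensystemD(2)[of k e \<sigma> i "e i"] by auto

lemma eigensystem_span: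
  assumes s: "eigensystem (Suc k) e \<sigma>"
  defines "w \<equiv> \<lambda>c x. \<Sum>i<Suc k. c i * e i x"
  shows "sq B (w c) = (\<Sum>i<Suc k. (c i)\<^sup>2)" "sq E (w c) \<le> \<sigma> k * (\<Sum>i<Suc k. (c i)\<^sup>2)"
proof -
  note ev = eigensystemD[OF s]
  have V: "w c \<in> V" unfolding w_def using ev(1) by (intro B.sum_in) auto
  have eV: "\<forall>i<Suc k. e i \<in> V" using ev(1) by auto
  have Bi: "B (e i) (w c) = c i" if i: "i < Suc k" for i
  proof -
    have "B (e i) (w c) = (\<Sum>j<Suc k. c j * B (e i) (e j))"
      unfolding w_def using eV i by (intro B.sum_right) auto
    also have "\<dots> = (\<Sum>j<Suc k. if j = i then c j else 0)"
      using ev(3)[OF i] by (intro sum.cong refl) auto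
    also have "\<dots> = c i" using i by simp
    finally show ?thesis .
  qed
  have "sq B (w c) = (\<Sum>i<Suc k. c i * B (e i) (w c))"
    using B.sum_left[OF eV V, of c] by (simp add: w_def)
  also have "\<dots> = (\<Sum>i<Suc k. (c i)\<^sup>2)"
    using Bi by (intro sum.cong refl) (simp add: power2_eq_square)
  finally show "sq B (w c) = (\<Sum>i<Suc k. (c i)\<^sup>2)" .
  have "sq E (w c) = (\<Sum>i<Suc k. c i * E (e i) (w c))"
    using E.sum_left[OF eV V, of c] by (simp add: w_def)
  also have "\<dots> \<le> (\<Sum>i<Suc k. \<sigma> k * (c i)\<^sup>2)"
  proof (rule sum_mono)
    fix i assume "i \<in> {..<Suc k}"
    then have i: "i < Suc k" by simp
    have "c i * E (e i) (w c) = \<sigma> i * (c i)\<^sup>2"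
      using ev(2)[OF i V] Bi[OF i] by (simp add: power2_eq_square)
    also have "\<dots> \<le> \<sigma> k * (c i)\<^sup>2"
      using eigenvalues_mono[OF s, of i k] i by (intro mult_right_mono) auto
    finally show "c i * E (e i) (w c) \<le> \<sigma> k * (c i)\<^sup>2" .
  qed
  finally show "sq E (w c) \<le> \<sigma> k * (\<Sum>i<Suc k. (c i)\<^sup>2)" by (simp only: sum_distrib_left)
qed

text \<open>Replacing each eigenfunction by a nearby member \<open>p i\<close> of a dense set changes both forms on the span
  by arbitrarily little, relative to the sum of the squared coefficients. The errors are separated
  from the main terms by Young's inequality with the parameter \<open>\<eta>\<close>.\<close>

lemma spectral_subspace_approx:
  assumes s: "eigensystem (Suc k) e \<sigma>"
    and T: "T \<subseteq> V" "\<And>u \<delta>. u \<in> V \<Longrightarrow> \<delta> > 0 \<Longrightarrow>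
      \<exists>p\<in>T. sq B (\<lambda>x. p x - u x) + sq E (\<lambda>x. p x - u x) < \<delta>"
    and ep: "\<epsilon> > 0"
  shows "\<exists>p. (\<forall>i<Suc k. p i \<in> T) \<and> (\<forall>c.
     (\<Sum>i<Suc k. (c i)\<^sup>2) \<le> 2 * sq B (lincomb (Suc k) c p) \<and>
     sq E (lincomb (Suc k) c p)
       \<le> (\<sigma> k + \<epsilon>) * sq B (lincomb (Suc k) c p))"
proof -
  note ev = eigensystemD[OF s]
  have sk: "\<sigma> k \<ge> 0" using eigensystem_nonneg[OF s] by simp
  have "((\<lambda>\<eta>. ((1 + \<eta>) * \<sigma> k + \<eta>) * ((1 + \<eta>) / (1 - \<eta>))) \<longlongrightarrow> \<sigma> k) (at_right 0)"
    by (auto intro!: tendsto_eq_intros)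
  then have "\<forall>\<^sub>F \<eta> in at_right 0. ((1 + \<eta>) * \<sigma> k + \<eta>) * ((1 + \<eta>) / (1 - \<eta>)) < \<sigma> k + \<epsilon>"
    using ep by (intro order_tendstoD) auto
  moreover have "\<forall>\<^sub>F \<eta> in at_right (0::real). \<eta> < 1/3"
    by (rule order_tendstoD(2)[OF tendsto_ident_at]) simp
  moreover have "\<forall>\<^sub>F \<eta> in at_right (0::real). 0 < \<eta>" by (rule eventually_at_right_less)
  ultimately have "\<forall>\<^sub>F \<eta> in at_right 0. ((1 + \<eta>) * \<sigma> k + \<eta>) * ((1 + \<eta>) / (1 - \<eta>)) < \<sigma> k + \<epsilon> \<and> \<eta> < 1/3 \<and> 0 < \<eta>"
    by eventually_elim simp
  then obtain \<eta> where eta: "((1 + \<eta>) * \<sigma> k + \<eta>) * ((1 + \<eta>) / (1 - \<eta>)) < \<sigma> k + \<epsilon>" "\<eta> < 1/3" "0 < \<eta>"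
    using eventually_happens'[OF trivial_limit_at_right_real] by blast
  \<comment> \<open>Chosen such that \<open>(1 + 1 / \<eta>) (k + 1) \<delta> = \<eta>\<close>.\<close>
  define \<delta> where "\<delta> = \<eta> / ((1 + 1 / \<eta>) * real (Suc k))"
  have dl: "\<delta> > 0" using eta by (simp add: \<delta>_def add_pos_pos)
  have "\<forall>i. \<exists>p. i < Suc k \<longrightarrow> p \<in> T \<and> sq B (\<lambda>x. p x - e i x) + sq E (\<lambda>x. p x - e i x) < \<delta>"
  proof
    fix i
    show "\<exists>p. i < Suc k \<longrightarrow> p \<in> T \<and> sq B (\<lambda>x. p x - e i x) + sq E (\<lambda>x. p x - e i x) < \<delta>"
    proof (cases "i < Suc k")
      case True
      then show ?thesis using T(2)[OF ev(1)[OF True] dl] by blast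
    qed auto
  qed
  then obtain p where p: "\<And>i. i < Suc k \<Longrightarrow> p i \<in> T"
    "\<And>i. i < Suc k \<Longrightarrow> sq B (\<lambda>x. p i x - e i x) + sq E (\<lambda>x. p i x - e i x) < \<delta>"
    by metis
  define d where "d i = (\<lambda>x. p i x - e i x)" for i
  have dV: "\<forall>i<Suc k. d i \<in> V" unfolding d_def using p(1) T(1) ev(1) by (auto intro!: B.diff_in)
  have dB: "(\<Sum>i<Suc k. sq B (d i)) \<le> real (Suc k) * \<delta>" "(\<Sum>i<Suc k. sq E (d i)) \<le> real (Suc k) * \<delta>"
  proof -
    have "sq B (d i) \<le> \<delta>" "sq E (d i) \<le> \<delta>" if "i < Suc k" for i
      using p(2)[OF that] B.nonneg[of "d i"] E.nonneg[of "d i"] dV that unfolding d_def by fastforce+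
    then show "(\<Sum>i<Suc k. sq B (d i)) \<le> real (Suc k) * \<delta>" "(\<Sum>i<Suc k. sq E (d i)) \<le> real (Suc k) * \<delta>"
      using sum_mono[of "{..<Suc k}" "\<lambda>i. sq B (d i)" "\<lambda>_. \<delta>"] sum_mono[of "{..<Suc k}" "\<lambda>i. sq E (d i)" "\<lambda>_. \<delta>"]
      by (simp_all del: sum.lessThan_Suc of_nat_Suc)
  qed
  have main: "(\<Sum>i<Suc k. (c i)\<^sup>2) \<le> 2 * sq B (lincomb (Suc k) c p) \<and>
     sq E (lincomb (Suc k) c p)
       \<le> (\<sigma> k + \<epsilon>) * sq B (lincomb (Suc k) c p)" for c
  proof -
    define S where "S = (\<Sum>i<Suc k. (c i)\<^sup>2)"
    define P where "P = (lincomb (Suc k) c p)"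
    define w where "w = (lincomb (Suc k) c e)"
    define h where "h = (lincomb (Suc k) c d)"
    have S0: "S \<ge> 0" unfolding S_def by (intro sum_nonneg) auto
    have V: "P \<in> V" "w \<in> V" "h \<in> V" unfolding P_def w_def h_def
      using p(1) T(1) ev(1) dV by (auto intro!: B.sum_in simp del: sum.lessThan_Suc)
    have hm: "(\<lambda>x. (-1) * h x) \<in> V" using V(3) by (rule B.scale_in)
    have Pw: "P = (\<lambda>x. w x + h x)" "w = (\<lambda>x. P x + (-1) * h x)"
      by (auto simp: P_def w_def h_def d_def algebra_simps sum_subtractf simp del: sum.lessThan_Suc)
    have hs: "B h h \<le> S * (real (Suc k) * \<delta>)" "E h h \<le> S * (real (Suc k) * \<delta>)"
      using B.sum_bound[OF dV, of c] E.sum_bound[OF dV, of c] mult_left_mono[OF dB(1) S0] mult_left_mono[OF dB(2) S0]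
      unfolding h_def S_def by linarith+
    have q: "(1 + 1 / \<eta>) * (S * (real (Suc k) * \<delta>)) = \<eta> * S"
    proof -
      have "(1 + 1 / \<eta>) \<noteq> 0" using eta(3) by (simp add: add_pos_pos less_imp_neq[symmetric])
      then show ?thesis by (simp add: \<delta>_def del: of_nat_Suc)
    qed
    have e1: "0 \<le> 1 + 1 / \<eta>" using eta(3) by simp
    have ww: "B w w = S" "E w w \<le> \<sigma> k * S"
      unfolding w_def S_def by (rule eigensystem_span[OF s])+
    have "S \<le> (1 + \<eta>) * B P P + (1 + 1 / \<eta>) * sq B (\<lambda>x. (-1) * h x)"
      using B.Young[OF V(1) hm eta(3)] unfolding Pw(2)[symmetric] ww(1) .
    also have "sq B (\<lambda>x. (-1) * h x) = B h h" using B.quad_scale[OF V(3), of "-1"] by simp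
    also have "(1 + 1 / \<eta>) * B h h \<le> \<eta> * S" using mult_left_mono[OF hs(1) e1] unfolding q .
    finally have S: "(1 - \<eta>) * S \<le> (1 + \<eta>) * B P P" by (simp add: algebra_simps)
    then have SB: "S \<le> ((1 + \<eta>) / (1 - \<eta>)) * B P P" using eta by (simp add: field_simps)
    have BP: "B P P \<ge> 0" using B.nonneg[OF V(1)] .
    have "(1 + \<eta>) / (1 - \<eta>) \<le> 2" using eta by (simp add: field_simps)
    from mult_right_mono[OF this BP] have r1: "S \<le> 2 * B P P" using SB by linarith
    have "E P P \<le> (1 + \<eta>) * E w w + (1 + 1 / \<eta>) * E h h"
      using E.Young[OF V(2,3) eta(3)] unfolding Pw(1)[symmetric] .
    also have "\<dots> \<le> (1 + \<eta>) * (\<sigma> k * S) + \<eta> * S"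
    proof -
      have "0 \<le> 1 + \<eta>" using eta by simp
      from mult_left_mono[OF ww(2) this] mult_left_mono[OF hs(2) e1, unfolded q] show ?thesis by linarith
    qed
    also have "\<dots> = ((1 + \<eta>) * \<sigma> k + \<eta>) * S" by (simp add: algebra_simps)
    also have "\<dots> \<le> ((1 + \<eta>) * \<sigma> k + \<eta>) * (((1 + \<eta>) / (1 - \<eta>)) * B P P)"
      using SB sk eta by (intro mult_left_mono) auto
    also have "\<dots> = (((1 + \<eta>) * \<sigma> k + \<eta>) * ((1 + \<eta>) / (1 - \<eta>))) * B P P" by simp
    also have "\<dots> \<le> (\<sigma> k + \<epsilon>) * B P P"
      using eta(1) BP by (intro mult_right_mono) auto
    finally show ?thesis using r1 unfolding P_def S_def by simp
  qed
  show ?thesis by (intro exI[of _ p] conjI allI impI p(1) main[THEN conjunct1] main[THEN conjunct2])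
qed

end

section \<open>The variational principle for the eigenvalues\<close>

definition mass_form :: "(real ^ 'n) set \<Rightarrow> (real ^ 'n \<Rightarrow> real) \<Rightarrow> (real ^ 'n \<Rightarrow> real) \<Rightarrow> real" where
  "mass_form U u v = (\<integral>x. u x * v x \<partial>lebesgue_on U)"

definition energy_form :: "(real ^ 'n \<Rightarrow> real) \<Rightarrow> (real ^ 'n) set \<Rightarrow> (real ^ 'n \<Rightarrow> real) \<Rightarrow> (real ^ 'n \<Rightarrow> real) \<Rightarrow> real" where
  "energy_form V U u v = (\<integral>x. weak_gradient U u x \<bullet> weak_gradient U v x + V x * u x * v x \<partial>lebesgue_on U)"

text \<open>Both eigenvalue problems of the theorem are of this kind: potential zero on \<open>\<Omega>\<close>, and \<open>C\<close> times the
  indicator of the complement of \<open>\<Omega>\<close> on \<open>D\<close>.\<close>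

locale schroedinger =
  fixes V :: "real ^ 'n \<Rightarrow> real" and U :: "(real ^ 'n) set" and c :: real
  assumes U: "open U" "bounded U" "U \<noteq> {}"
    and Vm: "V \<in> borel_measurable (lebesgue_on U)" and Vb: "\<And>x. 0 \<le> V x" "\<And>x. V x \<le> c"
begin

lemma c0: "c \<ge> 0" using Vb[of undefined] by linarith

lemma V_L2:
  assumes "u \<in> L2_on U"
  shows "(\<lambda>x. V x * u x) \<in> L2_on U"
proof -
  note [measurable] = Vm L2D(1)[OF assms]
  have "integrable (lebesgue_on U) (\<lambda>x. (norm (V x * u x))\<^sup>2)"
  proof (rule Bochner_Integration.integrable_bound)
    show "integrable (lebesgue_on U) (\<lambda>x. c\<^sup>2 * (norm (u x))\<^sup>2)" using L2D(2)[OF assms] by auto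
    have "(V x)\<^sup>2 * (u x)\<^sup>2 \<le> c\<^sup>2 * (u x)\<^sup>2" for x
      using Vb by (intro mult_right_mono power_mono) auto
    then show "AE x in lebesgue_on U. norm ((norm (V x * u x))\<^sup>2) \<le> norm (c\<^sup>2 * (norm (u x))\<^sup>2)"
      by (intro AE_I2) (simp add: power_mult_distrib)
  qed measurable
  then show ?thesis by (simp add: L2_on_def)
qed

lemma V_int: "u \<in> L2_on U \<Longrightarrow> v \<in> L2_on U \<Longrightarrow> integrable (lebesgue_on U) (\<lambda>x. V x * u x * v x)"
  using L2_mult[OF V_L2] by blast

lemma energy_form_sobolev:
  assumes "sobolev U u g" "sobolev U v h"
  shows "energy_form V U u v = (\<integral>x. g x \<bullet> h x \<partial>lebesgue_on U) + (\<integral>x. V x * u x * v x \<partial>lebesgue_on U)"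
proof -
  note a = sobolev_H10(2)[OF U(1,2) assms(1)] sobolev_H10(2)[OF U(1,2) assms(2)]
  note L = sobolevD(1,2)[OF assms(1)] sobolevD(1,2)[OF assms(2)]
  note wL = sobolevD(2)[OF H10_sobolev[OF U(1,2) sobolev_H10(1)[OF U(1,2)]]]
  note [measurable] = L[THEN L2D(1)] wL[OF assms(1), THEN L2D(1)] wL[OF assms(2), THEN L2D(1)] Vm
  have "energy_form V U u v = (\<integral>x. g x \<bullet> h x + V x * u x * v x \<partial>lebesgue_on U)"
    unfolding energy_form_def
  proof (rule integral_cong_AE)
    show "AE x in lebesgue_on U. weak_gradient U u x \<bullet> weak_gradient U v x + V x * u x * v x = g x \<bullet> h x + V x * u x * v x"
      using a by eventually_elim simp
  qed measurable
  then show ?thesis using L2_inner[OF L(2,4)] V_int[OF L(1,3)] by simp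
qed

lemma H10_lincomb: "u \<in> H10 U \<Longrightarrow> v \<in> H10 U \<Longrightarrow> (\<lambda>x. a * u x + b * v x) \<in> H10 U"
  by (rule sobolev_H10(1)[OF U(1,2) sobolev_lincomb[OF U(1) H10_sobolev[OF U(1,2)] H10_sobolev[OF U(1,2)]]])

lemma H10_L2: "u \<in> H10 U \<Longrightarrow> u \<in> L2_on U"
  using sobolevD(1)[OF H10_sobolev[OF U(1,2)]] .

lemma zero_test: "(\<lambda>x. 0) \<in> test_functions U"
  by (rule test_functionsI[of _ "{}"]) auto

lemma zero_H10: "(\<lambda>x. 0) \<in> H10 U"
  by (rule sobolev_H10(1)[OF U(1,2) sobolev_test[OF U(1) zero_test]])

lemma psd_mass: "psd_form (H10 U) (mass_form U)"
proof
  fix u v w :: "real ^ 'n \<Rightarrow> real" and a b :: real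
  assume u: "u \<in> H10 U" and v: "v \<in> H10 U"
  show "mass_form U u v = mass_form U v u" by (simp add: mass_form_def mult.commute)
  assume w: "w \<in> H10 U"
  have e: "(\<lambda>x. (a * u x + b * v x) * w x) = (\<lambda>x. a * (u x * w x) + b * (v x * w x))"
    by (auto simp: algebra_simps)
  show "mass_form U (\<lambda>x. a * u x + b * v x) w = a * mass_form U u w + b * mass_form U v w"
    unfolding mass_form_def e using L2_mult[OF H10_L2[OF u] H10_L2[OF w]] L2_mult[OF H10_L2[OF v] H10_L2[OF w]]
    by simp
qed (auto simp: mass_form_def zero_H10 H10_lincomb)

lemma psd_energy: "psd_form (H10 U) (energy_form V U)"
proof
  fix u v w :: "real ^ 'n \<Rightarrow> real" and a b :: real
  assume u: "u \<in> H10 U"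
  show "energy_form V U u u \<ge> 0"
    unfolding energy_form_def using Vb by (intro integral_nonneg_AE AE_I2) (simp add: mult.assoc)
  assume v: "v \<in> H10 U"
  show "energy_form V U u v = energy_form V U v u"
    by (simp add: energy_form_def inner_commute mult_ac)
  assume w: "w \<in> H10 U"
  note s = u[THEN H10_sobolev[OF U(1,2)]] v[THEN H10_sobolev[OF U(1,2)]] w[THEN H10_sobolev[OF U(1,2)]]
  note L = sobolevD(1,2)[OF s(1)] sobolevD(1,2)[OF s(2)] sobolevD(1,2)[OF s(3)]
  let ?g = "weak_gradient U u" and ?h = "weak_gradient U v" and ?k = "weak_gradient U w"
  have e1: "(\<lambda>x. (a *\<^sub>R ?g x + b *\<^sub>R ?h x) \<bullet> ?k x) = (\<lambda>x. a * (?g x \<bullet> ?k x) + b * (?h x \<bullet> ?k x))"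
    by (simp add: inner_add_left)
  have e2: "(\<lambda>x. V x * (a * u x + b * v x) * w x) = (\<lambda>x. a * (V x * u x * w x) + b * (V x * v x * w x))"
    by (auto simp: algebra_simps)
  show "energy_form V U (\<lambda>x. a * u x + b * v x) w = a * energy_form V U u w + b * energy_form V U v w"
    unfolding energy_form_sobolev[OF sobolev_lincomb[OF U(1) s(1,2)] s(3)] energy_form_sobolev[OF s(1,3)]
      energy_form_sobolev[OF s(2,3)] e1 e2
    using L2_inner[OF L(2,6)] L2_inner[OF L(4,6)] V_int[OF L(1,5)] V_int[OF L(3,5)]
    by (simp add: algebra_simps)
qed (auto simp: zero_H10 H10_lincomb)

text \<open>Mass plus energy is comparable to the squared norm of \<open>H1\<close>, uniformly in \<open>u\<close>: a nonnegative
  potential only adds to the energy, and a bounded one adds at most a multiple of the mass.\<close>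

lemma energy_form_square:
  assumes "sobolev U u g"
  shows "energy_form V U u u \<le> (1 + c) * H1_sq U u g" "H1_sq U u g \<le> mass_form U u u + energy_form V U u u"
proof -
  note L = sobolevD(1,2)[OF assms]
  have e: "energy_form V U u u = (\<integral>x. (norm (g x))\<^sup>2 \<partial>lebesgue_on U) + (\<integral>x. V x * u x * u x \<partial>lebesgue_on U)"
    unfolding energy_form_sobolev[OF assms assms] by (simp add: power2_norm_eq_inner)
  have m: "mass_form U u u = (\<integral>x. (u x)\<^sup>2 \<partial>lebesgue_on U)" by (simp add: mass_form_def power2_eq_square)
  have n: "(\<integral>x. (u x)\<^sup>2 \<partial>lebesgue_on U) \<ge> 0" "(\<integral>x. (norm (g x))\<^sup>2 \<partial>lebesgue_on U) \<ge> 0" by auto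
  have "0 \<le> (\<integral>x. V x * u x * u x \<partial>lebesgue_on U)"
    using Vb by (intro integral_nonneg_AE AE_I2) (simp add: mult.assoc)
  then show "H1_sq U u g \<le> mass_form U u u + energy_form V U u u"
    unfolding H1_sq_split[OF L] e m by simp
  have "(\<integral>x. V x * u x * u x \<partial>lebesgue_on U) \<le> (\<integral>x. c * (u x)\<^sup>2 \<partial>lebesgue_on U)"
  proof (rule integral_mono[OF V_int[OF L(1,1)]])
    show "V x * u x * u x \<le> c * (u x)\<^sup>2" for x
      using mult_right_mono[OF Vb(2)[of x] zero_le_power2[of "u x"]] by (simp add: power2_eq_square)
  qed (use L2_sq[OF L(1)] in auto)
  also have "\<dots> = c * (\<integral>x. (u x)\<^sup>2 \<partial>lebesgue_on U)" by simp
  finally show "energy_form V U u u \<le> (1 + c) * H1_sq U u g"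
  proof -
    have "(1 + c) * H1_sq U u g = (\<integral>x. (u x)\<^sup>2 \<partial>lebesgue_on U) + (\<integral>x. (norm (g x))\<^sup>2 \<partial>lebesgue_on U)
        + c * (\<integral>x. (u x)\<^sup>2 \<partial>lebesgue_on U) + c * (\<integral>x. (norm (g x))\<^sup>2 \<partial>lebesgue_on U)"
      unfolding H1_sq_split[OF L] by (simp add: algebra_simps)
    then show "(\<integral>x. V x * u x * u x \<partial>lebesgue_on U) \<le> c * (\<integral>x. (u x)\<^sup>2 \<partial>lebesgue_on U) \<Longrightarrow> ?thesis"
      unfolding e using mult_nonneg_nonneg[OF c0 n(2)] n by linarith
  qed
qed

lemma mass_le_H1_sq:
  assumes "sobolev U u g"
  shows "mass_form U u u \<le> H1_sq U u g"
  using H1_sq_ge(1)[OF sobolevD(1,2)[OF assms]] by (simp add: mass_form_def power2_eq_square)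

lemma sobolev_diff: "sobolev U u g \<Longrightarrow> sobolev U v h \<Longrightarrow> sobolev U (\<lambda>x. u x - v x) (\<lambda>x. g x - h x)"
  using sobolev_lincomb[OF U(1), of u g v h 1 "-1"] by simp

lemma test_dense:
  assumes u: "u \<in> H10 U" and d: "\<delta> > 0"
  shows "\<exists>p\<in>test_functions U. sq (mass_form U) (\<lambda>x. p x - u x) +
    sq (energy_form V U) (\<lambda>x. p x - u x) < \<delta>"
proof -
  note s = H10_sobolev[OF U(1,2) u]
  obtain p where p: "p \<in> test_functions U" "H1_sq U (\<lambda>x. p x - u x) (\<lambda>x. grad p x - weak_gradient U u x) < \<delta> / (2 + c)"
    using sobolevD(3)[OF s, of "\<delta> / (2 + c)"] d c0 by auto
  note sd = sobolev_diff[OF sobolev_test[OF U(1) p(1)] s]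
  have "(2 + c) * H1_sq U (\<lambda>x. p x - u x) (\<lambda>x. grad p x - weak_gradient U u x) < \<delta>"
    using p(2) c0 by (simp add: field_simps)
  then show ?thesis
    using energy_form_square(1)[OF sd] mass_le_H1_sq[OF sd] by (intro bexI[OF _ p(1)]) (simp add: algebra_simps)
qed

lemma test_mass:
  assumes "C1c U f" "C1c U g"
  shows "mass_form U f g = (\<integral>x. f x * g x \<partial>lborel)"
  unfolding mass_form_def
  by (rule lebesgue_on_eq_lborel(1)[OF U(1)])
    (use C1c_cont[OF assms(1)] C1c_cont[OF assms(2)] C1c_zero_outside[OF assms(1)] in \<open>auto intro!: borel_cont continuous_intros\<close>)

lemma test_energy:
  assumes f: "C1c U f"
  shows "energy_form V U f f = energy f + (\<integral>x. V x * (f x)\<^sup>2 \<partial>lebesgue_on U)"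
proof -
  note s = sobolev_C1c[OF U(1,2) f]
  have "(\<integral>x. grad f x \<bullet> grad f x \<partial>lebesgue_on U) = (\<integral>x. grad f x \<bullet> grad f x \<partial>lborel)"
    by (rule lebesgue_on_eq_lborel(1)[OF U(1)])
      (use C1c_cont[OF f] C1c_zero_outside[OF f] in \<open>auto intro!: borel_cont continuous_intros\<close>)
  then show ?thesis
    unfolding energy_form_sobolev[OF s s] energy_def
    by (simp add: power2_norm_eq_inner mult.assoc power2_eq_square[of "f _"])
qed

text \<open>Each \<open>u n\<close> is replaced by a test function at distance at most \<open>1 / (n + 1)\<close>, to which \<open>Rellich\<close>
  applies.\<close>

lemma H10_compact:
  fixes u :: "nat \<Rightarrow> real ^ 'n \<Rightarrow> real"
  assumes u: "\<And>n. u n \<in> H10 U" and b: "\<And>n. sq (mass_form U) (u n) + sq (energy_form V U) (u n) \<le> M"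
  shows "\<exists>r :: nat \<Rightarrow> nat. strict_mono r \<and> (\<forall>e>0. \<exists>N. \<forall>m\<ge>N. \<forall>n\<ge>N.
        sq (mass_form U) (\<lambda>x. u (r m) x - u (r n) x) < e)"
proof -
  note s = H10_sobolev[OF U(1,2) u]
  define i where "i n = inverse (real (Suc n))" for n
  have i: "0 < i n" "i n \<le> 1" for n by (auto simp: i_def field_simps)
  have "\<forall>n. \<exists>p. p \<in> test_functions U \<and> H1_sq U (\<lambda>x. p x - u n x) (\<lambda>x. grad p x - weak_gradient U (u n) x) < i n"
    using sobolevD(3)[OF s i(1)] by (auto simp: Bex_def)
  then obtain p where p: "\<And>n. p n \<in> test_functions U"
    "\<And>n. H1_sq U (\<lambda>x. p n x - u n x) (\<lambda>x. grad (p n) x - weak_gradient U (u n) x) < i n" by metis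
  note sp = sobolev_test[OF U(1) p(1)]
  note pc = test_C1c[OF p(1)]
  have pn: "H1_sq U (p n) (grad (p n)) \<le> 2 + 2 * M" for n
  proof -
    have "H1_sq U (\<lambda>x. (p n x - u n x) + u n x) (\<lambda>x. (grad (p n) x - weak_gradient U (u n) x) + weak_gradient U (u n) x)
      \<le> 2 * H1_sq U (\<lambda>x. p n x - u n x) (\<lambda>x. grad (p n) x - weak_gradient U (u n) x) + 2 * H1_sq U (u n) (weak_gradient U (u n))"
      by (intro H1_sq_add L2_diff sobolevD(1,2)[OF sp] sobolevD(1,2)[OF s])
    moreover have "H1_sq U (u n) (weak_gradient U (u n)) \<le> M"
      using energy_form_square(2)[OF s, of n] b[of n] by linarith
    ultimately show ?thesis using p(2)[of n] i(2)[of n] by simp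
  qed
  have nl: "H1_sq U (p n) (grad (p n)) = (\<integral>x. (p n x)\<^sup>2 \<partial>lborel) + energy (p n)" for n
  proof -
    have "(\<integral>x. (p n x)\<^sup>2 \<partial>lebesgue_on U) = (\<integral>x. (p n x)\<^sup>2 \<partial>lborel)"
      by (rule lebesgue_on_eq_lborel(1)[OF U(1)])
        (use C1c_cont[OF pc] C1c_zero_outside[OF pc] in \<open>auto intro!: borel_cont continuous_intros\<close>)
    moreover have "(\<integral>x. (norm (grad (p n) x))\<^sup>2 \<partial>lebesgue_on U) = energy (p n)"
      unfolding energy_def by (rule lebesgue_on_eq_lborel(1)[OF U(1)])
        (use C1c_cont[OF pc] C1c_zero_outside[OF pc] in \<open>auto intro!: borel_cont continuous_intros\<close>)
    ultimately show ?thesis using H1_sq_split[OF sobolevD(1,2)[OF sp]] by simp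
  qed
  obtain R where R: "\<And>x. x \<in> U \<Longrightarrow> norm x \<le> R" using U(2) bounded_iff by blast
  have "\<exists>r :: nat \<Rightarrow> nat. strict_mono r \<and> (\<forall>e>0. \<exists>N. \<forall>m\<ge>N. \<forall>n\<ge>N. (\<integral>x. (p (r m) x - p (r n) x)\<^sup>2 \<partial>lborel) < e)"
  proof (rule Rellich)
    show "C1c UNIV (p n)" for n by (rule C1c_mono[OF pc subset_UNIV])
    show "p n x = 0" if "R < norm x" for n x
      using C1c_zero_outside(1)[OF pc] R[of x] that by fastforce
    show "(\<integral>x. (p n x)\<^sup>2 \<partial>lborel) \<le> 2 + 2 * M" for n
      using pn[of n] nl[of n] energy_nonneg[of "p n"] by linarith
    have z: "0 \<le> (\<integral>x. (p n x)\<^sup>2 \<partial>lborel)" for n by simp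
    show "energy (p n) \<le> 2 + 2 * M" for n
      using pn[of n] nl[of n] z[of n] by linarith
  qed
  then obtain r :: "nat \<Rightarrow> nat" where r: "strict_mono r"
    "\<forall>e>0. \<exists>N. \<forall>m\<ge>N. \<forall>n\<ge>N. (\<integral>x. (p (r m) x - p (r n) x)\<^sup>2 \<partial>lborel) < e" by blast
  have three: "sq (mass_form U) (\<lambda>x. u m x - u n x)
    \<le> 3 * i m + 3 * i n + 3 * (\<integral>x. (p m x - p n x)\<^sup>2 \<partial>lborel)" for m n
  proof -
    note L = sobolevD(1)[OF s] sobolevD(1)[OF sp]
    have "sq (mass_form U) (\<lambda>x. u m x - u n x)
      \<le> (\<integral>x. 3 * (p m x - u m x)\<^sup>2 + 3 * (p n x - u n x)\<^sup>2 + 3 * (p m x - p n x)\<^sup>2 \<partial>lebesgue_on U)"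
      unfolding mass_form_def
    proof (rule integral_mono)
      show "integrable (lebesgue_on U) (\<lambda>x. (u m x - u n x) * (u m x - u n x))"
        by (intro L2_mult L2_diff L)
      show "integrable (lebesgue_on U) (\<lambda>x. 3 * (p m x - u m x)\<^sup>2 + 3 * (p n x - u n x)\<^sup>2 + 3 * (p m x - p n x)\<^sup>2)"
        by (intro Bochner_Integration.integrable_add integrable_mult_right L2_sq L2_diff L)
      fix x
      define a b d where "a = p m x - u m x" and "b = p n x - u n x" and "d = p m x - p n x"
      have "0 \<le> (a + b)\<^sup>2 + (a + d)\<^sup>2 + (b - d)\<^sup>2" by simp
      then have "(d - a + b) * (d - a + b) \<le> 3 * a\<^sup>2 + 3 * b\<^sup>2 + 3 * d\<^sup>2"
        by (simp add: power2_eq_square algebra_simps)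
      moreover have "d - a + b = u m x - u n x" by (simp add: a_def b_def d_def)
      ultimately show "(u m x - u n x) * (u m x - u n x) \<le> 3 * (p m x - u m x)\<^sup>2 + 3 * (p n x - u n x)\<^sup>2 + 3 * (p m x - p n x)\<^sup>2"
        by (simp add: a_def b_def d_def)
    qed
    also have "\<dots> = 3 * (\<integral>x. (p m x - u m x)\<^sup>2 \<partial>lebesgue_on U) + 3 * (\<integral>x. (p n x - u n x)\<^sup>2 \<partial>lebesgue_on U)
        + 3 * (\<integral>x. (p m x - p n x)\<^sup>2 \<partial>lebesgue_on U)"
      using L2_sq[OF L2_diff[OF L(2)[of m] L(1)[of m]]] L2_sq[OF L2_diff[OF L(2)[of n] L(1)[of n]]] L2_sq[OF L2_diff[OF L(2)[of m] L(2)[of n]]]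
      by simp
    also have "(\<integral>x. (p m x - p n x)\<^sup>2 \<partial>lebesgue_on U) = (\<integral>x. (p m x - p n x)\<^sup>2 \<partial>lborel)"
      by (rule lebesgue_on_eq_lborel(1)[OF U(1)])
        (use C1c_cont[OF pc] C1c_zero_outside[OF pc] in \<open>auto intro!: borel_cont continuous_intros\<close>)
    also have "(\<integral>x. (p m x - u m x)\<^sup>2 \<partial>lebesgue_on U) \<le> i m"
      using H1_sq_ge(1)[OF sobolevD(1,2)[OF sobolev_diff[OF sp[of m] s[of m]]]] p(2)[of m] by linarith
    also have "(\<integral>x. (p n x - u n x)\<^sup>2 \<partial>lebesgue_on U) \<le> i n"
      using H1_sq_ge(1)[OF sobolevD(1,2)[OF sobolev_diff[OF sp[of n] s[of n]]]] p(2)[of n] by linarith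
    finally show ?thesis by simp
  qed
  have "\<exists>N. \<forall>m\<ge>N. \<forall>n\<ge>N. sq (mass_form U) (\<lambda>x. u (r m) x - u (r n) x) < e" if e: "e > 0" for e
  proof -
    obtain N1 where N1: "\<And>m n. m \<ge> N1 \<Longrightarrow> n \<ge> N1 \<Longrightarrow> (\<integral>x. (p (r m) x - p (r n) x)\<^sup>2 \<partial>lborel) < e / 9"
      using r(2)[rule_format, of "e / 9"] e by auto
    obtain N2 where N2: "i N2 < e / 9" using reals_Archimedean[of "e / 9"] e by (auto simp: i_def)
    have im: "i (r m) < e / 9" if "m \<ge> N2" for m
    proof -
      have "N2 \<le> r m" using seq_suble[OF r(1), of m] that by linarith
      then have "i (r m) \<le> i N2" unfolding i_def by (intro le_imp_inverse_le) auto
      then show ?thesis using N2 by linarith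
    qed
    show ?thesis
    proof (intro exI[of _ "max N1 N2"] allI impI)
      fix m n assume "m \<ge> max N1 N2" "n \<ge> max N1 N2"
      then show "sq (mass_form U) (\<lambda>x. u (r m) x - u (r n) x) < e"
        using three[of "r m" "r n"] N1[of m n] im[of m] im[of n] by simp
    qed
  qed
  then show ?thesis using r(1) by blast
qed

lemma H10_complete:
  fixes u :: "nat \<Rightarrow> real ^ 'n \<Rightarrow> real"
  assumes u: "\<And>n. u n \<in> H10 U"
    and c: "\<And>e. e > 0 \<Longrightarrow> \<exists>N. \<forall>m\<ge>N. \<forall>n\<ge>N. sq (mass_form U) (\<lambda>x. u m x - u n x) +
          sq (energy_form V U) (\<lambda>x. u m x - u n x) < e"
  shows "\<exists>v\<in>H10 U. (\<lambda>n. sq (mass_form U) (\<lambda>x. u n x - v x)) \<longlonglongrightarrow> 0 \<and>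
    (\<lambda>n. sq (energy_form V U) (\<lambda>x. u n x - v x)) \<longlonglongrightarrow> 0"
proof -
  note s = H10_sobolev[OF U(1,2) u]
  obtain v h where v: "sobolev U v h"
    "(\<lambda>n. H1_sq U (\<lambda>x. u n x - v x) (\<lambda>x. weak_gradient U (u n) x - h x)) \<longlonglongrightarrow> 0"
  proof (rule sobolev_complete[OF U(1) s])
    fix e :: real assume "e > 0"
    from c[OF this] obtain N where N: "\<forall>m\<ge>N. \<forall>n\<ge>N. sq (mass_form U) (\<lambda>x. u m x - u n x) +
          sq (energy_form V U) (\<lambda>x. u m x - u n x) < e" by blast
    show "\<exists>N. \<forall>m\<ge>N. \<forall>n\<ge>N. H1_sq U (\<lambda>x. u m x - u n x) (\<lambda>x. weak_gradient U (u m) x - weak_gradient U (u n) x) < e"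
    proof (intro exI[of _ N] allI impI)
      fix m n assume "m \<ge> N" "n \<ge> N"
      then show "H1_sq U (\<lambda>x. u m x - u n x) (\<lambda>x. weak_gradient U (u m) x - weak_gradient U (u n) x) < e"
        using N energy_form_square(2)[OF sobolev_diff[OF s s], of m n] by (meson order_le_less_trans)
    qed
  qed blast
  have nn: "0 \<le> mass_form U w w" "0 \<le> energy_form V U w w" if "w \<in> H10 U" for w
    using psd_form.nonneg[OF psd_mass that] psd_form.nonneg[OF psd_energy that] .
  have d: "(\<lambda>x. u n x - v x) \<in> H10 U" for n
    by (rule sobolev_H10(1)[OF U(1,2) sobolev_diff[OF s v(1)]])
  have "(\<lambda>n. sq (mass_form U) (\<lambda>x. u n x - v x)) \<longlonglongrightarrow> 0"
    by (rule tendsto_sandwich[OF _ _ tendsto_const v(2)])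
      (intro always_eventually allI nn d mass_le_H1_sq[OF sobolev_diff[OF s v(1)]])+
  moreover have "(\<lambda>n. sq (energy_form V U) (\<lambda>x. u n x - v x)) \<longlonglongrightarrow> 0"
  proof (rule tendsto_sandwich[OF _ _ tendsto_const])
    show "(\<lambda>n. (1 + c) * H1_sq U (\<lambda>x. u n x - v x) (\<lambda>x. weak_gradient U (u n) x - h x)) \<longlonglongrightarrow> 0"
      using tendsto_mult_left[OF v(2), of "1 + c"] by simp
  qed (intro always_eventually allI nn d energy_form_square(1)[OF sobolev_diff[OF s v(1)]])+
  ultimately show ?thesis using sobolev_H10(1)[OF U(1,2) v(1)] by blast
qed

lemma mass_zero_iff:
  assumes "u \<in> H10 U"
  shows "mass_form U u u = 0 \<longleftrightarrow> (AE x in lebesgue_on U. u x = 0)"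
  unfolding mass_form_def
  using integral_nonneg_eq_0_iff_AE[OF L2_mult[OF H10_L2[OF assms] H10_L2[OF assms]]] by simp

text \<open>Powers of one bump function are linearly independent, because the bump takes infinitely
  many values.\<close>

lemma H10_infinite_dim:
  fixes k :: nat
  shows "\<exists>u. (\<forall>i<k. u i \<in> H10 U) \<and>
      (\<forall>c. sq (mass_form U) (lincomb k c u) = 0 \<longrightarrow> (\<forall>i<k. c i = 0))"
proof -
  obtain q where q: "q \<in> U" using U(3) by blast
  obtain b where b: "b \<in> test_functions U" "b q > 0" "\<And>x. 0 \<le> b x" using bump_exists[OF U(1) q] by blast
  define u where "u i = (\<lambda>x. b x ^ Suc i)" for i
  note bc = test_C1c[OF b(1)]
  obtain K where K: "compact K" "K \<subseteq> U" "\<And>x. x \<notin> K \<Longrightarrow> b x = 0" using bc unfolding C1c_def by blast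
  have ut: "u i \<in> test_functions U" for i
    unfolding u_def by (rule test_functionsI[OF _ K(1,2)]) (auto intro!: Ck_power test_smooth[OF b(1)] simp: K(3) simp del: power_Suc)
  have uH: "u i \<in> H10 U" for i by (rule sobolev_H10(1)[OF U(1,2) sobolev_test[OF U(1) ut]])
  have "\<forall>i<k. a i = 0" if z: "sq (mass_form U) (lincomb k a u) = 0" for a
  proof -
    define f where "f = (lincomb k a u)"
    have ft: "f \<in> test_functions U" unfolding f_def by (rule test_functions_sum) (auto intro: ut)
    have "f \<in> H10 U" by (rule sobolev_H10(1)[OF U(1,2) sobolev_test[OF U(1) ft]])
    then have "AE x in lebesgue_on U. f x = 0" using z mass_zero_iff by (simp add: f_def)
    then have fz: "f x = 0" for x
      using continuous_AE_zero[OF U(1) continuous_on_subset[OF C1c_cont(1)[OF test_C1c[OF ft]] subset_UNIV]]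
        C1c_zero_outside(1)[OF test_C1c[OF ft]] by blast
    define P where "P = (\<Sum>i<k. monom (a i) (Suc i))"
    have Pf: "poly P (b x) = f x" for x by (simp add: P_def f_def u_def poly_sum poly_monom)
    have "{0..b q} \<subseteq> range b"
    proof
      fix y assume y: "y \<in> {0..b q}"
      have "K \<noteq> UNIV" using K(1) not_compact_UNIV by auto
      then obtain z where z: "b z = 0" using K(3) by blast
      have "connected (range b)"
        using C1c_cont(1)[OF bc] by (intro connected_continuous_image) auto
      then show "y \<in> range b"
        using connectedD_interval[of "range b" "b z" "b q" y] y z by auto
    qed
    then have "{0..b q} \<subseteq> {y. poly P y = 0}" using Pf fz by auto
    moreover have "infinite {0..b q}" using b(2) by (simp add: infinite_Icc)
    ultimately have "P = 0" using poly_roots_finite finite_subset by blast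
    have "coeff P (Suc i) = a i" if "i < k" for i
      unfolding P_def coeff_sum using that by (simp add: coeff_monom)
    then show ?thesis using \<open>P = 0\<close> by simp
  qed
  then show ?thesis using uH by blast
qed

end

sublocale schroedinger \<subseteq> S: spectral_forms "H10 U" "mass_form U" "energy_form V U"
proof (intro spectral_forms.intro psd_mass psd_energy spectral_forms_axioms.intro)
qed (fact H10_compact H10_complete H10_infinite_dim)+

context schroedinger
begin

lemma eigenspace_iff: "u \<in> eigenspace V U l \<longleftrightarrow> S.eigenfunction u l"
  unfolding eigenspace_def S.eigenfunction_def energy_form_def mass_form_def by auto

lemma independent_iff:
  assumes "\<And>i. i < k \<Longrightarrow> u i \<in> H10 U"
  shows "ae_independent U k u \<longleftrightarrow>
    (\<forall>c. sq (mass_form U) (lincomb k c u) = 0 \<longrightarrow> (\<forall>i<k. c i = 0))"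
  unfolding ae_independent_def using mass_zero_iff[OF S.B.sum_in[OF assms]] by auto

text \<open>The eigensystem itself competes in the infimum, and no other independent eigenfunctions can do
  better.\<close>

lemma kth_eigenvalue_eq:
  assumes s: "S.eigensystem (Suc k) e \<sigma>"
  shows "kth_eigenvalue V U (Suc k) = \<sigma> k"
  unfolding kth_eigenvalue_def
proof (rule cInf_eq_minimum)
  have "ae_independent U (Suc k) e"
    using S.eigensystem_independent[OF s] S.eigensystemD(1)[OF s] by (subst independent_iff) auto
  moreover have "e i \<in> eigenspace V U (\<sigma> i)" "\<sigma> i \<le> \<sigma> k" if "i < Suc k" for i
    using s that S.eigenvalues_mono[OF s, of i k] by (auto simp: eigenspace_iff S.eigensystem_def)
  ultimately show "\<sigma> k \<in> {t. \<exists>u l. ae_independent U (Suc k) u \<and> (\<forall>i<Suc k. l i \<le> t \<and> u i \<in> eigenspace V U (l i))}"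
    by blast
next
  fix t assume "t \<in> {t. \<exists>u l. ae_independent U (Suc k) u \<and> (\<forall>i<Suc k. l i \<le> t \<and> u i \<in> eigenspace V U (l i))}"
  then obtain u l where u: "ae_independent U (Suc k) u" "\<And>i. i < Suc k \<Longrightarrow> l i \<le> t" "\<And>i. i < Suc k \<Longrightarrow> S.eigenfunction (u i) (l i)"
    by (auto simp: eigenspace_iff)
  have uH: "\<And>i. i < Suc k \<Longrightarrow> u i \<in> H10 U" using u(3) by (simp add: S.eigenfunction_def)
  show "\<sigma> k \<le> t"
  proof (rule S.independent_eigenfunctions_ge[OF s u(3,2)])
    show "\<forall>i<Suc k. c i = 0" if "sq (mass_form U) (lincomb (Suc k) c u) = 0" for c
      using u(1) that independent_iff[of "Suc k" u, OF uH] by blast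
  qed
qed

lemma kth_eigenvalue_nonneg: "kth_eigenvalue V U (Suc k) \<ge> 0"
proof -
  obtain e \<sigma> where s: "S.eigensystem (Suc k) e \<sigma>" using S.eigensystem_exists by blast
  show ?thesis using S.eigensystem_nonneg[OF s, of k] unfolding kth_eigenvalue_eq[OF s] by simp
qed

text \<open>An upper bound needs no more than a trial space of compactly supported \<open>C\<^sup>1\<close> functions, with
  classical gradients and Lebesgue integrals over the whole space.\<close>

lemma kth_eigenvalue_le:
  assumes p: "\<And>i. i < Suc k \<Longrightarrow> C1c U (p i)"
    and ind: "\<And>a. \<exists>i<Suc k. a i \<noteq> 0 \<Longrightarrow> (\<integral>x. (\<Sum>i<Suc k. a i * p i x)\<^sup>2 \<partial>lborel) > 0"
    and le: "\<And>a. energy (lincomb (Suc k) a p) + (\<integral>x. V x * (\<Sum>i<Suc k. a i * p i x)\<^sup>2 \<partial>lebesgue_on U)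
      \<le> t * (\<integral>x. (\<Sum>i<Suc k. a i * p i x)\<^sup>2 \<partial>lborel)"
  shows "kth_eigenvalue V U (Suc k) \<le> t"
proof -
  obtain e \<sigma> where s: "S.eigensystem (Suc k) e \<sigma>" using S.eigensystem_exists by blast
  have pH: "p i \<in> H10 U" if "i < Suc k" for i
    by (rule sobolev_H10(1)[OF U(1,2) sobolev_C1c[OF U(1,2) p[OF that]]])
  have sum: "C1c U (lincomb (Suc k) a p)" for a by (rule C1c_sum) (use p in auto)
  have m: "sq (mass_form U) (lincomb (Suc k) a p) = (\<integral>x. (\<Sum>i<Suc k. a i * p i x)\<^sup>2 \<partial>lborel)" for a
    unfolding test_mass[OF sum sum] by (simp only: power2_eq_square)
  show ?thesis unfolding kth_eigenvalue_eq[OF s]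
  proof (rule S.eigenvalue_le_of_subspace[OF s pH])
    show "sq (mass_form U) (lincomb (Suc k) a p) > 0" if "\<exists>i<Suc k. a i \<noteq> 0" for a
      unfolding m using ind[OF that] .
    show "sq (energy_form V U) (lincomb (Suc k) a p)
      \<le> t * sq (mass_form U) (lincomb (Suc k) a p)" for a
      unfolding m test_energy[OF sum] by (rule le)
  qed
qed

text \<open>Conversely, test functions close to the first \<open>k + 1\<close> eigenfunctions attain the eigenvalue up to
  \<open>\<epsilon>\<close>, and they are still linearly independent.\<close>

lemma kth_eigenvalue_test_space:
  assumes "\<epsilon> > 0"
  obtains p where "\<And>i. i < Suc k \<Longrightarrow> p i \<in> test_functions U"
    "\<And>a. \<exists>i<Suc k. a i \<noteq> 0 \<Longrightarrow> (\<integral>x. (\<Sum>i<Suc k. a i * p i x)\<^sup>2 \<partial>lborel) > 0"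
    "\<And>a. energy (lincomb (Suc k) a p) + (\<integral>x. V x * (\<Sum>i<Suc k. a i * p i x)\<^sup>2 \<partial>lebesgue_on U)
      \<le> (kth_eigenvalue V U (Suc k) + \<epsilon>) * (\<integral>x. (\<Sum>i<Suc k. a i * p i x)\<^sup>2 \<partial>lborel)"
proof -
  obtain e \<sigma> where s: "S.eigensystem (Suc k) e \<sigma>" using S.eigensystem_exists by blast
  have T: "test_functions U \<subseteq> H10 U"
    using sobolev_H10(1)[OF U(1,2) sobolev_test[OF U(1)]] by blast
  obtain p where p: "\<And>i. i < Suc k \<Longrightarrow> p i \<in> test_functions U"
    "\<And>a. (\<Sum>i<Suc k. (a i)\<^sup>2) \<le> 2 * sq (mass_form U) (lincomb (Suc k) a p)"
    "\<And>a. sq (energy_form V U) (lincomb (Suc k) a p)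
       \<le> (\<sigma> k + \<epsilon>) * sq (mass_form U) (lincomb (Suc k) a p)"
    using S.spectral_subspace_approx[OF s T test_dense assms] by blast
  have sum: "C1c U (lincomb (Suc k) a p)" for a by (rule C1c_sum) (use p(1) test_C1c in auto)
  have m: "sq (mass_form U) (lincomb (Suc k) a p) = (\<integral>x. (\<Sum>i<Suc k. a i * p i x)\<^sup>2 \<partial>lborel)" for a
    unfolding test_mass[OF sum sum] by (simp only: power2_eq_square)
  show thesis
  proof (rule that[OF p(1)])
    fix a :: "nat \<Rightarrow> real" assume "\<exists>i<Suc k. a i \<noteq> 0"
    then obtain i where i: "i < Suc k" "a i \<noteq> 0" by blast
    have "0 < (a i)\<^sup>2" using i by simp
    also have "\<dots> \<le> (\<Sum>i<Suc k. (a i)\<^sup>2)" using i by (intro member_le_sum) auto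
    finally show "(\<integral>x. (\<Sum>i<Suc k. a i * p i x)\<^sup>2 \<partial>lborel) > 0" using p(2)[of a] unfolding m by linarith
  next
    fix a :: "nat \<Rightarrow> real"
    show "energy (lincomb (Suc k) a p) + (\<integral>x. V x * (\<Sum>i<Suc k. a i * p i x)\<^sup>2 \<partial>lebesgue_on U)
      \<le> (kth_eigenvalue V U (Suc k) + \<epsilon>) * (\<integral>x. (\<Sum>i<Suc k. a i * p i x)\<^sup>2 \<partial>lborel)"
      using p(3)[of a] unfolding m test_energy[OF sum] kth_eigenvalue_eq[OF s] .
  qed
qed

end

section \<open>Cutoffs and a partition of unity near the boundary\<close>

text \<open>The graph function of a boundary chart, as a defining function: it decreases at unit speed
  along the chart direction.\<close>

lemma C2_boundary_defining_function:
  fixes \<Omega> :: "(real ^ 'n) set"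
  assumes "C2_boundary \<Omega>" "p \<in> frontier \<Omega>"
  obtains r \<nu> g where "r > 0" "norm \<nu> = 1" "C1 g" "\<And>y t. g (y - t *\<^sub>R \<nu>) = g y - t"
    "\<And>y. y \<in> ball p r \<Longrightarrow> y \<in> \<Omega> \<longleftrightarrow> g y > 0"
proof -
  obtain r \<nu> \<gamma> where c: "r > 0" "norm \<nu> = 1" "Ck_function 2 \<gamma>"
    "\<Omega> \<inter> ball p r = {y \<in> ball p r. y \<bullet> \<nu> > \<gamma> (y - (y \<bullet> \<nu>) *\<^sub>R \<nu>)}"
    using assms unfolding C2_boundary_def by blast
  define A where "A y = y - (y \<bullet> \<nu>) *\<^sub>R \<nu>" for y
  define g where "g y = y \<bullet> \<nu> - \<gamma> (A y + 0)" for y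
  have A: "bounded_linear A" unfolding A_def
    by (intro bounded_linear_sub bounded_linear_ident bounded_linear_scaleR_const bounded_linear_inner_left)
  have "C1 \<gamma>" using Ck_mono[OF c(3), of 1] by simp
  then have "C1 (\<lambda>y. \<gamma> (A y + 0))" by (rule Ck_compose_affine[OF A])
  then have g: "C1 g" unfolding g_def by (intro Ck_diff Ck_inner_const)
  have nn: "\<nu> \<bullet> \<nu> = 1" using c(2) by (simp add: norm_eq_1)
  have "A (y - t *\<^sub>R \<nu>) = A y" for y t
    by (simp add: A_def inner_diff_left nn scaleR_left_diff_distrib)
  then have "g (y - t *\<^sub>R \<nu>) = g y - t" for y t
    by (simp add: g_def inner_diff_left nn)
  moreover have "y \<in> \<Omega> \<longleftrightarrow> g y > 0" if "y \<in> ball p r" for y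
  proof -
    have "y \<in> \<Omega> \<inter> ball p r \<longleftrightarrow> y \<in> {y \<in> ball p r. y \<bullet> \<nu> > \<gamma> (y - (y \<bullet> \<nu>) *\<^sub>R \<nu>)}"
      by (simp only: c(4))
    then show ?thesis using that by (simp add: g_def A_def)
  qed
  ultimately show thesis using that c(1,2) g by blast
qed

text \<open>Local cutoffs at scale \<open>t\<close>. At a boundary point the cutoff is a smoothstep in the variable \<open>g / t\<close>:
  it vanishes where \<open>g \<le> t / 4\<close>, so that its support stays inside \<open>\<Omega>\<close>, and where it is not
  locally constant equal to \<open>1\<close> one has \<open>g < t\<close>, so that the point shifted by \<open>- t \<nu>\<close> lies
  outside \<open>\<Omega>\<close>. At an interior point no shift is needed.\<close>

lemma local_cutoff:
  fixes \<Omega> :: "(real ^ 'n) set"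
  assumes O: "open \<Omega>" "C2_boundary \<Omega>" and p: "p \<in> closure \<Omega>"
  shows "\<exists>\<rho> \<nu> L t0 \<kappa>. \<rho> > 0 \<and> norm \<nu> \<le> 1 \<and> L \<ge> 0 \<and> t0 > 0 \<and> (\<forall>t. 0 < t \<and> t < t0 \<longrightarrow>
      C1 (\<kappa> t) \<and> (\<forall>x. 0 \<le> \<kappa> t x \<and> \<kappa> t x \<le> 1) \<and>
      (\<forall>x\<in>cball p \<rho>. norm (grad (\<kappa> t) x) \<le> L / t \<and>
         (x - t *\<^sub>R \<nu> \<in> \<Omega> \<longrightarrow> \<kappa> t x = 1 \<and> grad (\<kappa> t) x = 0)) \<and>
      (\<exists>F. closed F \<and> F \<inter> cball p \<rho> \<subseteq> \<Omega> \<and> (\<forall>x. \<kappa> t x \<noteq> 0 \<longrightarrow> x \<in> F)))"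
proof (cases "p \<in> \<Omega>")
  case True
  then obtain \<rho> where r: "\<rho> > 0" "cball p \<rho> \<subseteq> \<Omega>" using O(1) open_contains_cball by blast
  show ?thesis
    by (rule exI[of _ \<rho>], rule exI[of _ 0], rule exI[of _ 0], rule exI[of _ 1], rule exI[of _ "\<lambda>t x. 1"])
      (use r in \<open>auto intro!: exI[of _ UNIV]\<close>)
next
  case False
  then have "p \<in> frontier \<Omega>" using p O(1) by (simp add: frontier_def interior_open)
  then obtain r \<nu> g where c: "r > 0" "norm \<nu> = 1" "C1 g" "\<And>y t. g (y - t *\<^sub>R \<nu>) = g y - t"
    "\<And>y. y \<in> ball p r \<Longrightarrow> y \<in> \<Omega> \<longleftrightarrow> g y > 0"
    by (rule C2_boundary_defining_function[OF O(2)]) blast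
  define \<rho> where "\<rho> = r / 2"
  define \<kappa> where "\<kappa> t x = smoothstep ((1 / t) * g x)" for t x
  have "compact (grad g ` cball p \<rho>)"
    by (rule compact_continuous_image[OF continuous_on_subset[OF C1_continuous_grad[OF c(3)] subset_UNIV] compact_cball])
  then obtain M where M: "M > 0" "\<And>x. x \<in> cball p \<rho> \<Longrightarrow> norm (grad g x) \<le> M"
    using bounded_pos[of "grad g ` cball p \<rho>"] compact_imp_bounded by blast
  have main: "C1 (\<kappa> t) \<and> (\<forall>x. 0 \<le> \<kappa> t x \<and> \<kappa> t x \<le> 1) \<and>
      (\<forall>x\<in>cball p \<rho>. norm (grad (\<kappa> t) x) \<le> 8 * M / t \<and>
         (x - t *\<^sub>R \<nu> \<in> \<Omega> \<longrightarrow> \<kappa> t x = 1 \<and> grad (\<kappa> t) x = 0)) \<and>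
      (\<exists>F. closed F \<and> F \<inter> cball p \<rho> \<subseteq> \<Omega> \<and> (\<forall>x. \<kappa> t x \<noteq> 0 \<longrightarrow> x \<in> F))"
    if t: "0 < t" "t < r / 2" for t
  proof -
    have gt: "C1 (\<lambda>x. (1 / t) * g x)" by (intro Ck_cmult c(3))
    have gr: "grad (\<kappa> t) x = smoothstep' ((1 / t) * g x) *\<^sub>R (1 / t) *\<^sub>R grad g x" for x
      unfolding \<kappa>_def[abs_def] C1_smoothstep(2)[OF gt] grad_cmult[OF c(3)] by simp
    have "C1 (\<kappa> t)" unfolding \<kappa>_def[abs_def] by (rule C1_smoothstep(1)[OF gt])
    moreover have "0 \<le> \<kappa> t x \<and> \<kappa> t x \<le> 1" for x by (simp add: \<kappa>_def smoothstep_facts)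
    moreover have "norm (grad (\<kappa> t) x) \<le> 8 * M / t" if x: "x \<in> cball p \<rho>" for x
    proof -
      have "norm (grad (\<kappa> t) x) = \<bar>smoothstep' ((1 / t) * g x)\<bar> * (norm (grad g x) / t)"
        unfolding gr using t by simp
      also have "\<dots> \<le> 8 * (M / t)"
        using t M(2)[OF x] by (intro mult_mono smoothstep_facts divide_right_mono) auto
      finally show ?thesis by simp
    qed
    moreover have "\<kappa> t x = 1 \<and> grad (\<kappa> t) x = 0" if x: "x \<in> cball p \<rho>" "x - t *\<^sub>R \<nu> \<in> \<Omega>" for x
    proof -
      have "dist p (x - t *\<^sub>R \<nu>) \<le> dist p x + dist x (x - t *\<^sub>R \<nu>)" by (rule dist_triangle)
      also have "dist x (x - t *\<^sub>R \<nu>) = t" using t c(2) by (simp add: dist_norm)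
      finally have "x - t *\<^sub>R \<nu> \<in> ball p r" using x(1) t by (simp add: \<rho>_def)
      then have "g (x - t *\<^sub>R \<nu>) > 0" using c(5) x(2) by blast
      then have "(1 / t) * g x \<ge> 3/4" using t c(4) by (simp add: field_simps)
      then show ?thesis unfolding gr using smoothstep_facts(4,6) by (simp add: \<kappa>_def)
    qed
    moreover have "\<exists>F. closed F \<and> F \<inter> cball p \<rho> \<subseteq> \<Omega> \<and> (\<forall>x. \<kappa> t x \<noteq> 0 \<longrightarrow> x \<in> F)"
    proof (intro exI[of _ "{x. t / 4 \<le> g x}"] conjI allI impI)
      show "closed {x. t / 4 \<le> g x}"
        using Ck_continuous[OF c(3)] by (intro closed_Collect_le continuous_intros)
      show "{x. t / 4 \<le> g x} \<inter> cball p \<rho> \<subseteq> \<Omega>"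
      proof
        fix x assume "x \<in> {x. t / 4 \<le> g x} \<inter> cball p \<rho>"
        then have "x \<in> ball p r" "g x > 0" using t c(1) by (auto simp: \<rho>_def)
        then show "x \<in> \<Omega>" using c(5) by blast
      qed
      show "x \<in> {x. t / 4 \<le> g x}" if "\<kappa> t x \<noteq> 0" for x
      proof (rule ccontr)
        assume "x \<notin> {x. t / 4 \<le> g x}"
        then have "(1 / t) * g x \<le> 1/4" using t by (simp add: field_simps)
        then show False using that smoothstep_facts(3) by (simp add: \<kappa>_def)
      qed
    qed
    ultimately show ?thesis by blast
  qed
  show ?thesis
    by (rule exI[of _ \<rho>], rule exI[of _ \<nu>], rule exI[of _ "8 * M"], rule exI[of _ "r / 2"], rule exI[of _ \<kappa>])
      (use main c(1,2) M(1) in \<open>auto simp: \<rho>_def\<close>)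
qed

lemma ball_cutoff:
  fixes p :: "real ^ 'n"
  assumes "\<rho> > 0"
  obtains b where "C1 b" "\<And>x. 0 \<le> b x" "\<And>x. b x \<le> 1" "\<And>x. x \<notin> cball p \<rho> \<Longrightarrow> b x = 0"
    "\<And>x. x \<in> ball p (\<rho> / 2) \<Longrightarrow> b x = 1"
proof -
  define f where "f x = 1 - (1 / \<rho>\<^sup>2) * ((x - p) \<bullet> (x - p))" for x
  have f: "C1 f" unfolding f_def by (intro Ck_diff Ck_const Ck_cmult Ck_sqdist)
  have "smoothstep (f x) = 0" if "x \<notin> cball p \<rho>" for x
  proof -
    have "\<rho>\<^sup>2 \<le> (norm (x - p))\<^sup>2" using that assms by (intro power_mono) (auto simp: dist_norm norm_minus_commute)
    then have "1 \<le> (1 / \<rho>\<^sup>2) * ((x - p) \<bullet> (x - p))" using assms by (simp add: power2_norm_eq_inner field_simps)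
    then have "f x \<le> 1/4" unfolding f_def by linarith
    then show ?thesis by (rule smoothstep_facts)
  qed
  moreover have "smoothstep (f x) = 1" if "x \<in> ball p (\<rho> / 2)" for x
  proof -
    have "(norm (x - p))\<^sup>2 \<le> (\<rho> / 2)\<^sup>2" using that by (intro power_mono) (auto simp: dist_norm norm_minus_commute)
    then have "f x \<ge> 3/4" using assms by (simp add: f_def power2_norm_eq_inner field_simps)
    then show ?thesis by (rule smoothstep_facts)
  qed
  ultimately show thesis using that[of "\<lambda>x. smoothstep (f x)"] C1_smoothstep(1)[OF f] smoothstep_facts by blast
qed

lemma partition_telescope:
  fixes b :: "nat \<Rightarrow> real"
  shows "(\<Sum>i<m. b i * (\<Prod>j<i. 1 - b j)) = 1 - (\<Prod>j<m. 1 - b j)"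
  by (induction m) (auto simp: algebra_simps)

text \<open>The local cutoffs are combined with a partition of unity. With bumps \<open>b\<^sub>i\<close> equal to \<open>1\<close> on balls that
  cover \<open>\<Omega>\<close>, the products \<open>\<eta>\<^sub>i = b\<^sub>i (1 - b\<^sub>0) \<dots> (1 - b\<^sub>i\<^sub>-\<^sub>1)\<close> are nonnegative, their sum is
  \<open>1 - (1 - b\<^sub>0) \<dots> (1 - b\<^sub>m\<^sub>-\<^sub>1)\<close>, and this is \<open>1\<close> on \<open>\<Omega>\<close>. The function \<open>\<zeta> t i\<close> is \<open>\<eta>\<^sub>i\<close> times the local
  cutoff at scale \<open>t\<close>; it agrees with \<open>\<eta>\<^sub>i\<close> to first order at every point \<open>x\<close> with \<open>x - t \<nu>\<^sub>i\<close> in \<open>\<Omega>\<close>.\<close>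

lemma cutoff_family:
  fixes \<Omega> :: "(real ^ 'n) set"
  assumes O: "open \<Omega>" "bounded \<Omega>" "C2_boundary \<Omega>"
  obtains m :: nat and \<eta> :: "nat \<Rightarrow> real ^ 'n \<Rightarrow> real" and \<nu> :: "nat \<Rightarrow> real ^ 'n"
    and \<zeta> :: "real \<Rightarrow> nat \<Rightarrow> real ^ 'n \<Rightarrow> real" and M t0 :: real
  where "M \<ge> 0" "t0 > 0" "t0 \<le> 1"
    "\<And>i. i < m \<Longrightarrow> C1c UNIV (\<eta> i)" "\<And>i x. i < m \<Longrightarrow> 0 \<le> \<eta> i x" "\<And>x. (\<Sum>i<m. \<eta> i x) \<le> 1"
    "\<And>x. x \<in> \<Omega> \<Longrightarrow> (\<Sum>i<m. \<eta> i x) = 1" "\<And>i. i < m \<Longrightarrow> norm (\<nu> i) \<le> 1"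
    "\<And>i x. i < m \<Longrightarrow> norm (grad (\<eta> i) x) \<le> M" "\<And>i x h. i < m \<Longrightarrow> \<bar>\<eta> i (x + h) - \<eta> i x\<bar> \<le> M * norm h"
    "\<And>t i. 0 < t \<Longrightarrow> t < t0 \<Longrightarrow> i < m \<Longrightarrow> C1c \<Omega> (\<zeta> t i)"
    "\<And>t i x. 0 < t \<Longrightarrow> t < t0 \<Longrightarrow> i < m \<Longrightarrow> 0 \<le> \<zeta> t i x \<and> \<zeta> t i x \<le> \<eta> i x"
    "\<And>t i x. 0 < t \<Longrightarrow> t < t0 \<Longrightarrow> i < m \<Longrightarrow> x - t *\<^sub>R \<nu> i \<in> \<Omega> \<Longrightarrow> \<zeta> t i x = \<eta> i x \<and> grad (\<zeta> t i) x = grad (\<eta> i) x"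
    "\<And>t i x. 0 < t \<Longrightarrow> t < t0 \<Longrightarrow> i < m \<Longrightarrow> norm (grad (\<zeta> t i) x - grad (\<eta> i) x) \<le> M / t"
proof -
  have "\<forall>p. \<exists>\<rho> \<nu> L t0 \<kappa>. p \<in> closure \<Omega> \<longrightarrow> \<rho> > 0 \<and> norm \<nu> \<le> 1 \<and> L \<ge> 0 \<and> t0 > 0 \<and> (\<forall>t. 0 < t \<and> t < t0 \<longrightarrow>
      C1 (\<kappa> t) \<and> (\<forall>x. 0 \<le> \<kappa> t x \<and> \<kappa> t x \<le> 1) \<and>
      (\<forall>x\<in>cball p \<rho>. norm (grad (\<kappa> t) x) \<le> L / t \<and>
         (x - t *\<^sub>R \<nu> \<in> \<Omega> \<longrightarrow> \<kappa> t x = 1 \<and> grad (\<kappa> t) x = 0)) \<and>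
      (\<exists>F. closed F \<and> F \<inter> cball p \<rho> \<subseteq> \<Omega> \<and> (\<forall>x. \<kappa> t x \<noteq> 0 \<longrightarrow> x \<in> F)))"
    (is "\<forall>p. ?P p")
  proof
    show "?P p" for p
      using local_cutoff[OF O(1,3), of p] by (cases "p \<in> closure \<Omega>") simp_all
  qed
  then obtain \<rho> \<nu> L T \<kappa> where ch: "\<And>p. p \<in> closure \<Omega> \<Longrightarrow> \<rho> p > 0 \<and> norm (\<nu> p) \<le> 1 \<and> L p \<ge> 0 \<and> T p > 0 \<and>
      (\<forall>t. 0 < t \<and> t < T p \<longrightarrow>
      C1 (\<kappa> p t) \<and> (\<forall>x. 0 \<le> \<kappa> p t x \<and> \<kappa> p t x \<le> 1) \<and>
      (\<forall>x\<in>cball p (\<rho> p). norm (grad (\<kappa> p t) x) \<le> L p / t \<and>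
         (x - t *\<^sub>R \<nu> p \<in> \<Omega> \<longrightarrow> \<kappa> p t x = 1 \<and> grad (\<kappa> p t) x = 0)) \<and>
      (\<exists>F. closed F \<and> F \<inter> cball p (\<rho> p) \<subseteq> \<Omega> \<and> (\<forall>x. \<kappa> p t x \<noteq> 0 \<longrightarrow> x \<in> F)))"
    by metis
  have cp: "compact (closure \<Omega>)" using O(2) by simp
  have cv: "closure \<Omega> \<subseteq> (\<Union>p\<in>closure \<Omega>. ball p (\<rho> p / 2))"
    using ch by (auto intro!: bexI)
  obtain P where P: "P \<subseteq> closure \<Omega>" "finite P" "closure \<Omega> \<subseteq> (\<Union>p\<in>P. ball p (\<rho> p / 2))"
    by (rule compactE_image[OF cp _ cv]) auto
  obtain q :: "nat \<Rightarrow> real ^ 'n" where q: "bij_betw q {..<card P} P"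
    using ex_bij_betw_nat_finite[OF P(2)] by (auto simp: atLeast0LessThan)
  define m where "m = card P"
  have qP: "q i \<in> P" "q i \<in> closure \<Omega>" if "i < m" for i
    using bij_betwE[OF q] that P(1) by (auto simp: m_def)
  have "\<exists>b. i < m \<longrightarrow> C1 b \<and> (\<forall>x. 0 \<le> b x \<and> b x \<le> 1) \<and> (\<forall>x. x \<notin> cball (q i) (\<rho> (q i)) \<longrightarrow> b x = 0) \<and>
    (\<forall>x\<in>ball (q i) (\<rho> (q i) / 2). b x = 1)" for i
  proof (cases "i < m")
    case True
    have "\<rho> (q i) > 0" using ch[OF qP(2)[OF True]] by blast
    from ball_cutoff[OF this, of "q i"] show ?thesis by metis
  qed auto
  then obtain b where b: "\<And>i. i < m \<Longrightarrow> C1 (b i) \<and> (\<forall>x. 0 \<le> b i x \<and> b i x \<le> 1) \<and>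
    (\<forall>x. x \<notin> cball (q i) (\<rho> (q i)) \<longrightarrow> b i x = 0) \<and> (\<forall>x\<in>ball (q i) (\<rho> (q i) / 2). b i x = 1)"
    by metis
  define \<eta> where "\<eta> i = (\<lambda>x. b i x * (\<Prod>j<i. 1 - b j x))" for i
  define \<zeta> where "\<zeta> t i = (\<lambda>x. \<eta> i x * \<kappa> (q i) t x)" for t i
  have pr: "0 \<le> (\<Prod>j<i. 1 - b j x)" "(\<Prod>j<i. 1 - b j x) \<le> 1" if "i \<le> m" for i x
    using b that by (auto intro!: prod_nonneg prod_le_1)
  have eC1: "C1 (\<eta> i)" if "i < m" for i
    unfolding \<eta>_def using b that by (intro Ck_mult Ck_prod Ck_diff Ck_const) auto
  have ez: "\<eta> i x = 0" if "i < m" "x \<notin> cball (q i) (\<rho> (q i))" for i x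
    using b that by (simp add: \<eta>_def)
  have eC: "C1c UNIV (\<eta> i)" if "i < m" for i
    unfolding C1c_def using eC1[OF that] ez[OF that] by (intro conjI exI[of _ "cball (q i) (\<rho> (q i))"]) auto
  have e0: "0 \<le> \<eta> i x" if "i < m" for i x
    unfolding \<eta>_def using b that pr(1)[of i x] by simp
  have e1: "\<eta> i x \<le> 1" if "i < m" for i x
    unfolding \<eta>_def using b[OF that] pr[of i x] that by (intro mult_le_one) auto
  have es: "(\<Sum>i<m. \<eta> i x) = 1 - (\<Prod>j<m. 1 - b j x)" for x
    unfolding \<eta>_def by (rule partition_telescope)
  have es1: "(\<Sum>i<m. \<eta> i x) \<le> 1" for x unfolding es using pr(1)[of m x] by simp
  have eO: "(\<Sum>i<m. \<eta> i x) = 1" if "x \<in> \<Omega>" for x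
  proof -
    have "x \<in> closure \<Omega>" using closure_subset that by (rule subsetD)
    then have "x \<in> (\<Union>p\<in>P. ball p (\<rho> p / 2))" by (rule subsetD[OF P(3)])
    then obtain p where p: "p \<in> P" "x \<in> ball p (\<rho> p / 2)" by (rule UN_E)
    obtain i where i: "i < m" "q i = p" using q p(1) unfolding bij_betw_def m_def by force
    have "b i x = 1" using b[OF i(1)] p(2) i(2) by blast
    then have "(\<Prod>j<m. 1 - b j x) = 0" using i(1) by (intro prod_zero) auto
    then show ?thesis unfolding es by simp
  qed
  have "\<exists>B. i < m \<longrightarrow> B \<ge> 0 \<and> (\<forall>x. norm (grad (\<eta> i) x) \<le> B) \<and> (\<forall>x h. \<bar>\<eta> i (x + h) - \<eta> i x\<bar> \<le> B * norm h)" for i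
  proof (cases "i < m")
    case True
    from C1c_bounds[OF eC[OF this]] show ?thesis by metis
  qed auto
  then obtain B where B: "\<And>i. i < m \<Longrightarrow> B i \<ge> 0 \<and> (\<forall>x. norm (grad (\<eta> i) x) \<le> B i) \<and> (\<forall>x h. \<bar>\<eta> i (x + h) - \<eta> i x\<bar> \<le> B i * norm h)"
    by metis
  define M where "M = (\<Sum>i<m. B i + L (q i))"
  have L0: "L (q i) \<ge> 0" if "i < m" for i using ch[OF qP(2)[OF that]] by blast
  have BM: "B i + L (q i) \<le> M" if "i < m" for i
    unfolding M_def using that B L0 by (intro member_le_sum[of i "{..<m}" "\<lambda>i. B i + L (q i)"]) auto
  have M0: "M \<ge> 0" unfolding M_def using B L0 by (intro sum_nonneg) (simp add: add_nonneg_nonneg)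
  define t0 where "t0 = Min (insert 1 ((\<lambda>i. T (q i)) ` {..<m}))"
  have t0: "t0 > 0" "t0 \<le> 1" unfolding t0_def using ch qP(2) by auto
  have tT: "t < T (q i)" if "t < t0" "i < m" for t i
  proof -
    have "t0 \<le> T (q i)" unfolding t0_def using that by (intro Min_le) auto
    then show ?thesis using that by simp
  qed
  show thesis
  proof (rule that[of M t0 m \<eta> "\<lambda>i. \<nu> (q i)" \<zeta>])
    fix i and x h :: "real ^ 'n" assume i: "i < m"
    show "norm (\<nu> (q i)) \<le> 1" using ch[OF qP(2)[OF i]] by blast
    show "norm (grad (\<eta> i) x) \<le> M" using B[OF i] BM[OF i] L0[OF i] by (meson add_increasing2 order_trans order_refl)
    have "B i * norm h \<le> M * norm h" using B[OF i] BM[OF i] L0[OF i] by (intro mult_right_mono) auto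
    then show "\<bar>\<eta> i (x + h) - \<eta> i x\<bar> \<le> M * norm h" using B[OF i] by (meson order_trans)
  next
    fix t i assume t: "0 < t" "t < t0" and i: "i < m"
    note c = ch[OF qP(2)[OF i], THEN conjunct2, THEN conjunct2, THEN conjunct2, THEN conjunct2, rule_format, OF conjI[OF t(1) tT[OF t(2) i]]]
    have cC: "C1 (\<kappa> (q i) t)" using c by blast
    obtain F where F: "closed F" "F \<inter> cball (q i) (\<rho> (q i)) \<subseteq> \<Omega>" "\<And>x. \<kappa> (q i) t x \<noteq> 0 \<Longrightarrow> x \<in> F" using c by blast
    have c01: "0 \<le> \<kappa> (q i) t x" "\<kappa> (q i) t x \<le> 1" for x using c by blast+
    have zg: "grad (\<zeta> t i) x = \<eta> i x *\<^sub>R grad (\<kappa> (q i) t) x + \<kappa> (q i) t x *\<^sub>R grad (\<eta> i) x" for x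
      unfolding \<zeta>_def by (rule grad_mult[OF eC1[OF i] cC])
    have out: "\<zeta> t i x = 0" "\<eta> i x = 0" "grad (\<eta> i) x = 0" if "x \<notin> cball (q i) (\<rho> (q i))" for x
      using ez[OF i that] grad_zero_outside[of "cball (q i) (\<rho> (q i))" "\<eta> i" x] ez[OF i] that by (auto simp: \<zeta>_def)
    show "C1c \<Omega> (\<zeta> t i)"
      unfolding C1c_def
    proof (intro conjI exI[of _ "F \<inter> cball (q i) (\<rho> (q i))"] allI impI)
      show "C1 (\<zeta> t i)" unfolding \<zeta>_def by (intro Ck_mult eC1[OF i] cC)
      show "compact (F \<inter> cball (q i) (\<rho> (q i)))" using F(1) by (intro closed_Int_compact compact_cball)
      show "\<zeta> t i x = 0" if "x \<notin> F \<inter> cball (q i) (\<rho> (q i))" for x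
        using that out(1)[of x] F(3)[of x] by (auto simp: \<zeta>_def)
    qed (rule F(2))
    fix x
    show "0 \<le> \<zeta> t i x \<and> \<zeta> t i x \<le> \<eta> i x"
      unfolding \<zeta>_def using e0[OF i, of x] c01[of x] by (simp add: mult_left_le)
    show "norm (grad (\<zeta> t i) x - grad (\<eta> i) x) \<le> M / t"
    proof (cases "x \<in> cball (q i) (\<rho> (q i))")
      case True
      have 1: "norm (grad (\<kappa> (q i) t) x) \<le> L (q i) / t" using c True by blast
      have "grad (\<zeta> t i) x - grad (\<eta> i) x = \<eta> i x *\<^sub>R grad (\<kappa> (q i) t) x - (1 - \<kappa> (q i) t x) *\<^sub>R grad (\<eta> i) x"
        unfolding zg by (simp add: algebra_simps)
      also have "norm \<dots> \<le> \<eta> i x * norm (grad (\<kappa> (q i) t) x) + (1 - \<kappa> (q i) t x) * norm (grad (\<eta> i) x)"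
        using norm_triangle_ineq4[of "\<eta> i x *\<^sub>R grad (\<kappa> (q i) t) x" "(1 - \<kappa> (q i) t x) *\<^sub>R grad (\<eta> i) x"] e0[OF i, of x] c01[of x]
        by simp
      also have "\<dots> \<le> 1 * (L (q i) / t) + 1 * B i"
        using e0[OF i, of x] e1[OF i, of x] c01[of x] B[OF i] 1 by (intro add_mono mult_mono) auto
      also have "\<dots> \<le> L (q i) / t + B i / t"
        using B[OF i] t t0(2) by (simp add: pos_le_divide_eq mult_left_le)
      also have "\<dots> = (B i + L (q i)) / t" by (simp add: add_divide_distrib)
      also have "\<dots> \<le> M / t" using BM[OF i] t by (intro divide_right_mono) auto
      finally show ?thesis .
    next
      case False
      then show ?thesis unfolding zg using out[OF False] M0 t by simp
    qed
    assume s: "x - t *\<^sub>R \<nu> (q i) \<in> \<Omega>"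
    show "\<zeta> t i x = \<eta> i x \<and> grad (\<zeta> t i) x = grad (\<eta> i) x"
    proof (cases "x \<in> cball (q i) (\<rho> (q i))")
      case True
      then have "\<kappa> (q i) t x = 1" "grad (\<kappa> (q i) t) x = 0" using c s by blast+
      then show ?thesis unfolding zg by (simp add: \<zeta>_def)
    next
      case False
      then show ?thesis unfolding zg using out[OF False] by simp
    qed
  qed (use M0 t0 eC e0 es1 eO in auto)
qed

section \<open>Transplantation into the domain\<close>

text \<open>The weights \<open>e i\<close> are subconvex, and the Cauchy--Schwarz inequality is applied to the factors
  \<open>sqrt (e i)\<close> and \<open>sqrt (e i) * norm (a i)\<close>.\<close>

lemma weighted_norm_sum_sq:
  fixes a :: "nat \<Rightarrow> 'b::real_normed_vector"
  assumes "\<And>i. i < m \<Longrightarrow> 0 \<le> z i \<and> z i \<le> e i" "(\<Sum>i<m. e i) \<le> 1"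
  shows "(norm (\<Sum>i<m. z i *\<^sub>R a i))\<^sup>2 \<le> (\<Sum>i<m. e i * (norm (a i))\<^sup>2)"
proof -
  have e0: "0 \<le> e i" if "i < m" for i using assms(1)[OF that] by linarith
  have "norm (\<Sum>i<m. z i *\<^sub>R a i) \<le> (\<Sum>i<m. norm (z i *\<^sub>R a i))" by (rule norm_sum)
  also have "\<dots> \<le> (\<Sum>i<m. sqrt (e i) * (sqrt (e i) * norm (a i)))"
  proof (rule sum_mono)
    fix i assume "i \<in> {..<m}"
    then have "\<bar>z i\<bar> \<le> e i" "0 \<le> e i" using assms(1)[of i] by auto
    then show "norm (z i *\<^sub>R a i) \<le> sqrt (e i) * (sqrt (e i) * norm (a i))"
      by (simp add: mult_right_mono flip: mult.assoc)
  qed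
  finally have "(norm (\<Sum>i<m. z i *\<^sub>R a i))\<^sup>2 \<le> (\<Sum>i<m. sqrt (e i) * (sqrt (e i) * norm (a i)))\<^sup>2"
    by (intro power_mono) auto
  also have "\<dots> \<le> (\<Sum>i<m. (sqrt (e i))\<^sup>2) * (\<Sum>i<m. (sqrt (e i) * norm (a i))\<^sup>2)"
    by (rule Cauchy_Schwarz_ineq_sum)
  also have "\<dots> = (\<Sum>i<m. e i) * (\<Sum>i<m. e i * (norm (a i))\<^sup>2)"
    using e0 by (simp add: power_mult_distrib)
  also have "\<dots> \<le> 1 * (\<Sum>i<m. e i * (norm (a i))\<^sup>2)"
    using assms(2) e0 by (intro mult_right_mono sum_nonneg) auto
  finally show ?thesis by simp
qed

lemma norm_sum_sq:
  fixes a :: "nat \<Rightarrow> 'b::real_normed_vector"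
  shows "(norm (\<Sum>i<m. a i))\<^sup>2 \<le> real m * (\<Sum>i<m. (norm (a i))\<^sup>2)"
proof -
  have "(norm (\<Sum>i<m. a i))\<^sup>2 \<le> (\<Sum>i<m. 1 * norm (a i))\<^sup>2"
    by (intro power_mono) (auto intro: norm_sum)
  also have "\<dots> \<le> (\<Sum>i<m. 1\<^sup>2) * (\<Sum>i<m. (norm (a i))\<^sup>2)" by (rule Cauchy_Schwarz_ineq_sum)
  finally show ?thesis by simp
qed

lemma norm_add_sq_Young:
  fixes a b :: "'b::real_normed_vector"
  assumes "t > 0"
  shows "(norm (a + b))\<^sup>2 \<le> (1 + t) * (norm a)\<^sup>2 + (1 + 1 / t) * (norm b)\<^sup>2"
proof -
  have "(norm (a + b))\<^sup>2 \<le> (norm a + norm b)\<^sup>2" by (intro power_mono norm_triangle_ineq) auto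
  moreover have "0 \<le> (t * norm a - norm b)\<^sup>2 / t" using assms by simp
  then have "2 * norm a * norm b \<le> t * (norm a)\<^sup>2 + (norm b)\<^sup>2 / t"
    using assms by (simp add: power2_eq_square field_simps)
  ultimately show ?thesis by (simp add: power2_eq_square algebra_simps)
qed

definition outside_mass :: "(real ^ 'n) set \<Rightarrow> (real ^ 'n \<Rightarrow> real) \<Rightarrow> real" where
  "outside_mass \<Omega> u = (\<integral>x. indicator (- \<Omega>) x * (u x)\<^sup>2 \<partial>lborel)"

text \<open>On \<open>\<Omega>\<close> the gradient of \<open>T t u\<close> is \<open>(\<Sum>i. \<zeta>\<^sub>i \<nabla>v\<^sub>i) + (\<Sum>i. v\<^sub>i \<nabla>\<zeta>\<^sub>i)\<close> with \<open>v\<^sub>i(x) = u(x - t \<nu>\<^sub>i)\<close>.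
  The first sum is a subconvex combination of shifted gradients; shifting back replaces the weights
  by \<open>\<eta>\<^sub>i(y + t \<nu>\<^sub>i) \<le> \<eta>\<^sub>i(y) + M t\<close>, whose sum is at most \<open>1 + m M t\<close>. In the second sum one may
  subtract \<open>u (\<Sum>i. \<nabla>\<eta>\<^sub>i) = 0\<close>, which leaves \<open>(v\<^sub>i - u) \<nabla>\<eta>\<^sub>i\<close>, of order \<open>t\<close> in mean square, and
  \<open>v\<^sub>i (\<nabla>\<zeta>\<^sub>i - \<nabla>\<eta>\<^sub>i)\<close>, which is of order \<open>1 / t\<close> times \<open>v\<^sub>i\<close> and vanishes unless the shifted point is
  outside \<open>\<Omega>\<close>. Young's inequality with weight \<open>t\<close> costs the second sum another factor \<open>1 / t\<close>,
  whence \<open>t ^ 3\<close> in the energy bound. The mass bound follows in the same way from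
  \<open>u - T t u = (\<Sum>i. \<eta>\<^sub>i u - \<zeta>\<^sub>i v\<^sub>i)\<close> on \<open>\<Omega>\<close>.\<close>

lemma transplantation:
  fixes \<Omega> :: "(real ^ 'n) set"
  assumes O: "open \<Omega>" "bounded \<Omega>" "C2_boundary \<Omega>"
  obtains c t0 :: real and T :: "real \<Rightarrow> (real ^ 'n \<Rightarrow> real) \<Rightarrow> real ^ 'n \<Rightarrow> real"
  where "c > 0" "t0 > 0" "t0 \<le> 1"
    "\<And>t k p a. T t (\<lambda>x. \<Sum>i<(k::nat). a i * p i x) = (\<lambda>x. \<Sum>i<k. a i * T t (p i) x)"
    "\<And>t u. 0 < t \<Longrightarrow> t < t0 \<Longrightarrow> C1c UNIV u \<Longrightarrow> C1c \<Omega> (T t u)"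
    "\<And>t u. 0 < t \<Longrightarrow> t < t0 \<Longrightarrow> C1c UNIV u \<Longrightarrow>
      energy (T t u) \<le> (1 + c * t) * energy u + c / t ^ 3 * outside_mass \<Omega> u"
    "\<And>t u. 0 < t \<Longrightarrow> t < t0 \<Longrightarrow> C1c UNIV u \<Longrightarrow>
      (\<integral>x. (u x)\<^sup>2 \<partial>lborel) \<le> (1 + t) * (\<integral>x. (T t u x)\<^sup>2 \<partial>lborel) + c * t * energy u + c / t * outside_mass \<Omega> u"
proof -
  obtain m :: nat and \<eta> \<nu> \<zeta> M t0 where f: "M \<ge> 0" "t0 > 0" "t0 \<le> 1"
    "\<And>i. i < m \<Longrightarrow> C1c UNIV (\<eta> i)" "\<And>i x. i < m \<Longrightarrow> 0 \<le> \<eta> i x" "\<And>x. (\<Sum>i<m. \<eta> i x) \<le> 1"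
    "\<And>x. x \<in> \<Omega> \<Longrightarrow> (\<Sum>i<m. \<eta> i x) = 1" "\<And>i. i < m \<Longrightarrow> norm (\<nu> i) \<le> 1"
    "\<And>i x. i < m \<Longrightarrow> norm (grad (\<eta> i) x) \<le> M" "\<And>i x h. i < m \<Longrightarrow> \<bar>\<eta> i (x + h) - \<eta> i x\<bar> \<le> M * norm h"
    "\<And>t i. 0 < t \<Longrightarrow> t < t0 \<Longrightarrow> i < m \<Longrightarrow> C1c \<Omega> (\<zeta> t i)"
    "\<And>t i x. 0 < t \<Longrightarrow> t < t0 \<Longrightarrow> i < m \<Longrightarrow> 0 \<le> \<zeta> t i x \<and> \<zeta> t i x \<le> \<eta> i x"
    "\<And>t i x. 0 < t \<Longrightarrow> t < t0 \<Longrightarrow> i < m \<Longrightarrow> x - t *\<^sub>R \<nu> i \<in> \<Omega> \<Longrightarrow> \<zeta> t i x = \<eta> i x \<and> grad (\<zeta> t i) x = grad (\<eta> i) x"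
    "\<And>t i x. 0 < t \<Longrightarrow> t < t0 \<Longrightarrow> i < m \<Longrightarrow> norm (grad (\<zeta> t i) x - grad (\<eta> i) x) \<le> M / t"
    by (rule cutoff_family[OF O]) blast
  define T where "T t u = (\<lambda>x. \<Sum>i<m. \<zeta> t i x * u (x - t *\<^sub>R \<nu> i))" for t and u :: "real ^ 'n \<Rightarrow> real"
  define c where "c = 1 + 2 * (real m * M) + 4 * (real m)\<^sup>2 * (M\<^sup>2 + 1)"
  have mM: "0 \<le> real m * M" "0 \<le> (real m)\<^sup>2 * M\<^sup>2" "0 \<le> (real m)\<^sup>2" using f(1) by auto
  have c: "c > 0" "1 + 2 * (real m * M) + 4 * ((real m)\<^sup>2 * M\<^sup>2) \<le> c" "4 * ((real m)\<^sup>2 * M\<^sup>2) \<le> c" "4 * (real m)\<^sup>2 + 1 \<le> c"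
  proof -
    have "c = 1 + 2 * (real m * M) + 4 * ((real m)\<^sup>2 * M\<^sup>2) + 4 * (real m)\<^sup>2" by (simp add: c_def algebra_simps)
    then show "c > 0" "1 + 2 * (real m * M) + 4 * ((real m)\<^sup>2 * M\<^sup>2) \<le> c" "4 * ((real m)\<^sup>2 * M\<^sup>2) \<le> c" "4 * (real m)\<^sup>2 + 1 \<le> c"
      using mM by linarith+
  qed
  have lin: "T t (\<lambda>x. \<Sum>i<k. a i * p i x) = (\<lambda>x. \<Sum>i<k. a i * T t (p i) x)" for t k and a :: "nat \<Rightarrow> real" and p
  proof
    fix x
    have "T t (\<lambda>x. \<Sum>i<k. a i * p i x) x = (\<Sum>j<m. \<Sum>i<k. a i * (\<zeta> t j x * p i (x - t *\<^sub>R \<nu> j)))"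
      unfolding T_def by (simp add: sum_distrib_left mult_ac)
    also have "\<dots> = (\<Sum>i<k. \<Sum>j<m. a i * (\<zeta> t j x * p i (x - t *\<^sub>R \<nu> j)))" by (rule sum.swap)
    finally show "T t (\<lambda>x. \<Sum>i<k. a i * p i x) x = (\<Sum>i<k. a i * T t (p i) x)"
      unfolding T_def by (simp add: sum_distrib_left)
  qed
  have main: "C1c \<Omega> (T t u) \<and> energy (T t u) \<le> (1 + c * t) * energy u + c / t ^ 3 * outside_mass \<Omega> u \<and>
      (\<integral>x. (u x)\<^sup>2 \<partial>lborel) \<le> (1 + t) * (\<integral>x. (T t u x)\<^sup>2 \<partial>lborel) + c * t * energy u + c / t * outside_mass \<Omega> u"
    if t: "0 < t" "t < t0" and u: "C1c UNIV u" for t u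
  proof -
    have t1: "t \<le> 1" using t f(3) by simp
    note uc = C1c_cont[OF u]
    note [measurable] = borel_cont[OF uc(1)] borel_cont[OF uc(2)]
    have Ob: "- \<Omega> \<in> sets borel" using O(1) by (auto intro: borel_closed)
    define v where "v i = (\<lambda>x. u (x - t *\<^sub>R \<nu> i))" for i
    have vC1: "C1 (v i)" and vg: "grad (v i) x = grad u (x - t *\<^sub>R \<nu> i)" for i x
      unfolding v_def using Ck_translate[OF uc(3)] grad_translate[OF uc(3)] by auto
    obtain R where R: "\<And>x. norm x > R \<Longrightarrow> u x = 0" using C1c_bounds[OF u] by metis
    have vC: "C1c UNIV (v i)" for i
      unfolding C1c_def
    proof (intro conjI vC1 exI[of _ "cball (t *\<^sub>R \<nu> i) R"] allI impI)
      fix x assume "x \<notin> cball (t *\<^sub>R \<nu> i) R"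
      then show "v i x = 0" unfolding v_def by (intro R) (simp add: dist_norm norm_minus_commute)
    qed auto
    have Tv: "T t u = (\<lambda>x. \<Sum>i<m. 1 * (\<zeta> t i x * v i x))" by (simp add: T_def v_def)
    have zC: "C1c \<Omega> (\<zeta> t i)" "C1 (\<zeta> t i)" if "i < m" for i using f(11)[OF t that] by (auto simp: C1c_def)
    have TC: "C1c \<Omega> (T t u)" unfolding Tv
      by (rule C1c_sum) (auto intro: C1c_mult(1) zC(1) vC1)
    have Tg: "grad (T t u) x = (\<Sum>i<m. \<zeta> t i x *\<^sub>R grad (v i) x) + (\<Sum>i<m. v i x *\<^sub>R grad (\<zeta> t i) x)" for x
    proof -
      have "grad (T t u) x = (\<Sum>i<m. grad (\<lambda>x. 1 * (\<zeta> t i x * v i x)) x)"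
        unfolding Tv by (rule grad_sum) (auto intro!: Ck_cmult Ck_mult zC(2) vC1 simp del: One_nat_def)
      also have "\<dots> = (\<Sum>i<m. \<zeta> t i x *\<^sub>R grad (v i) x + v i x *\<^sub>R grad (\<zeta> t i) x)"
        by (intro sum.cong refl) (simp add: grad_mult[OF zC(2) vC1] del: One_nat_def)
      finally show ?thesis by (simp add: sum.distrib)
    qed
    define w where "w = (\<lambda>x. indicator (- \<Omega>) x * (u x)\<^sup>2)"
    have [measurable]: "w \<in> borel_measurable borel" unfolding w_def using Ob by measurable
    have wi: "integrable lborel w"
    proof (rule Bochner_Integration.integrable_bound[OF C1c_integrable_sq[OF u]])
      show "AE x in lborel. norm (w x) \<le> norm ((u x)\<^sup>2)" by (intro AE_I2) (simp add: w_def indicator_def)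
    qed measurable
    have w0: "0 \<le> w x" for x by (simp add: w_def)
    define ws where "ws i = (\<lambda>x. w (x + (- (t *\<^sub>R \<nu> i))))" for i
    have wsi: "integrable lborel (ws i)" "(\<integral>x. ws i x \<partial>lborel) = outside_mass \<Omega> u" for i
      unfolding ws_def lborel_translate(2)[OF \<open>w \<in> borel_measurable borel\<close>] lborel_translate(1)[OF \<open>w \<in> borel_measurable borel\<close>]
      using wi by (simp_all add: outside_mass_def w_def)
    define ds where "ds i = (\<lambda>x. (v i x - u x)\<^sup>2)" for i
    have dsi: "integrable lborel (ds i)" "i < m \<Longrightarrow> (\<integral>x. ds i x \<partial>lborel) \<le> t\<^sup>2 * energy u" for i
    proof -
      have "C1c UNIV (\<lambda>x. v i x - u x)"
        using C1c_sum[of "{0, Suc 0}" UNIV "\<lambda>j. if j = 0 then v i else u" "\<lambda>j. if j = 0 then 1 else -1"] vC u by simp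
      from C1c_integrable_sq[OF this] show "integrable lborel (ds i)" unfolding ds_def .
      assume i: "i < m"
      have "(\<integral>x. ds i x \<partial>lborel) \<le> (norm (- (t *\<^sub>R \<nu> i)))\<^sup>2 * energy u"
        using translation_estimate[OF u, of "- (t *\<^sub>R \<nu> i)"] by (simp add: ds_def v_def)
      also have "\<dots> \<le> t\<^sup>2 * energy u"
        using f(8)[OF i] t by (intro mult_right_mono energy_nonneg power_mono) (auto simp: mult_left_le)
      finally show "(\<integral>x. ds i x \<partial>lborel) \<le> t\<^sup>2 * energy u" .
    qed
    have Om0: "outside_mass \<Omega> u \<ge> 0" using w0 by (auto simp: outside_mass_def w_def)
    \<comment> \<open>\<open>ws i\<close> is the shifted square of \<open>u\<close> outside \<open>\<Omega>\<close>; where it vanishes although \<open>v i\<close> does not,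
      the shifted point lies in \<open>\<Omega>\<close>.\<close>
    have zero: "\<zeta> t i x = \<eta> i x" "grad (\<zeta> t i) x = grad (\<eta> i) x" if "i < m" "v i x \<noteq> 0" "ws i x = 0" for i x
    proof -
      have "x - t *\<^sub>R \<nu> i \<in> \<Omega>"
        using that(2,3) by (auto simp: v_def ws_def w_def indicator_def split: if_splits)
      then show "\<zeta> t i x = \<eta> i x" "grad (\<zeta> t i) x = grad (\<eta> i) x" using f(13)[OF t that(1)] by auto
    qed
    have wsv: "ws i x = 0 \<or> ws i x = (v i x)\<^sup>2" for i x
      by (auto simp: ws_def w_def v_def indicator_def)
    have gradsum: "(\<Sum>i<m. grad (\<eta> i) x) = 0" if "x \<in> \<Omega>" for x
    proof -
      have "(\<Sum>i<m. grad (\<eta> i) x) = grad (\<lambda>x. \<Sum>i<m. \<eta> i x) x"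
        by (rule grad_sum[symmetric]) (use f(4) C1c_cont(3) in auto)
      also have "\<dots> = grad (\<lambda>x. 1) x" by (rule grad_local[OF O(1) that f(7)])
      finally show ?thesis by simp
    qed
    have Rbound: "(norm (\<Sum>i<m. v i x *\<^sub>R grad (\<zeta> t i) x))\<^sup>2
        \<le> 2 * real m * (\<Sum>i<m. M\<^sup>2 * ds i x + (M / t)\<^sup>2 * ws i x)" for x
    proof (cases "x \<in> \<Omega>")
      case False
      then have "grad (\<zeta> t i) x = 0" if "i < m" for i using C1c_zero_outside(2)[OF zC(1)[OF that]] by blast
      then have "(\<Sum>i<m. v i x *\<^sub>R grad (\<zeta> t i) x) = 0" by simp
      moreover have "0 \<le> (\<Sum>i<m. M\<^sup>2 * ds i x + (M / t)\<^sup>2 * ws i x)"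
        using w0 by (intro sum_nonneg) (auto simp: ds_def ws_def)
      ultimately show ?thesis by simp
    next
      case True
      have "(\<Sum>i<m. v i x *\<^sub>R grad (\<zeta> t i) x) = (\<Sum>i<m. v i x *\<^sub>R grad (\<zeta> t i) x) - u x *\<^sub>R (\<Sum>i<m. grad (\<eta> i) x)"
        using gradsum[OF True] by simp
      also have "\<dots> = (\<Sum>i<m. v i x *\<^sub>R grad (\<zeta> t i) x - u x *\<^sub>R grad (\<eta> i) x)"
        by (simp add: sum_subtractf scaleR_sum_right)
      also have "(norm \<dots>)\<^sup>2 \<le> real m * (\<Sum>i<m. (norm (v i x *\<^sub>R grad (\<zeta> t i) x - u x *\<^sub>R grad (\<eta> i) x))\<^sup>2)"
        by (rule norm_sum_sq)
      also have "\<dots> \<le> real m * (\<Sum>i<m. 2 * (M\<^sup>2 * ds i x + (M / t)\<^sup>2 * ws i x))"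
      proof (intro mult_left_mono sum_mono)
        fix i assume "i \<in> {..<m}"
        then have i: "i < m" by simp
        have e: "v i x *\<^sub>R grad (\<zeta> t i) x - u x *\<^sub>R grad (\<eta> i) x
          = (v i x - u x) *\<^sub>R grad (\<eta> i) x + v i x *\<^sub>R (grad (\<zeta> t i) x - grad (\<eta> i) x)"
          by (simp add: algebra_simps)
        have "(norm ((v i x - u x) *\<^sub>R grad (\<eta> i) x))\<^sup>2 = ds i x * (norm (grad (\<eta> i) x))\<^sup>2"
          by (simp add: ds_def power_mult_distrib)
        also have "\<dots> \<le> ds i x * M\<^sup>2"
          using f(9)[OF i] by (intro mult_left_mono power_mono) (auto simp: ds_def)
        finally have 1: "(norm ((v i x - u x) *\<^sub>R grad (\<eta> i) x))\<^sup>2 \<le> M\<^sup>2 * ds i x" by (simp add: mult.commute)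
        have 2: "(norm (v i x *\<^sub>R (grad (\<zeta> t i) x - grad (\<eta> i) x)))\<^sup>2 \<le> (M / t)\<^sup>2 * ws i x"
        proof (cases "v i x = 0 \<or> ws i x = 0")
          case True
          then have z: "v i x *\<^sub>R (grad (\<zeta> t i) x - grad (\<eta> i) x) = 0" using zero(2)[OF i] by auto
          show ?thesis unfolding z using w0 by (simp add: ws_def)
        next
          case False
          then have "ws i x = (v i x)\<^sup>2" using wsv[of i x] by blast
          moreover have "(norm (grad (\<zeta> t i) x - grad (\<eta> i) x))\<^sup>2 \<le> (M / t)\<^sup>2"
            using f(14)[OF t i] by (intro power_mono) auto
          ultimately show ?thesis
            using mult_right_mono[of "(norm (grad (\<zeta> t i) x - grad (\<eta> i) x))\<^sup>2" "(M / t)\<^sup>2" "(v i x)\<^sup>2"]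
            by (simp add: power_mult_distrib mult.commute)
        qed
        show "(norm (v i x *\<^sub>R grad (\<zeta> t i) x - u x *\<^sub>R grad (\<eta> i) x))\<^sup>2 \<le> 2 * (M\<^sup>2 * ds i x + (M / t)\<^sup>2 * ws i x)"
          unfolding e distrib_left
          by (rule order_trans[OF norm_add_sq add_mono[OF mult_left_mono[OF 1] mult_left_mono[OF 2]]]) auto
      qed simp
      also have "\<dots> = 2 * real m * (\<Sum>i<m. M\<^sup>2 * ds i x + (M / t)\<^sup>2 * ws i x)"
        by (simp only: sum_distrib_left[symmetric] mult.assoc mult.left_commute)
      finally show ?thesis .
    qed
    define A where "A i = (\<lambda>x. \<eta> i x * (norm (grad (v i) x))\<^sup>2)" for i
    have Ai: "integrable lborel (A i)" "(\<integral>x. A i x \<partial>lborel) \<le> (\<integral>x. \<eta> i x * (norm (grad u x))\<^sup>2 \<partial>lborel) + M * t * energy u"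
      "integrable lborel (\<lambda>x. \<eta> i x * (norm (grad u x))\<^sup>2)" if i: "i < m" for i
    proof -
      note ec = C1c_cont[OF f(4)[OF i]]
      have c1: "continuous_on UNIV (\<lambda>x. (norm (grad g x))\<^sup>2)" if "C1 g" for g :: "real ^ 'n \<Rightarrow> real"
        using C1_continuous_grad[OF that] by (intro continuous_intros)
      show "integrable lborel (A i)" unfolding A_def
        by (rule C1c_integrable_mult[OF f(4)[OF i] c1[OF vC1]])
      show ei: "integrable lborel (\<lambda>x. \<eta> i x * (norm (grad u x))\<^sup>2)"
        by (rule C1c_integrable_mult[OF f(4)[OF i] c1[OF uc(3)]])
      let ?B = "\<lambda>x. \<eta> i (x + t *\<^sub>R \<nu> i) * (norm (grad u x))\<^sup>2"
      have Bm: "?B \<in> borel_measurable borel"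
        by (intro borel_cont continuous_intros c1[OF uc(3)] continuous_on_compose2[OF ec(1)]) auto
      have Am: "A i \<in> borel_measurable borel" unfolding A_def
        by (intro borel_cont continuous_on_mult ec(1) c1[OF vC1])
      have AB: "(\<lambda>x. A i (x + t *\<^sub>R \<nu> i)) = ?B" by (simp add: A_def vg)
      have Bi: "integrable lborel ?B"
        using lborel_translate(2)[OF Am, of "t *\<^sub>R \<nu> i"] \<open>integrable lborel (A i)\<close> unfolding AB by simp
      have "(\<integral>x. A i x \<partial>lborel) = (\<integral>x. ?B x \<partial>lborel)"
        using lborel_translate(1)[OF Am, of "t *\<^sub>R \<nu> i"] unfolding AB by simp
      also have "\<dots> \<le> (\<integral>x. \<eta> i x * (norm (grad u x))\<^sup>2 + M * t * (norm (grad u x))\<^sup>2 \<partial>lborel)"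
      proof (rule integral_mono[OF Bi])
        show "integrable lborel (\<lambda>x. \<eta> i x * (norm (grad u x))\<^sup>2 + M * t * (norm (grad u x))\<^sup>2)"
          using ei C1c_integrable_grad_sq[OF u] by auto
        fix x
        have "M * norm (t *\<^sub>R \<nu> i) \<le> M * t"
          using f(1) f(8)[OF i] t by (intro mult_left_mono) (auto simp: mult_left_le)
        then have "\<eta> i (x + t *\<^sub>R \<nu> i) \<le> \<eta> i x + M * t"
          using f(10)[OF i, of x "t *\<^sub>R \<nu> i"] by linarith
        from mult_right_mono[OF this, of "(norm (grad u x))\<^sup>2"]
        show "?B x \<le> \<eta> i x * (norm (grad u x))\<^sup>2 + M * t * (norm (grad u x))\<^sup>2"
          by (simp add: algebra_simps)
      qed
      also have "\<dots> = (\<integral>x. \<eta> i x * (norm (grad u x))\<^sup>2 \<partial>lborel) + M * t * energy u"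
        using ei C1c_integrable_grad_sq[OF u] by (simp add: energy_def)
      finally show "(\<integral>x. A i x \<partial>lborel) \<le> (\<integral>x. \<eta> i x * (norm (grad u x))\<^sup>2 \<partial>lborel) + M * t * energy u" .
    qed
    have Asum: "(\<Sum>i<m. \<integral>x. A i x \<partial>lborel) \<le> (1 + real m * M * t) * energy u"
    proof -
      have "(\<Sum>i<m. \<integral>x. A i x \<partial>lborel) \<le> (\<Sum>i<m. (\<integral>x. \<eta> i x * (norm (grad u x))\<^sup>2 \<partial>lborel) + M * t * energy u)"
        using Ai(2) by (intro sum_mono) auto
      also have "\<dots> = (\<Sum>i<m. \<integral>x. \<eta> i x * (norm (grad u x))\<^sup>2 \<partial>lborel) + real m * M * t * energy u"
        by (simp add: sum.distrib)
      also have "(\<Sum>i<m. \<integral>x. \<eta> i x * (norm (grad u x))\<^sup>2 \<partial>lborel) = (\<integral>x. (\<Sum>i<m. \<eta> i x * (norm (grad u x))\<^sup>2) \<partial>lborel)"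
        using Ai(3) by (intro Bochner_Integration.integral_sum[symmetric]) auto
      also have "\<dots> \<le> energy u" unfolding energy_def
      proof (rule integral_mono)
        show "(\<Sum>i<m. \<eta> i x * (norm (grad u x))\<^sup>2) \<le> (norm (grad u x))\<^sup>2" for x
          using mult_right_mono[OF f(6)[of x], of "(norm (grad u x))\<^sup>2"] by (simp add: sum_distrib_right)
      qed (use Ai(3) C1c_integrable_grad_sq[OF u] in auto)
      finally show ?thesis by (simp add: algebra_simps)
    qed
    define E where "E = (\<Sum>i<m. \<integral>x. M\<^sup>2 * ds i x + (M / t)\<^sup>2 * ws i x \<partial>lborel)"
    have E: "E \<le> real m * (M\<^sup>2 * (t\<^sup>2 * energy u) + (M / t)\<^sup>2 * outside_mass \<Omega> u)"
    proof -
      have "E \<le> (\<Sum>i<m. M\<^sup>2 * (t\<^sup>2 * energy u) + (M / t)\<^sup>2 * outside_mass \<Omega> u)"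
        unfolding E_def
      proof (rule sum_mono)
        fix i assume "i \<in> {..<m}"
        then have "M\<^sup>2 * (\<integral>x. ds i x \<partial>lborel) \<le> M\<^sup>2 * (t\<^sup>2 * energy u)"
          by (intro mult_left_mono dsi(2)) auto
        then show "(\<integral>x. M\<^sup>2 * ds i x + (M / t)\<^sup>2 * ws i x \<partial>lborel) \<le> M\<^sup>2 * (t\<^sup>2 * energy u) + (M / t)\<^sup>2 * outside_mass \<Omega> u"
          using dsi(1)[of i] wsi[of i] by simp
      qed
      then show ?thesis by simp
    qed
    have it: "0 \<le> 1 + 1 / t" "1 + 1 / t \<le> 2 / t" using t t1 by (auto simp: field_simps)
    have en: "energy (T t u) \<le> (1 + t) * ((1 + real m * M * t) * energy u) + (2 / t) * (2 * real m * E)"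
    proof -
      have "energy (T t u) \<le> (\<integral>x. (1 + t) * (\<Sum>i<m. A i x) + (1 + 1 / t) * (2 * real m * (\<Sum>i<m. M\<^sup>2 * ds i x + (M / t)\<^sup>2 * ws i x)) \<partial>lborel)"
        unfolding energy_def
      proof (rule integral_mono)
        show "integrable lborel (\<lambda>x. (norm (grad (T t u) x))\<^sup>2)"
          by (rule C1c_integrable_grad_sq[OF C1c_mono[OF TC subset_UNIV]])
        show "integrable lborel (\<lambda>x. (1 + t) * (\<Sum>i<m. A i x) + (1 + 1 / t) * (2 * real m * (\<Sum>i<m. M\<^sup>2 * ds i x + (M / t)\<^sup>2 * ws i x)))"
          using Ai(1) dsi(1) wsi(1) by (intro Bochner_Integration.integrable_add integrable_mult_right Bochner_Integration.integrable_sum) auto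
        fix x
        have "(norm (grad (T t u) x))\<^sup>2 \<le> (1 + t) * (norm (\<Sum>i<m. \<zeta> t i x *\<^sub>R grad (v i) x))\<^sup>2
          + (1 + 1 / t) * (norm (\<Sum>i<m. v i x *\<^sub>R grad (\<zeta> t i) x))\<^sup>2"
          unfolding Tg by (rule norm_add_sq_Young[OF t(1)])
        also have "\<dots> \<le> (1 + t) * (\<Sum>i<m. A i x) + (1 + 1 / t) * (2 * real m * (\<Sum>i<m. M\<^sup>2 * ds i x + (M / t)\<^sup>2 * ws i x))"
          unfolding A_def using t it(1)
          by (intro add_mono mult_left_mono Rbound weighted_norm_sum_sq f(12)[OF t] f(6)) auto
        finally show "(norm (grad (T t u) x))\<^sup>2 \<le> (1 + t) * (\<Sum>i<m. A i x) + (1 + 1 / t) * (2 * real m * (\<Sum>i<m. M\<^sup>2 * ds i x + (M / t)\<^sup>2 * ws i x))" .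
      qed
      also have "\<dots> = (1 + t) * (\<Sum>i<m. \<integral>x. A i x \<partial>lborel) + (1 + 1 / t) * (2 * real m * E)"
      proof -
        have i1: "integrable lborel (\<lambda>x. \<Sum>i<m. A i x)" using Ai(1) by (intro Bochner_Integration.integrable_sum) auto
        have i2: "integrable lborel (\<lambda>x. M\<^sup>2 * ds i x + (M / t)\<^sup>2 * ws i x)" for i using dsi(1) wsi(1) by auto
        have i3: "integrable lborel (\<lambda>x. \<Sum>i<m. M\<^sup>2 * ds i x + (M / t)\<^sup>2 * ws i x)" by (intro Bochner_Integration.integrable_sum i2)
        have "(\<integral>x. (\<Sum>i<m. A i x) \<partial>lborel) = (\<Sum>i<m. \<integral>x. A i x \<partial>lborel)"
          using Ai(1) by (intro Bochner_Integration.integral_sum) auto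
        moreover have "(\<integral>x. (\<Sum>i<m. M\<^sup>2 * ds i x + (M / t)\<^sup>2 * ws i x) \<partial>lborel) = E"
          unfolding E_def by (intro Bochner_Integration.integral_sum i2)
        ultimately show ?thesis
          by (subst Bochner_Integration.integral_add) (use i1 i3 in auto)
      qed
      also have "\<dots> \<le> (1 + t) * ((1 + real m * M * t) * energy u) + (2 / t) * (2 * real m * E)"
      proof -
        have "0 \<le> E" unfolding E_def
          using w0 by (intro sum_nonneg integral_nonneg_AE AE_I2) (auto simp: ds_def ws_def)
        then show ?thesis using Asum it(2) t by (intro add_mono mult_left_mono mult_right_mono) auto
      qed
      finally show ?thesis .
    qed
    have en2: "energy (T t u) \<le> (1 + c * t) * energy u + c / t ^ 3 * outside_mass \<Omega> u"
    proof -
      have "(2 / t) * (2 * real m * E) \<le> (2 / t) * (2 * real m * (real m * (M\<^sup>2 * (t\<^sup>2 * energy u) + (M / t)\<^sup>2 * outside_mass \<Omega> u)))"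
        using t by (intro mult_left_mono E) auto
      also have "\<dots> = 4 * ((real m)\<^sup>2 * M\<^sup>2) * t * energy u + 4 * ((real m)\<^sup>2 * M\<^sup>2) / t ^ 3 * outside_mass \<Omega> u"
        using t by (simp add: field_simps power2_eq_square power3_eq_cube)
      also have "\<dots> \<le> 4 * ((real m)\<^sup>2 * M\<^sup>2) * t * energy u + c / t ^ 3 * outside_mass \<Omega> u"
        using c(3) t Om0 by (intro add_left_mono mult_right_mono divide_right_mono) auto
      finally have 1: "(2 / t) * (2 * real m * E) \<le> 4 * ((real m)\<^sup>2 * M\<^sup>2) * t * energy u + c / t ^ 3 * outside_mass \<Omega> u" .
      have "real m * M * t * t \<le> real m * M * t * 1" using mM t t1 by (intro mult_left_mono) auto
      then have "(1 + t) * (1 + real m * M * t) \<le> 1 + (1 + 2 * (real m * M)) * t" by (simp add: algebra_simps)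
      then have "(1 + t) * (1 + real m * M * t) * energy u \<le> (1 + (1 + 2 * (real m * M)) * t) * energy u"
        by (intro mult_right_mono energy_nonneg)
      moreover have "(1 + 2 * (real m * M) + 4 * ((real m)\<^sup>2 * M\<^sup>2)) * t * energy u \<le> c * t * energy u"
        using c(2) t by (intro mult_right_mono energy_nonneg) auto
      ultimately show ?thesis using en 1 by (simp add: algebra_simps)
    qed
    have mass: "(\<integral>x. (u x)\<^sup>2 \<partial>lborel) \<le> (1 + t) * (\<integral>x. (T t u x)\<^sup>2 \<partial>lborel) + c * t * energy u + c / t * outside_mass \<Omega> u"
    proof -
      have Tsi: "integrable lborel (\<lambda>x. (T t u x)\<^sup>2)" by (rule C1c_integrable_sq[OF C1c_mono[OF TC subset_UNIV]])
      have pt: "(u x)\<^sup>2 \<le> (1 + t) * (T t u x)\<^sup>2 + (2 / t) * (2 * real m * (\<Sum>i<m. ds i x + ws i x)) + w x" for x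
      proof (cases "x \<in> \<Omega>")
        case False
        have "0 \<le> (\<Sum>i<m. ds i x + ws i x)" using w0 by (intro sum_nonneg) (auto simp: ds_def ws_def)
        then have "0 \<le> (1 + t) * (T t u x)\<^sup>2 + (2 / t) * (2 * real m * (\<Sum>i<m. ds i x + ws i x))"
          using t by (intro add_nonneg_nonneg mult_nonneg_nonneg) auto
        then show ?thesis using False by (simp add: w_def)
      next
        case True
        have d: "u x - T t u x = (\<Sum>i<m. \<eta> i x * u x - \<zeta> t i x * v i x)"
        proof -
          have "u x = (\<Sum>i<m. \<eta> i x) * u x" using f(7)[OF True] by simp
          then show ?thesis by (simp add: Tv sum_subtractf sum_distrib_right)
        qed
        have "(norm (u x - T t u x))\<^sup>2 \<le> real m * (\<Sum>i<m. (norm (\<eta> i x * u x - \<zeta> t i x * v i x))\<^sup>2)"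
          unfolding d by (rule norm_sum_sq)
        also have "\<dots> \<le> real m * (\<Sum>i<m. 2 * (ds i x + ws i x))"
        proof (intro mult_left_mono sum_mono)
          fix i assume "i \<in> {..<m}"
          then have i: "i < m" by simp
          have e: "\<eta> i x * u x - \<zeta> t i x * v i x = \<eta> i x * (u x - v i x) + (\<eta> i x - \<zeta> t i x) * v i x"
            by (simp add: algebra_simps)
          have "\<eta> i x \<le> (\<Sum>i<m. \<eta> i x)" using i f(5) by (intro member_le_sum) auto
          then have e1: "\<bar>\<eta> i x\<bar> \<le> 1" "\<bar>\<eta> i x - \<zeta> t i x\<bar> \<le> 1"
            using f(6)[of x] f(5)[OF i, of x] f(12)[OF t i, of x] by linarith+
          have sq1: "y\<^sup>2 \<le> 1" if "\<bar>y\<bar> \<le> 1" for y :: real using that by (simp add: abs_square_le_1)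
          have 1: "(norm (\<eta> i x * (u x - v i x)))\<^sup>2 \<le> ds i x"
            using mult_right_mono[OF sq1[OF e1(1)], of "(u x - v i x)\<^sup>2"]
            by (simp add: power_mult_distrib ds_def power2_commute)
          have 2: "(norm ((\<eta> i x - \<zeta> t i x) * v i x))\<^sup>2 \<le> ws i x"
          proof (cases "v i x = 0 \<or> ws i x = 0")
            case True
            then have z: "(\<eta> i x - \<zeta> t i x) * v i x = 0" using zero(1)[OF i] by auto
            show ?thesis unfolding z using w0 by (simp add: ws_def)
          next
            case False
            then have "ws i x = (v i x)\<^sup>2" using wsv[of i x] by blast
            then show ?thesis using mult_right_mono[OF sq1[OF e1(2)], of "(v i x)\<^sup>2"]
              by (simp add: power_mult_distrib)
          qed
          show "(norm (\<eta> i x * u x - \<zeta> t i x * v i x))\<^sup>2 \<le> 2 * (ds i x + ws i x)"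
            unfolding e distrib_left
            by (rule order_trans[OF norm_add_sq add_mono[OF mult_left_mono[OF 1] mult_left_mono[OF 2]]]) auto
        qed simp
        also have "\<dots> = 2 * real m * (\<Sum>i<m. ds i x + ws i x)"
          by (simp only: sum_distrib_left[symmetric] mult.assoc mult.left_commute)
        finally have dd: "(norm (u x - T t u x))\<^sup>2 \<le> 2 * real m * (\<Sum>i<m. ds i x + ws i x)" .
        have "(u x)\<^sup>2 \<le> (1 + t) * (T t u x)\<^sup>2 + (1 + 1 / t) * (norm (u x - T t u x))\<^sup>2"
          using norm_add_sq_Young[OF t(1), of "T t u x" "u x - T t u x"] by simp
        also have "(1 + 1 / t) * (norm (u x - T t u x))\<^sup>2 \<le> (2 / t) * (2 * real m * (\<Sum>i<m. ds i x + ws i x))"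
          using it dd t by (intro mult_mono) auto
        finally show ?thesis using w0[of x] by linarith
      qed
      have i1: "integrable lborel (\<lambda>x. ds i x + ws i x)" for i using dsi(1) wsi(1) by auto
      have i2: "integrable lborel (\<lambda>x. \<Sum>i<m. ds i x + ws i x)" by (intro Bochner_Integration.integrable_sum i1)
      have "(\<integral>x. (u x)\<^sup>2 \<partial>lborel) \<le> (\<integral>x. (1 + t) * (T t u x)\<^sup>2 + (2 / t) * (2 * real m * (\<Sum>i<m. ds i x + ws i x)) + w x \<partial>lborel)"
        by (intro integral_mono C1c_integrable_sq[OF u] pt Bochner_Integration.integrable_add integrable_mult_right Tsi i2 wi)
      also have "\<dots> = (1 + t) * (\<integral>x. (T t u x)\<^sup>2 \<partial>lborel) + (2 / t) * (2 * real m * (\<integral>x. (\<Sum>i<m. ds i x + ws i x) \<partial>lborel)) + outside_mass \<Omega> u"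
        using Tsi i2 wi by (simp add: outside_mass_def w_def)
      also have "(\<integral>x. (\<Sum>i<m. ds i x + ws i x) \<partial>lborel) = (\<Sum>i<m. \<integral>x. ds i x + ws i x \<partial>lborel)"
        by (intro Bochner_Integration.integral_sum i1)
      also have "(\<Sum>i<m. \<integral>x. ds i x + ws i x \<partial>lborel) \<le> (\<Sum>i<m. t\<^sup>2 * energy u + outside_mass \<Omega> u)"
        using dsi wsi by (intro sum_mono) auto
      finally have "(\<integral>x. (u x)\<^sup>2 \<partial>lborel) \<le> (1 + t) * (\<integral>x. (T t u x)\<^sup>2 \<partial>lborel)
        + (2 / t) * (2 * real m * (real m * (t\<^sup>2 * energy u + outside_mass \<Omega> u))) + outside_mass \<Omega> u"
        using t by (simp add: mult_left_mono divide_right_mono)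
      moreover have "(2 / t) * (2 * real m * (real m * (t\<^sup>2 * energy u + outside_mass \<Omega> u)))
        = 4 * (real m)\<^sup>2 * t * energy u + 4 * (real m)\<^sup>2 / t * outside_mass \<Omega> u"
        using t by (simp add: field_simps power2_eq_square)
      moreover have "outside_mass \<Omega> u \<le> 1 / t * outside_mass \<Omega> u"
        using t t1 Om0 mult_right_mono[of 1 "1 / t" "outside_mass \<Omega> u"] by (simp add: field_simps)
      moreover have "(4 * (real m)\<^sup>2 + 1) / t * outside_mass \<Omega> u
        = 4 * (real m)\<^sup>2 / t * outside_mass \<Omega> u + 1 / t * outside_mass \<Omega> u"
        by (simp add: add_divide_distrib distrib_right)
      ultimately have "(\<integral>x. (u x)\<^sup>2 \<partial>lborel) \<le> (1 + t) * (\<integral>x. (T t u x)\<^sup>2 \<partial>lborel)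
        + 4 * (real m)\<^sup>2 * t * energy u + (4 * (real m)\<^sup>2 + 1) / t * outside_mass \<Omega> u"
        by linarith
      moreover have "4 * (real m)\<^sup>2 * t * energy u \<le> c * t * energy u"
        using c(4) t by (intro mult_right_mono energy_nonneg) auto
      moreover have "(4 * (real m)\<^sup>2 + 1) / t * outside_mass \<Omega> u \<le> c / t * outside_mass \<Omega> u"
        using c(4) t by (intro mult_right_mono divide_right_mono Om0) auto
      ultimately show ?thesis by linarith
    qed
    show ?thesis using TC en2 mass by blast
  qed
  show thesis
    by (rule that[of c t0 T]) (use c(1) f(2,3) lin main in auto)
qed

section \<open>Comparison of the two eigenvalues\<close>

lemma schroedinger_Dirichlet:
  fixes \<Omega> :: "(real ^ 'n) set"
  assumes "open \<Omega>" "bounded \<Omega>" "\<Omega> \<noteq> {}"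
  shows "schroedinger (\<lambda>x. 0) \<Omega> 0"
  using assms by unfold_locales auto

lemma schroedinger_penalized:
  fixes \<Omega> D :: "(real ^ 'n) set"
  assumes "open D" "bounded D" "D \<noteq> {}" "open \<Omega>" "C > 0"
  shows "schroedinger (\<lambda>x. C * indicator (- \<Omega>) x) D C"
proof
  have "- \<Omega> \<in> sets borel" using assms(4) by (auto intro: borel_closed)
  then have "(\<lambda>x. C * indicator (- \<Omega>) x) \<in> borel_measurable borel" by measurable
  then show "(\<lambda>x. C * indicator (- \<Omega>) x) \<in> borel_measurable (lebesgue_on D)"
    by (intro measurable_restrict_space1 measurable_completion) simp
qed (use assms in \<open>auto simp: indicator_def\<close>)

lemma dirichlet_eigenvalue_nonneg:
  fixes \<Omega> :: "(real ^ 'n) set"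
  assumes "open \<Omega>" "bounded \<Omega>" "\<Omega> \<noteq> {}"
  shows "dirichlet_eigenvalue \<Omega> (Suc k) \<ge> 0"
  unfolding dirichlet_eigenvalue_def
  by (rule schroedinger.kth_eigenvalue_nonneg[OF schroedinger_Dirichlet[OF assms]])

lemma penalized_eigenvalue_nonneg:
  fixes \<Omega> D :: "(real ^ 'n) set"
  assumes "open D" "bounded D" "D \<noteq> {}" "open \<Omega>" "C > 0"
  shows "penalized_eigenvalue C \<Omega> D (Suc k) \<ge> 0"
  unfolding penalized_eigenvalue_def
  by (rule schroedinger.kth_eigenvalue_nonneg[OF schroedinger_penalized[OF assms]])

text \<open>A trial space of test functions on \<open>\<Omega>\<close> is one on \<open>D\<close>, with the same energies, since the penalty
  does not see functions supported in \<open>\<Omega>\<close>.\<close>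

lemma penalized_le_dirichlet:
  fixes \<Omega> D :: "(real ^ 'n) set"
  assumes D: "open D" "bounded D" and O: "open \<Omega>" "\<Omega> \<noteq> {}" "\<Omega> \<subseteq> D" and C: "C > 0"
  shows "penalized_eigenvalue C \<Omega> D (Suc k) \<le> dirichlet_eigenvalue \<Omega> (Suc k)"
proof (rule field_le_epsilon)
  fix \<epsilon> :: real assume ep: "\<epsilon> > 0"
  have Ob: "bounded \<Omega>" using D(2) O(3) by (rule bounded_subset)
  have Dn: "D \<noteq> {}" using O by auto
  interpret O: schroedinger "\<lambda>x. 0" \<Omega> 0 by (rule schroedinger_Dirichlet[OF O(1) Ob O(2)])
  interpret D: schroedinger "\<lambda>x. C * indicator (- \<Omega>) x" D C by (rule schroedinger_penalized[OF D Dn O(1) C])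
  obtain p where p: "\<And>i. i < Suc k \<Longrightarrow> p i \<in> test_functions \<Omega>"
    "\<And>a. \<exists>i<Suc k. a i \<noteq> 0 \<Longrightarrow> (\<integral>x. (\<Sum>i<Suc k. a i * p i x)\<^sup>2 \<partial>lborel) > 0"
    "\<And>a. energy (lincomb (Suc k) a p) + (\<integral>x. 0 * (\<Sum>i<Suc k. a i * p i x)\<^sup>2 \<partial>lebesgue_on \<Omega>)
      \<le> (kth_eigenvalue (\<lambda>x. 0) \<Omega> (Suc k) + \<epsilon>) * (\<integral>x. (\<Sum>i<Suc k. a i * p i x)\<^sup>2 \<partial>lborel)"
    using O.kth_eigenvalue_test_space[OF ep] by blast
  show "penalized_eigenvalue C \<Omega> D (Suc k) \<le> dirichlet_eigenvalue \<Omega> (Suc k) + \<epsilon>"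
    unfolding penalized_eigenvalue_def
  proof (rule D.kth_eigenvalue_le[OF _ p(2)])
    show "C1c D (p i)" if "i < Suc k" for i by (rule C1c_mono[OF test_C1c[OF p(1)[OF that]] O(3)])
    fix a :: "nat \<Rightarrow> real"
    have "(\<Sum>i<Suc k. a i * p i x) = 0" if "x \<notin> \<Omega>" for x
    proof -
      have "p i x = 0" if "i < Suc k" for i
        using C1c_zero_outside(1)[OF test_C1c[OF p(1)[OF that]] \<open>x \<notin> \<Omega>\<close>] .
      then show ?thesis by simp
    qed
    then have z: "C * indicator (- \<Omega>) x * (\<Sum>i<Suc k. a i * p i x)\<^sup>2 = 0" for x by (cases "x \<in> \<Omega>") auto
    show "energy (lincomb (Suc k) a p) + (\<integral>x. C * indicator (- \<Omega>) x * (\<Sum>i<Suc k. a i * p i x)\<^sup>2 \<partial>lebesgue_on D)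
      \<le> (dirichlet_eigenvalue \<Omega> (Suc k) + \<epsilon>) * (\<integral>x. (\<Sum>i<Suc k. a i * p i x)\<^sup>2 \<partial>lborel)"
      unfolding z dirichlet_eigenvalue_def using p(3)[of a] by (simp del: sum.lessThan_Suc)
  qed
qed

lemma outside_mass_on:
  fixes \<Omega> D :: "(real ^ 'n) set"
  assumes "open D" "open \<Omega>" "C1c D u"
  shows "(\<integral>x. C * indicator (- \<Omega>) x * (u x)\<^sup>2 \<partial>lebesgue_on D) = C * outside_mass \<Omega> u"
proof -
  have "- \<Omega> \<in> sets borel" using assms(2) by (auto intro: borel_closed)
  moreover note [measurable] = borel_cont[OF C1c_cont(1)[OF assms(3)]]
  ultimately have "(\<lambda>x. C * indicator (- \<Omega>) x * (u x)\<^sup>2) \<in> borel_measurable borel" by measurable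
  then have "(\<integral>x. C * indicator (- \<Omega>) x * (u x)\<^sup>2 \<partial>lebesgue_on D) = (\<integral>x. C * indicator (- \<Omega>) x * (u x)\<^sup>2 \<partial>lborel)"
    by (rule lebesgue_on_eq_lborel(1)[OF assms(1)]) (use C1c_zero_outside(1)[OF assms(3)] in simp)
  then show ?thesis by (simp add: outside_mass_def mult.assoc)
qed

text \<open>Transplantation of a nearly optimal trial space of the penalised problem. For \<open>C = 1 / t ^ 4\<close> the
  two error terms in \<open>transplantation\<close> that contain the mass outside \<open>\<Omega>\<close> are at most \<open>c t\<close> times the
  penalty, so that all errors are relative errors of order \<open>t\<close>. Since \<open>\<sigma> \<le> \<Lambda>\<close>, the constants do not
  depend on \<open>t\<close>.\<close>

lemma dirichlet_le_penalized:
  fixes \<Omega> D :: "(real ^ 'n) set"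
  assumes D: "open D" "bounded D" and O: "open \<Omega>" "\<Omega> \<noteq> {}" "\<Omega> \<subseteq> D" "C2_boundary \<Omega>"
  obtains K t1 :: real where "K > 0" "t1 > 0" "t1 \<le> 1"
    "\<And>t. 0 < t \<Longrightarrow> t < t1 \<Longrightarrow> dirichlet_eigenvalue \<Omega> (Suc k) \<le> (1 + K * t) * penalized_eigenvalue (1 / t ^ 4) \<Omega> D (Suc k)"
proof -
  have Ob: "bounded \<Omega>" using D(2) O(3) by (rule bounded_subset)
  have Dn: "D \<noteq> {}" using O by auto
  interpret O: schroedinger "\<lambda>x. 0" \<Omega> 0 by (rule schroedinger_Dirichlet[OF O(1) Ob O(2)])
  obtain c t0 T where T: "c > 0" "t0 > 0" "t0 \<le> 1"
    "\<And>t k p a. T t (\<lambda>x. \<Sum>i<(k::nat). a i * p i x) = (\<lambda>x. \<Sum>i<k. a i * T t (p i) x)"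
    "\<And>t u. 0 < t \<Longrightarrow> t < t0 \<Longrightarrow> C1c UNIV u \<Longrightarrow> C1c \<Omega> (T t u)"
    "\<And>t u. 0 < t \<Longrightarrow> t < t0 \<Longrightarrow> C1c UNIV u \<Longrightarrow>
      energy (T t u) \<le> (1 + c * t) * energy u + c / t ^ 3 * outside_mass \<Omega> u"
    "\<And>t u. 0 < t \<Longrightarrow> t < t0 \<Longrightarrow> C1c UNIV u \<Longrightarrow>
      (\<integral>x. (u x)\<^sup>2 \<partial>lborel) \<le> (1 + t) * (\<integral>x. (T t u x)\<^sup>2 \<partial>lborel) + c * t * energy u + c / t * outside_mass \<Omega> u"
    by (rule transplantation[OF O(1) Ob O(4)]) blast
  define \<Lambda> where "\<Lambda> = dirichlet_eigenvalue \<Omega> (Suc k)"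
  have L0: "\<Lambda> \<ge> 0" unfolding \<Lambda>_def by (rule dirichlet_eigenvalue_nonneg[OF O(1) Ob O(2)])
  \<comment> \<open>\<open>d * t\<close> bounds the fraction of the mass that is lost; below \<open>t1\<close> it is at most one half.\<close>
  define d where "d = c * (\<Lambda> + 1)"
  have d: "d > 0" using T(1) L0 by (simp add: d_def)
  define K where "K = (1 + c) * (1 + 1) * (1 + 2 * d)"
  have K: "K > 0" using T(1) d by (simp add: K_def)
  define t1 where "t1 = min t0 (1 / (2 * d))"
  have t1: "t1 > 0" "t1 \<le> 1" using T(2,3) d by (auto simp: t1_def)
  have main: "\<Lambda> \<le> (1 + K * t) * penalized_eigenvalue (1 / t ^ 4) \<Omega> D (Suc k)" if t: "0 < t" "t < t1" for t
  proof -
    have tt: "t < t0" "t \<le> 1" using t t1 by (auto simp: t1_def)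
    have td: "d * t \<le> 1/2"
    proof -
      have "t < 1 / (2 * d)" using t by (simp add: t1_def)
      then show ?thesis using d by (simp add: field_simps)
    qed
    define C where "C = 1 / t ^ 4"
    have C: "C > 0" using t by (simp add: C_def)
    interpret D: schroedinger "\<lambda>x. C * indicator (- \<Omega>) x" D C by (rule schroedinger_penalized[OF D Dn O(1) C])
    define \<sigma> where "\<sigma> = penalized_eigenvalue C \<Omega> D (Suc k)"
    have s: "0 \<le> \<sigma>" "\<sigma> \<le> \<Lambda>" unfolding \<sigma>_def \<Lambda>_def
      by (rule penalized_eigenvalue_nonneg[OF D Dn O(1) C], rule penalized_le_dirichlet[OF D O(1-3) C])
    define A where "A = (1 + c * t) * (1 + t) * (1 + 2 * (d * t))"
    have A0: "A > 0" using T(1) t d by (simp add: A_def add_pos_pos)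
    have eps: "\<Lambda> \<le> A * (\<sigma> + \<epsilon>)" if ep: "\<epsilon> > 0" "\<epsilon> \<le> 1" for \<epsilon>
    proof -
      obtain p where p: "\<And>i. i < Suc k \<Longrightarrow> p i \<in> test_functions D"
        "\<And>a. \<exists>i<Suc k. a i \<noteq> 0 \<Longrightarrow> (\<integral>x. (\<Sum>i<Suc k. a i * p i x)\<^sup>2 \<partial>lborel) > 0"
        "\<And>a. energy (lincomb (Suc k) a p) + (\<integral>x. C * indicator (- \<Omega>) x * (\<Sum>i<Suc k. a i * p i x)\<^sup>2 \<partial>lebesgue_on D)
          \<le> (kth_eigenvalue (\<lambda>x. C * indicator (- \<Omega>) x) D (Suc k) + \<epsilon>) * (\<integral>x. (\<Sum>i<Suc k. a i * p i x)\<^sup>2 \<partial>lborel)"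
        using D.kth_eigenvalue_test_space[OF ep(1)] by blast
      define u where "u a = (lincomb (Suc k) a p)" for a
      define N where "N a = (\<integral>x. (u a x)\<^sup>2 \<partial>lborel)" for a
      have pD: "C1c D (p i)" if "i < Suc k" for i by (rule test_C1c[OF p(1)[OF that]])
      have uD: "C1c D (u a)" for a unfolding u_def by (rule C1c_sum) (use pD in auto)
      note uU = C1c_mono[OF uD subset_UNIV]
      have low: "energy (u a) + C * outside_mass \<Omega> (u a) \<le> (\<sigma> + \<epsilon>) * N a" for a
      proof -
        have "energy (u a) + (\<integral>x. C * indicator (- \<Omega>) x * (u a x)\<^sup>2 \<partial>lebesgue_on D) \<le> (\<sigma> + \<epsilon>) * N a"
          unfolding u_def N_def \<sigma>_def penalized_eigenvalue_def by (rule p(3))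
        then show ?thesis unfolding outside_mass_on[OF D(1) O(1) uD] .
      qed
      have Om: "0 \<le> outside_mass \<Omega> (u a)" for a
        unfolding outside_mass_def by (intro integral_nonneg_AE AE_I2) auto
      have N0: "0 \<le> N a" for a by (simp add: N_def)
      define q where "q i = T t (p i)" for i
      have qu: "(lincomb (Suc k) a q) = T t (u a)" for a
        unfolding u_def q_def T(4) ..
      have mass: "N a \<le> (1 + t) * (1 + 2 * (d * t)) * (\<integral>x. (T t (u a) x)\<^sup>2 \<partial>lborel)" for a
      proof -
        have "c / t * outside_mass \<Omega> (u a) \<le> c * t * (C * outside_mass \<Omega> (u a))"
        proof -
          have "t ^ 2 \<le> 1" using t tt by (intro power_le_one) auto
          then have "1 / t \<le> t * C" using t by (simp add: C_def field_simps power2_eq_square power4_eq_xxxx)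
          then have "c * (1 / t) * outside_mass \<Omega> (u a) \<le> c * (t * C) * outside_mass \<Omega> (u a)"
            using T(1) by (intro mult_right_mono mult_left_mono Om) auto
          then show ?thesis by (simp add: mult_ac)
        qed
        then have "N a \<le> (1 + t) * (\<integral>x. (T t (u a) x)\<^sup>2 \<partial>lborel) + c * t * (energy (u a) + C * outside_mass \<Omega> (u a))"
          using T(7)[OF t(1) tt(1) uU[of a]] unfolding N_def by (simp add: distrib_left)
        also have "c * t * (energy (u a) + C * outside_mass \<Omega> (u a)) \<le> c * t * ((\<sigma> + \<epsilon>) * N a)"
          using T(1) t by (intro mult_left_mono low) auto
        also have "\<dots> \<le> d * t * N a"
        proof -
          have "c * t * (\<sigma> + \<epsilon>) \<le> c * t * (\<Lambda> + 1)" using s ep T(1) t by (intro mult_left_mono) auto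
          then have "c * t * (\<sigma> + \<epsilon>) * N a \<le> c * t * (\<Lambda> + 1) * N a" by (intro mult_right_mono N0)
          then show ?thesis by (simp add: d_def mult_ac)
        qed
        finally have 1: "(1 - d * t) * N a \<le> (1 + t) * (\<integral>x. (T t (u a) x)\<^sup>2 \<partial>lborel)" by (simp add: algebra_simps)
        have "0 \<le> d * t * (1 - 2 * (d * t))" using td d t by (intro mult_nonneg_nonneg) auto
        then have "1 \<le> (1 + 2 * (d * t)) * (1 - d * t)" by (simp add: algebra_simps)
        then have "1 * N a \<le> (1 + 2 * (d * t)) * (1 - d * t) * N a" by (intro mult_right_mono N0)
        also have "\<dots> \<le> (1 + 2 * (d * t)) * ((1 + t) * (\<integral>x. (T t (u a) x)\<^sup>2 \<partial>lborel))"
          using d t unfolding mult.assoc[of "1 + 2 * (d * t)"] by (intro mult_left_mono 1) auto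
        finally show ?thesis by (simp add: mult_ac)
      qed
      have en: "energy (T t (u a)) \<le> (1 + c * t) * ((\<sigma> + \<epsilon>) * N a)" for a
      proof -
        have "c / t ^ 3 * outside_mass \<Omega> (u a) = c * t * (C * outside_mass \<Omega> (u a))"
          using t by (simp add: C_def field_simps power3_eq_cube power4_eq_xxxx)
        then have "energy (T t (u a)) \<le> energy (u a) + c * t * (energy (u a) + C * outside_mass \<Omega> (u a))"
          using T(6)[OF t(1) tt(1) uU[of a]] by (simp add: algebra_simps)
        also have "\<dots> \<le> (1 + c * t) * (energy (u a) + C * outside_mass \<Omega> (u a))"
          using mult_nonneg_nonneg[OF less_imp_le[OF C] Om[of a]] by (simp add: algebra_simps)
        also have "\<dots> \<le> (1 + c * t) * ((\<sigma> + \<epsilon>) * N a)"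
          using T(1) t by (intro mult_left_mono low) auto
        finally show ?thesis .
      qed
      have "kth_eigenvalue (\<lambda>x. 0) \<Omega> (Suc k) \<le> A * (\<sigma> + \<epsilon>)"
      proof (rule O.kth_eigenvalue_le)
        show "C1c \<Omega> (q i)" if "i < Suc k" for i
          unfolding q_def by (rule T(5)[OF t(1) tt(1) C1c_mono[OF pD[OF that] subset_UNIV]])
        fix a :: "nat \<Rightarrow> real"
        have qx: "(\<Sum>i<Suc k. a i * q i x) = T t (u a) x" for x using fun_cong[OF qu[of a], of x] by simp
        show "(\<integral>x. (\<Sum>i<Suc k. a i * q i x)\<^sup>2 \<partial>lborel) > 0" if "\<exists>i<Suc k. a i \<noteq> 0"
        proof (rule ccontr)
          assume "\<not> ?thesis"
          then have "(\<integral>x. (T t (u a) x)\<^sup>2 \<partial>lborel) \<le> 0" unfolding qx by simp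
          then have "(1 + t) * (1 + 2 * (d * t)) * (\<integral>x. (T t (u a) x)\<^sup>2 \<partial>lborel) \<le> 0"
            using d t by (intro mult_nonneg_nonpos) auto
          moreover have "N a > 0" unfolding N_def u_def by (rule p(2)[OF that])
          ultimately show False using mass[of a] by linarith
        qed
        have "(1 + c * t) * ((\<sigma> + \<epsilon>) * N a) \<le> (1 + c * t) * ((\<sigma> + \<epsilon>) * ((1 + t) * (1 + 2 * (d * t)) * (\<integral>x. (T t (u a) x)\<^sup>2 \<partial>lborel)))"
          using T(1) t s ep by (intro mult_left_mono mass) auto
        then have "energy (T t (u a)) \<le> A * (\<sigma> + \<epsilon>) * (\<integral>x. (T t (u a) x)\<^sup>2 \<partial>lborel)"
          using en[of a] unfolding A_def by (simp add: mult_ac)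
        then show "energy (lincomb (Suc k) a q) + (\<integral>x. 0 * (\<Sum>i<Suc k. a i * q i x)\<^sup>2 \<partial>lebesgue_on \<Omega>)
          \<le> A * (\<sigma> + \<epsilon>) * (\<integral>x. (\<Sum>i<Suc k. a i * q i x)\<^sup>2 \<partial>lborel)"
          unfolding qx by simp
      qed
      then show ?thesis unfolding \<Lambda>_def dirichlet_eigenvalue_def .
    qed
    have "\<Lambda> \<le> A * \<sigma>"
    proof (rule field_le_epsilon)
      fix e :: real assume e: "e > 0"
      define \<epsilon> where "\<epsilon> = min 1 (e / A)"
      have "\<epsilon> > 0" "\<epsilon> \<le> 1" "A * \<epsilon> \<le> e"
        using e A0 by (auto simp: \<epsilon>_def min_def field_simps)
      then show "\<Lambda> \<le> A * \<sigma> + e" using eps[of \<epsilon>] by (simp add: distrib_left)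
    qed
    also have "A * \<sigma> \<le> (1 + K * t) * \<sigma>"
    proof (rule mult_right_mono[OF _ s(1)])
      have P: "(1 + x * t) * (1 + y * t) \<le> 1 + ((1 + x) * (1 + y) - 1) * t" if "0 \<le> x" "0 \<le> y" for x y
      proof -
        have "x * y * t * t \<le> x * y * t * 1" using that t tt by (intro mult_left_mono) auto
        then show ?thesis by (simp add: algebra_simps)
      qed
      have X: "(1 + c * t) * (1 + t) \<le> 1 + ((1 + c) * (1 + 1) - 1) * t" using P[of c 1] T(1) by simp
      have "0 \<le> 1 + 2 * d * t" using d t by simp
      from mult_right_mono[OF X this] have "A \<le> (1 + ((1 + c) * (1 + 1) - 1) * t) * (1 + 2 * d * t)"
        by (simp only: A_def mult.assoc)
      also have "\<dots> \<le> 1 + ((1 + ((1 + c) * (1 + 1) - 1)) * (1 + 2 * d) - 1) * t"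
        using T(1) d by (intro P) auto
      also have "\<dots> \<le> 1 + K * t" using t by (simp add: K_def algebra_simps)
      finally show "A \<le> 1 + K * t" .
    qed
    finally show ?thesis unfolding \<sigma>_def C_def .
  qed
  show thesis by (rule that[OF K t1]) (use main in \<open>simp add: \<Lambda>_def\<close>)
qed

text \<open>For \<open>C \<ge> C0\<close> the rate is \<open>C powr (- 1/4)\<close>; for smaller \<open>C\<close> the quotient is at most \<open>1\<close>, and the
  right-hand side is made at least \<open>1\<close> by the summand \<open>C0 powr \<alpha>\<close> of the constant.\<close>

theorem theorem1p5:
  fixes D \<Omega> :: "(real ^ 'n) set" and k :: nat
  assumes "bounded D" and "open D"
    and "open \<Omega>" and "\<Omega> \<noteq> {}" and "\<Omega> \<subseteq> D"
    and "C2_boundary \<Omega>"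
    and "k \<ge> 1"
  shows "\<exists>K > 0. \<forall>C > 0.
    \<bar>dirichlet_eigenvalue \<Omega> k - penalized_eigenvalue C \<Omega> D k\<bar> / dirichlet_eigenvalue \<Omega> k
      \<le> K * C powr (- 1 / (real CARD('n) + 4))"
proof -
  obtain j where k: "k = Suc j" using assms(7) by (cases k) auto
  define \<Lambda> where "\<Lambda> = dirichlet_eigenvalue \<Omega> k"
  define \<sigma> where "\<sigma> C = penalized_eigenvalue C \<Omega> D k" for C
  have Ob: "bounded \<Omega>" using assms(1,5) by (rule bounded_subset)
  have Dn: "D \<noteq> {}" using assms(4,5) by auto
  obtain K t1 where K: "K > 0" "t1 > 0" "t1 \<le> 1"
    "\<And>t. 0 < t \<Longrightarrow> t < t1 \<Longrightarrow> \<Lambda> \<le> (1 + K * t) * \<sigma> (1 / t ^ 4)"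
    unfolding \<Lambda>_def \<sigma>_def k by (rule dirichlet_le_penalized[OF assms(2,1,3-6)]) blast
  have L0: "\<Lambda> \<ge> 0" unfolding \<Lambda>_def k by (rule dirichlet_eigenvalue_nonneg[OF assms(3) Ob assms(4)])
  have s: "0 \<le> \<sigma> C" "\<sigma> C \<le> \<Lambda>" if "C > 0" for C
    unfolding \<Lambda>_def \<sigma>_def k
    by (rule penalized_eigenvalue_nonneg[OF assms(2,1) Dn assms(3) that],
        rule penalized_le_dirichlet[OF assms(2,1,3-5) that])
  define \<alpha> where "\<alpha> = 1 / (real CARD('n) + 4)"
  have al: "0 < \<alpha>" "\<alpha> \<le> 1/4" by (auto simp: \<alpha>_def field_simps)
  \<comment> \<open>The factor \<open>2\<close> makes \<open>t = C powr (- 1/4)\<close> strictly smaller than \<open>t1\<close>.\<close>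
  define C0 where "C0 = (2 / t1) powr 4"
  have C0: "C0 > 1"
  proof -
    have "2 / t1 > 1" using K(2,3) by (simp add: field_simps)
    then show ?thesis unfolding C0_def by (intro gr_one_powr) auto
  qed
  have "\<bar>\<Lambda> - \<sigma> C\<bar> / \<Lambda> \<le> (K + C0 powr \<alpha>) * C powr (- \<alpha>)" if C: "C > 0" for C
  proof (cases "C \<ge> C0")
    case True
    define t where "t = C powr (-1/4)"
    have "t ^ 4 = t powr 4" using C by (simp add: t_def powr_numeral)
    also have "\<dots> = C powr (-1)" unfolding t_def powr_powr by simp
    also have "\<dots> = 1 / C" using C by (simp add: powr_minus_divide)
    finally have C4: "1 / t ^ 4 = C" by simp
    have "t \<le> C0 powr (-1/4)" unfolding t_def using True C0 by (intro powr_mono2') auto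
    also have "C0 powr (-1/4) = (2 / t1) powr (-1)" unfolding C0_def powr_powr by simp
    also have "\<dots> = t1 / 2" using K(2) by (simp add: powr_minus)
    finally have t: "0 < t" "t < t1" using C K(2) by (auto simp: t_def)
    have "\<Lambda> - \<sigma> C \<le> K * t * \<sigma> C" using K(4)[OF t] unfolding C4 by (simp add: algebra_simps)
    also have "\<dots> \<le> K * t * \<Lambda>" using K(1) t s(2)[OF C] by (intro mult_left_mono) auto
    finally have "\<bar>\<Lambda> - \<sigma> C\<bar> \<le> K * t * \<Lambda>" using s(2)[OF C] by simp
    then have "\<bar>\<Lambda> - \<sigma> C\<bar> / \<Lambda> \<le> K * t" using L0 K(1) t by (cases "\<Lambda> = 0") (auto simp: divide_le_eq)
    also have "\<dots> \<le> K * C powr (- \<alpha>)"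
      unfolding t_def using K(1) True C0 al by (intro mult_left_mono powr_mono) auto
    also have "\<dots> \<le> (K + C0 powr \<alpha>) * C powr (- \<alpha>)" by (intro mult_right_mono) auto
    finally show ?thesis .
  next
    case False
    have "\<bar>\<Lambda> - \<sigma> C\<bar> / \<Lambda> \<le> 1" using s[OF C] by (cases "\<Lambda> = 0") (auto simp: divide_le_eq)
    also have "1 = C0 powr \<alpha> * C0 powr (- \<alpha>)" using C0 by (simp flip: powr_add)
    also have "\<dots> \<le> C0 powr \<alpha> * C powr (- \<alpha>)"
      using False C al by (intro mult_left_mono powr_mono2') auto
    also have "\<dots> \<le> (K + C0 powr \<alpha>) * C powr (- \<alpha>)" using K(1) by (intro mult_right_mono) auto
    finally show ?thesis .
  qed
  moreover have "K + C0 powr \<alpha> > 0" using K(1) by (simp add: add_pos_nonneg)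
  ultimately show ?thesis
    unfolding \<Lambda>_def \<sigma>_def \<alpha>_def by (intro exI[of _ "K + C0 powr \<alpha>"]) (auto simp: \<alpha>_def)
qed

end
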